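(* Let $0\le s\le s'\le s+1$. There is a constant $C>0$, independent of $h$, such that for every $0<h\le1$ with $h=\pi/N$, $N\in\mathbb N$, each choice of sign $\pm$, and all $u_h^\pm\in X_{h,\pm}^{s',\frac12}$, $v_h^\mp\in X_{h,\mp}^{s',\frac12}$ with mean zero (that is, $\sum_{x\in\mathbb T_h}u_h^\pm(t,x)=\sum_{x\in\mathbb T_h}v_h^\mp(t,x)=0$ for all $t$), $$\left\|\nabla_h\left(u_h^\pm\cdot e^{\pm\frac{2t}{h^2}\partial_h}v_h^\mp\right)\right\|_{Z_{h,\pm}^s}\le C\,h^{s'-s}\,\|u_h^\pm\|_{X_{h,\pm}^{s',\frac12}}\|v_h^\mp\|_{X_{h,\mp}^{s',\frac12}}.$$
   Context: $\mathbb T_h=h\mathbb Z/2\pi\mathbb Z=\{hn:n=-N,\dots,N-1\}$ with $h=\pi/N$, $(\mathbb T_h)^*=\mathbb Z/2N\mathbb Z=\{-N,\dots,N-1\}$. $\nabla_h$ and $\partial_h$ are the Fourier multipliers on $\mathbb T_h$ with symbols $\frac{2i}h\sin(\frac{hk}2)$ and $ik$, $k\in\{-N,\dots,N-1\}$. The space-time Fourier transform of $u_h$ on $\mathbb R\times\mathbb T_h$ is $\widetilde{u_h}(\tau,k)=\frac h{2\pi}\sum_{x\in\mathbb T_h}\int_{\mathbb R}e^{-it\tau}e^{-ixk}u_h(t,x)\,dt$. Let $\langle a\rangle=(1+a^2)^{1/2}$ and $s_h(k)=\frac1{h^2}\big(k-\frac2h\sin(\frac{hk}2)\big)$. The space $X_{h,\pm}^{s,b}$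 is the completion of the functions that are Schwartz in $t$ with respect to $$\|u_h\|_{X_{h,\pm}^{s,b}}^2=\sum_{k\in(\mathbb T_h)^*}\int_{\mathbb R}\langle k\rangle^{2s}\langle\tau\mp s_h(k)\rangle^{2b}|\widetilde{u_h}(\tau,k)|^2\,d\tau,$$ and $$\|u_h\|_{Z_{h,\pm}^s}=\|u_h\|_{X_{h,\pm}^{s,-\frac12}}+\left\|\langle k\rangle^s\langle\tau\mp s_h(k)\rangle^{-1}\widetilde{u_h}(\tau,k)\right\|_{\ell^2_{k\in(\mathbb T_h)^*}L^1_\tau(\mathbb R)}.$$ *)

theory Defs
  imports "HOL-Analysis.Analysis"
begin

section \<open>The discrete torus and Fourier multipliers\<close>

definition mesh :: "nat \<Rightarrow> real"
  where "mesh N = pi / real N"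

definition freqs :: "nat \<Rightarrow> int set"
  where "freqs N = {- int N..<int N}"

definition grid :: "nat \<Rightarrow> real set"
  where "grid N = (\<lambda>n. mesh N * of_int n) ` {- int N..<int N}"

definition dft :: "nat \<Rightarrow> (real \<Rightarrow> complex) \<Rightarrow> int \<Rightarrow> complex"
  where "dft N f k =
    of_real (mesh N / (2 * pi)) * (\<Sum>x\<in>grid N. exp (- (\<i> * of_real x * of_int k)) * f x)"

text \<open>Only the values on \<^term>\<open>grid N\<close> of a function of \<open>x\<close> matter.  The symbols below are not all
  \<open>2N\<close>-periodic in \<open>k\<close>, so the choice of representatives \<^term>\<open>freqs N\<close> is part of the
  definition.\<close>

definition fourier_multiplier ::
    "nat \<Rightarrow> (int \<Rightarrow> complex) \<Rightarrow> (real \<Rightarrow> complex) \<Rightarrow> real \<Rightarrow> complex"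
  where "fourier_multiplier N m f x =
    (\<Sum>k\<in>freqs N. m k * dft N f k * exp (\<i> * of_real x * of_int k))"

definition nabla_symbol :: "nat \<Rightarrow> int \<Rightarrow> complex"
  where "nabla_symbol N k = 2 * \<i> / of_real (mesh N) * of_real (sin (mesh N * of_int k / 2))"

definition partial_symbol :: "int \<Rightarrow> complex"
  where "partial_symbol k = \<i> * of_int k"

definition nabla_h :: "nat \<Rightarrow> (real \<Rightarrow> complex) \<Rightarrow> real \<Rightarrow> complex"
  where "nabla_h N = fourier_multiplier N (nabla_symbol N)"

definition exp_partial_h :: "nat \<Rightarrow> real \<Rightarrow> (real \<Rightarrow> complex) \<Rightarrow> real \<Rightarrow> complex"
  where "exp_partial_h N a = fourier_multiplier N (\<lambda>k. exp (of_real a * partial_symbol k))"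


section \<open>Space-time Fourier transform and norms\<close>

text \<open>A space-time function \<open>u\<close> has arguments \<open>u t x\<close>.\<close>

definition st_fourier :: "nat \<Rightarrow> (real \<Rightarrow> real \<Rightarrow> complex) \<Rightarrow> real \<Rightarrow> int \<Rightarrow> complex"
  where "st_fourier N u \<tau> k = of_real (mesh N / (2 * pi)) *
    (\<Sum>x\<in>grid N. \<integral>t. exp (- (\<i> * of_real t * of_real \<tau>)) * exp (- (\<i> * of_real x * of_int k)) * u t x \<partial>lborel)"

definition jbr :: "real \<Rightarrow> real"
  where "jbr a = (1 + a\<^sup>2) powr (1/2)"

definition disp :: "nat \<Rightarrow> int \<Rightarrow> real"
  where "disp N k = (of_int k - 2 / mesh N * sin (mesh N * of_int k / 2)) / (mesh N)\<^sup>2"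

definition ennsqrt :: "ennreal \<Rightarrow> ennreal"
  where "ennsqrt a = (if a = top then top else ennreal (sqrt (enn2real a)))"

text \<open>The sign \<open>\<plusminus>\<close> is the parameter \<open>\<sigma> \<in> {1, -1}\<close>.  The formula norm \<open>X_pre\<close> is meant for functions
  integrable in \<open>t\<close>, for which \<^const>\<open>st_fourier\<close> is the Fourier transform.\<close>

definition X_pre :: "nat \<Rightarrow> real \<Rightarrow> real \<Rightarrow> real \<Rightarrow> (real \<Rightarrow> real \<Rightarrow> complex) \<Rightarrow> ennreal"
  where "X_pre N \<sigma> s b u = ennsqrt (\<Sum>k\<in>freqs N. \<integral>\<^sup>+\<tau>. ennreal
    (jbr (of_int k) powr (2 * s) * jbr (\<tau> - \<sigma> * disp N k) powr (2 * b) *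
      (cmod (st_fourier N u \<tau> k))\<^sup>2) \<partial>lborel)"

text \<open>\<open>Z_norm\<close> is likewise applied to functions integrable in \<open>t\<close>.  If such a function has finite
  \<open>X_pre N \<sigma> s (-1/2)\<close>, it represents an element of the completion for that norm, whose norm is
  \<open>X_pre N \<sigma> s (-1/2)\<close>.\<close>

definition Z_norm :: "nat \<Rightarrow> real \<Rightarrow> real \<Rightarrow> (real \<Rightarrow> real \<Rightarrow> complex) \<Rightarrow> ennreal"
  where "Z_norm N \<sigma> s u = X_pre N \<sigma> s (-1/2) u +
    ennsqrt (\<Sum>k\<in>freqs N. (\<integral>\<^sup>+\<tau>. ennreal
      (jbr (of_int k) powr s * jbr (\<tau> - \<sigma> * disp N k) powr (-1) *
        cmod (st_fourier N u \<tau> k)) \<partial>lborel)\<^sup>2)"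


section \<open>The completion\<close>

definition schwartz :: "(real \<Rightarrow> complex) \<Rightarrow> bool"
  where "schwartz f \<longleftrightarrow> (\<exists>D :: nat \<Rightarrow> real \<Rightarrow> complex. D 0 = f \<and>
    (\<forall>j t. (D j has_vector_derivative D (Suc j) t) (at t)) \<and>
    (\<forall>j m. bounded (range (\<lambda>t. t ^ m *\<^sub>R D j t))))"

text \<open>For \<open>b \<ge> 0\<close> and fixed \<open>N\<close>, the norm \<open>X_pre N \<sigma> s b\<close> controls the \<open>L\<^sup>2\<close> norm by Plancherel.  Hence a
  Cauchy sequence of functions that are Schwartz in \<open>t\<close> has an \<open>L\<^sup>2\<close> limit, which is zero only if the
  sequence tends to zero in \<open>X_pre N \<sigma> s b\<close>, and the completion is realised as a space of (classes
  of) \<open>L\<^sup>2\<close> functions.  The sequence \<open>\<phi>\<close> below represents the element \<open>u\<close>.\<close>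

definition X_approx :: "nat \<Rightarrow> real \<Rightarrow> real \<Rightarrow> real \<Rightarrow>
    (nat \<Rightarrow> real \<Rightarrow> real \<Rightarrow> complex) \<Rightarrow> (real \<Rightarrow> real \<Rightarrow> complex) \<Rightarrow> bool"
  where "X_approx N \<sigma> s b \<phi> u \<longleftrightarrow>
    (\<forall>n. \<forall>x\<in>grid N. schwartz (\<lambda>t. \<phi> n t x)) \<and>
    (\<forall>e>0. \<exists>M. \<forall>m\<ge>M. \<forall>n\<ge>M. X_pre N \<sigma> s b (\<lambda>t x. \<phi> m t x - \<phi> n t x) < ennreal e) \<and>
    (\<forall>x\<in>grid N. (\<lambda>t. u t x) \<in> borel_measurable lborel) \<and>
    (\<forall>x\<in>grid N. (\<lambda>n. \<integral>\<^sup>+t. ennreal ((cmod (\<phi> n t x - u t x))\<^sup>2) \<partial>lborel) \<longlonglongrightarrow> 0)"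

definition X_space :: "nat \<Rightarrow> real \<Rightarrow> real \<Rightarrow> real \<Rightarrow> (real \<Rightarrow> real \<Rightarrow> complex) set"
  where "X_space N \<sigma> s b = {u. \<exists>\<phi>. X_approx N \<sigma> s b \<phi> u}"

text \<open>The limit does not depend on the choice of the representing sequence (for \<open>b \<ge> 0\<close>).\<close>

definition X_norm :: "nat \<Rightarrow> real \<Rightarrow> real \<Rightarrow> real \<Rightarrow> (real \<Rightarrow> real \<Rightarrow> complex) \<Rightarrow> ennreal"
  where "X_norm N \<sigma> s b u =
    lim (\<lambda>n. X_pre N \<sigma> s b ((SOME \<phi>. X_approx N \<sigma> s b \<phi> u) n))"

text \<open>Elements of the completion are defined up to null sets in \<open>t\<close>.\<close>

definition mean_zero :: "nat \<Rightarrow> (real \<Rightarrow> real \<Rightarrow> complex) \<Rightarrow> bool"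
  where "mean_zero N u \<longleftrightarrow> (AE t in lborel. (\<Sum>x\<in>grid N. u t x) = 0)"

end

theory Submission
  imports Defs "HOL-Probability.Probability"
begin

text \<open>Write \<open>k1\<close>, \<open>k2\<close>, \<open>k\<close> for the frequencies of
  the two inputs and of the output, so \<open>k \<equiv> k1 + k2\<close> modulo \<open>2N\<close>.
  The modulation of the output minus those of the inputs is \<open>\<sigma> H\<close>, where without
  aliasing \<open>H = 8 / h\<^sup>3 * sin (h k2 / 4) * cos (h k / 4) * cos (h k1 / 4)\<close>, and
  with aliasing \<open>\<bar>H\<bar> \<ge> 2 / h\<^sup>3\<close>. Since \<open>k2 \<noteq> 0\<close>
  by the mean zero condition, the largest modulation is at least of the order \<open>\<bar>k2\<bar>
  / h\<^sup>2\<close>, and its square root pays for the derivative, whose symbol together with the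
  weights costs \<open>h powr (s' - s - 1)\<close>. What remains is a gain of \<open>\<bar>k2\<bar>
  powr (-1/2)\<close>, or \<open>sqrt h\<close> for aliased triads, and two modulations.
  Cauchy--Schwarz reduces this to sums over one frequency of \<open>\<bar>k2\<bar> powr (-1)\<close>
  times a negative power of \<open>\<langle>r - \<sigma> H\<rangle>\<close>. They are bounded
  because the values of \<open>H\<close> are separated quadratically (up to a reflection when
  \<open>k2\<close> is fixed); in the aliased case the weight \<open>h\<close> beats the number
  \<open>2N\<close> of terms. Elements of the completion are reached through their Schwartz
  approximations by Fatou's lemma.\<close>

section \<open>Trigonometric lower bounds and brackets\<close>

text \<open>The estimate sits at an endpoint: squared, the modulation weights have exponent
  \<open>-1\<close> and just fail to be integrable. It closes because the resonances within a fibre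
  are not only large but spread out, so that a bracket to the power \<open>-g\<close> sums like
  \<open>n powr (-(2 * g))\<close>. This leaves decay to give away. Two convolved brackets of
  exponent \<open>7/8\<close> keep \<open>5/8\<close>, above the threshold \<open>1/2\<close>. In
  the L1 part of the \<open>Z\<close> norm with a dominant output, one more convolution leaves only
  \<open>1/4\<close>; there the weight \<open>1 / \<bar>k2\<bar>\<close> makes up the difference,
  since \<open>1 + 2 * (1/4) > 1\<close>. With \<open>k2\<close> fixed the weight is constant, but
  that fibre occurs only with \<open>5/8\<close>. The spreading is quadratic and not linear because
  sine and cosine are flat at their extrema, which the frequency range reaches. Throughout, Fourier
  transforms enter by their absolute values, so a one-sided convolution bound replaces the exact
  formula for products.\<close>

lemma jordan_sin:
  fixes x :: real
  assumes "0 \<le> x" "x \<le> pi / 2"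
  shows "2 / pi * x \<le> sin x"
proof -
  have conc: "concave_on {0..pi/2} sin"
    by (rule f''_le0_imp_concave[where f' = cos and f'' = "\<lambda>x. - sin x"])
       (auto intro!: derivative_eq_intros sin_ge_zero)
  define t where "t = 2 / pi * x"
  have t: "0 \<le> t" "t \<le> 1" using assms by (auto simp: t_def field_simps)
  have "sin ((1 - t) *\<^sub>R 0 + t *\<^sub>R (pi/2)) \<ge> (1 - t) * sin 0 + t * sin (pi/2)"
    by (rule concave_onD[OF conc t]) auto
  moreover have "(1 - t) *\<^sub>R 0 + t *\<^sub>R (pi/2) = x" by (simp add: t_def)
  ultimately show ?thesis by (simp add: t_def)
qed

lemma abs_sin_ge:
  fixes x :: real
  assumes "\<bar>x\<bar> \<le> pi / 2"
  shows "2 / pi * \<bar>x\<bar> \<le> \<bar>sin x\<bar>"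
proof (cases "x \<ge> 0")
  case True
  then show ?thesis using jordan_sin[of x] assms by auto
next
  case False
  then show ?thesis using jordan_sin[of "-x"] assms by auto
qed

text \<open>Quadratic, since the derivative vanishes at the ends of the interval. With
  \<open>d\<close> half the distance, the difference is twice \<open>sin d\<close> times the cosine
  of the midpoint. The midpoint lies at distance at least \<open>d\<close> from the ends, so its
  cosine is at least \<open>sin d\<close> too, and the chord bound is applied twice.\<close>

lemma abs_sin_diff_ge:
  fixes x y :: real
  assumes "\<bar>x\<bar> \<le> pi / 2" "\<bar>y\<bar> \<le> pi / 2"
  shows "2 * ((x - y) / pi)\<^sup>2 \<le> \<bar>sin x - sin y\<bar>"
proof -
  have *: "2 * ((x - y) / pi)\<^sup>2 \<le> sin x - sin y"
    if "\<bar>x\<bar> \<le> pi / 2" "\<bar>y\<bar> \<le> pi / 2" "y \<le> x" for x y :: real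
  proof -
    define d where "d = (x - y) / 2"
    have d: "0 \<le> d" "d \<le> pi/2" using that by (auto simp: d_def abs_if split: if_splits)
    have s: "2 / pi * d \<le> sin d" using jordan_sin d by blast
    have "\<bar>(x + y) / 2\<bar> \<le> pi/2 - d" using that by (auto simp: d_def abs_if field_simps split: if_splits)
    then have "cos (pi/2 - d) \<le> cos \<bar>(x + y) / 2\<bar>"
      using d by (intro cos_monotone_0_pi_le) auto
    then have c: "sin d \<le> cos ((x+y)/2)" unfolding cos_abs_real by (simp add: sin_cos_eq[of d])
    have "0 \<le> sin d" using d by (intro sin_ge_zero) auto
    then have "2 * (2 / pi * d)\<^sup>2 \<le> 2 * (sin d * cos ((x+y)/2))"
      unfolding power2_eq_square using s c d
      by (intro mult_left_mono mult_mono) auto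
    also have "\<dots> = sin x - sin y" by (simp add: sin_diff_sin d_def)
    finally have "2 * (2 / pi * d)\<^sup>2 \<le> sin x - sin y" .
    moreover have "2 / pi * d = (x - y) / pi" by (simp add: d_def field_simps)
    ultimately show ?thesis by (simp only:)
  qed
  show ?thesis
  proof (cases "y \<le> x")
    case True
    with *[of x y] assms show ?thesis by simp
  next
    case False
    with *[of y x] assms have "2 * ((y - x) / pi)\<^sup>2 \<le> sin y - sin x" by simp
    moreover have "((y - x) / pi)\<^sup>2 = ((x - y) / pi)\<^sup>2" by (simp add: power2_commute power_divide)
    ultimately show ?thesis by linarith
  qed
qed

text \<open>Both factors of the sum-to-product formula are sines to which the chord bound applies.
  Cosine being even, only the squares of the arguments can be separated; this is the reflection that
  splits the sums with \<open>k2\<close> fixed.\<close>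

lemma abs_cos_diff_ge:
  fixes x y :: real
  assumes "\<bar>x\<bar> \<le> pi / 2" "\<bar>y\<bar> \<le> pi / 2"
  shows "2 / pi\<^sup>2 * \<bar>x\<^sup>2 - y\<^sup>2\<bar> \<le> \<bar>cos x - cos y\<bar>"
proof -
  have "\<bar>x + y\<bar> \<le> pi" "\<bar>y - x\<bar> \<le> pi" using assms by linarith+
  then have *: "\<bar>(x + y) / 2\<bar> \<le> pi/2" "\<bar>(y - x) / 2\<bar> \<le> pi/2" by simp_all
  have a: "2 / pi * \<bar>(x + y) / 2\<bar> \<le> \<bar>sin ((x + y) / 2)\<bar>"
    by (rule abs_sin_ge) (rule *)
  have b: "2 / pi * \<bar>(y - x) / 2\<bar> \<le> \<bar>sin ((y - x) / 2)\<bar>"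
    by (rule abs_sin_ge) (rule *)
  have "2 / pi\<^sup>2 * \<bar>x\<^sup>2 - y\<^sup>2\<bar> = 2 * ((2 / pi * \<bar>(x + y) / 2\<bar>) * (2 / pi * \<bar>(y - x) / 2\<bar>))"
    by (simp add: power2_eq_square square_diff_square_factored abs_mult abs_minus_commute)
  also have "\<dots> \<le> 2 * (\<bar>sin ((x + y) / 2)\<bar> * \<bar>sin ((y - x) / 2)\<bar>)"
    using a b by (intro mult_left_mono mult_mono) auto
  also have "\<dots> = \<bar>cos x - cos y\<bar>" by (simp add: cos_diff_cos abs_mult)
  finally show ?thesis .
qed

section \<open>The Japanese bracket\<close>

lemma jbr_sqrt: "jbr a = sqrt (1 + a\<^sup>2)"
  unfolding jbr_def by (simp add: powr_half_sqrt)

lemma jbr_ge_1: "1 \<le> jbr a"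
  by (simp add: jbr_sqrt)

lemma jbr_pos: "0 < jbr a"
  using jbr_ge_1[of a] by linarith

lemma jbr_ge_abs: "\<bar>a\<bar> \<le> jbr a"
  unfolding jbr_sqrt by (rule real_le_rsqrt) simp

lemma jbr_le: "jbr a \<le> 1 + \<bar>a\<bar>"
  unfolding jbr_sqrt by (rule real_le_lsqrt) (auto simp: power2_sum)

lemma one_plus_abs_le_jbr: "1 + \<bar>a\<bar> \<le> 2 * jbr a"
  using jbr_ge_1[of a] jbr_ge_abs[of a] by linarith

lemma jbr_measurable[measurable]: "jbr \<in> borel_measurable borel"
  unfolding jbr_def by measurable

lemma jbr_minus[simp]: "jbr (- a) = jbr a"
  by (simp add: jbr_def)

section \<open>Sums of brackets at separated points\<close>

lemma int_powr_sum_bound: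
  fixes p :: real
  assumes "p > 1"
  shows "\<exists>C>0. \<forall>S::int set. finite S \<longrightarrow> (\<Sum>j\<in>S. (1 + \<bar>real_of_int j\<bar>) powr (-p)) \<le> C"
proof -
  define f where "f n = real (Suc n) powr (-p)" for n
  have sm: "summable f"
    unfolding f_def using summable_real_powr_iff[of "-p"] assms by (subst summable_Suc_iff) auto
  have f0: "f n \<ge> 0" for n by (simp add: f_def)
  have nn: "(\<Sum>n\<in>T. f n) \<le> suminf f" if "finite T" for T
    by (rule sum_le_suminf[OF sm that]) (simp add: f0)
  have pos: "suminf f > 0"
    by (rule suminf_pos[OF sm]) (simp add: f_def)
  have "(\<Sum>j\<in>S. (1 + \<bar>real_of_int j\<bar>) powr (-p)) \<le> 2 * suminf f" if S: "finite S" for S :: "int set"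
  proof -
    \<comment> \<open>On the nonnegative and on the negative integers \<open>\<bar>j\<bar>\<close>
      is injective, so either half is dominated by the series over \<open>nat\<close>.\<close>
    have *: "(\<Sum>j\<in>T. (1 + \<bar>real_of_int j\<bar>) powr (-p)) \<le> suminf f"
      if "finite T" "inj_on (\<lambda>j. nat \<bar>j\<bar>) T" for T
    proof -
      have "(\<Sum>j\<in>T. (1 + \<bar>real_of_int j\<bar>) powr (-p)) = (\<Sum>j\<in>T. f (nat \<bar>j\<bar>))"
        by (intro sum.cong) (auto simp: f_def)
      also have "\<dots> = (\<Sum>n\<in>(\<lambda>j. nat \<bar>j\<bar>) ` T. f n)"
        using that by (simp add: sum.reindex)
      also have "\<dots> \<le> suminf f" using that by (intro nn) auto
      finally show ?thesis .
    qed
    have "(\<Sum>j\<in>S. (1 + \<bar>real_of_int j\<bar>) powr (-p))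
        = (\<Sum>j\<in>S \<inter> {0..}. (1 + \<bar>real_of_int j\<bar>) powr (-p)) + (\<Sum>j\<in>S - {0..}. (1 + \<bar>real_of_int j\<bar>) powr (-p))"
      by (rule sum.Int_Diff[OF S])
    also have "\<dots> \<le> suminf f + suminf f"
      using S by (intro add_mono *) (auto simp: inj_on_def)
    finally show ?thesis by simp
  qed
  then show ?thesis using pos by (intro exI[of _ "2 * suminf f"]) auto
qed

text \<open>The label \<open>q\<close> belongs to an index \<open>i0\<close> where
  \<open>\<bar>M i\<bar>\<close> is least. Every other \<open>\<bar>M i\<bar>\<close> is then at
  least half of its distance to \<open>M i0\<close>. In \<open>c/8\<close> this half is joined by
  the quarter from \<open>(1 + d)\<^sup>2 \<le> (2 * d)\<^sup>2\<close>; the minimum with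
  \<open>1\<close> covers indices with the same label as \<open>i0\<close>, where only
  \<open>jbr \<ge> 1\<close> is available.\<close>

lemma jbr_separated:
  fixes M :: "'a \<Rightarrow> real" and p :: "'a \<Rightarrow> int"
  assumes c: "c > 0" and fin: "finite I"
    and sep: "\<And>i j. i \<in> I \<Longrightarrow> j \<in> I \<Longrightarrow> c * (real_of_int (p i) - real_of_int (p j))\<^sup>2 \<le> \<bar>M i - M j\<bar>"
  shows "\<exists>q. \<forall>i\<in>I. min 1 (c/8) * (1 + \<bar>real_of_int (p i - q)\<bar>)\<^sup>2 \<le> jbr (M i)"
proof (cases "I = {}")
  case False
  then obtain i0 where i0: "i0 \<in> I" "\<And>i. i \<in> I \<Longrightarrow> \<bar>M i0\<bar> \<le> \<bar>M i\<bar>"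
    using arg_min_if_finite(1)[OF fin, of "\<lambda>i. \<bar>M i\<bar>"] arg_min_least[OF fin, of _ "\<lambda>i. \<bar>M i\<bar>"] by blast
  have "min 1 (c/8) * (1 + \<bar>real_of_int (p i - p i0)\<bar>)\<^sup>2 \<le> jbr (M i)" if i: "i \<in> I" for i
  proof (cases "p i = p i0")
    case True
    then show ?thesis using jbr_ge_1[of "M i"] by simp
  next
    case False
    define d where "d = \<bar>real_of_int (p i - p i0)\<bar>"
    have d1: "d \<ge> 1" unfolding d_def using False by linarith
    have "c * d\<^sup>2 \<le> \<bar>M i - M i0\<bar>" using sep[OF i i0(1)] by (simp add: d_def)
    also have "\<dots> \<le> 2 * \<bar>M i\<bar>" using i0(2)[OF i] by linarith
    finally have 1: "c * d\<^sup>2 / 2 \<le> \<bar>M i\<bar>" by simp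
    have "(1 + d)\<^sup>2 \<le> (2 * d)\<^sup>2" using d1 by (intro power_mono) auto
    then have "(c/8) * (1 + d)\<^sup>2 \<le> (c/8) * (2 * d)\<^sup>2" using c by (intro mult_left_mono) auto
    also have "\<dots> = c * d\<^sup>2 / 2" by (simp add: power_mult_distrib)
    finally have 2: "(c/8) * (1 + d)\<^sup>2 \<le> \<bar>M i\<bar>" using 1 by linarith
    have "min 1 (c/8) * (1 + d)\<^sup>2 \<le> (c/8) * (1 + d)\<^sup>2" by (intro mult_right_mono) auto
    with 2 jbr_ge_abs[of "M i"] show ?thesis by (simp add: d_def)
  qed
  then show ?thesis by blast
qed auto

lemma jbr_separated_powr:
  fixes M :: "'a \<Rightarrow> real" and p :: "'a \<Rightarrow> int"
  assumes c: "c > 0" and fin: "finite I" and g: "g > 0"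
    and sep: "\<And>i j. i \<in> I \<Longrightarrow> j \<in> I \<Longrightarrow> c * (real_of_int (p i) - real_of_int (p j))\<^sup>2 \<le> \<bar>M i - M j\<bar>"
  shows "\<exists>q. \<forall>i\<in>I. jbr (M i) powr (-g) \<le>
    min 1 (c/8) powr (-g) * (1 + \<bar>real_of_int (p i - q)\<bar>) powr (-(2*g))"
proof -
  obtain q where q: "\<forall>i\<in>I. min 1 (c/8) * (1 + \<bar>real_of_int (p i - q)\<bar>)\<^sup>2 \<le> jbr (M i)"
    using jbr_separated[OF c fin, of p M] sep by blast
  show ?thesis
  proof (intro exI ballI)
    fix i assume i: "i \<in> I"
    define d where "d = 1 + \<bar>real_of_int (p i - q)\<bar>"
    have d: "d > 0" unfolding d_def by linarith
    have "jbr (M i) powr (-g) \<le> (min 1 (c/8) * d\<^sup>2) powr (-g)"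
      using q i c d g by (intro powr_mono2') (auto simp: d_def)
    also have "\<dots> = min 1 (c/8) powr (-g) * (d powr 2) powr (-g)"
      using c d by (subst powr_mult) (auto simp: powr_realpow)
    also have "\<dots> = min 1 (c/8) powr (-g) * d powr (-(2*g))"
      by (simp only: powr_powr) simp
    finally show "jbr (M i) powr (-g) \<le>
       min 1 (c/8) powr (-g) * (1 + \<bar>real_of_int (p i - q)\<bar>) powr (-(2*g))" by (simp add: d_def)
  qed
qed

text \<open>Quadratic separation makes the brackets grow like the square of the distance of the
  labels, so \<open>1/2\<close> is the summability threshold. The unknown centre \<open>q\<close>
  does no harm because the bound for lattice sums is translation invariant; hence one constant for
  all index sets and all \<open>M\<close>.\<close>

lemma separated_sum_bound:
  assumes c: "c > 0" and g: "g > (1/2::real)"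
  shows "\<exists>C>0. \<forall>(I :: 'a set) (p :: 'a \<Rightarrow> int) M. finite I \<longrightarrow> inj_on p I \<longrightarrow>
     (\<forall>i\<in>I. \<forall>j\<in>I. c * (real_of_int (p i) - real_of_int (p j))\<^sup>2 \<le> \<bar>M i - M j\<bar>) \<longrightarrow>
     (\<Sum>i\<in>I. jbr (M i) powr (-g)) \<le> C"
proof -
  from int_powr_sum_bound[of "2*g"] g obtain C0 where C0: "C0 > 0"
    "\<And>S::int set. finite S \<Longrightarrow> (\<Sum>j\<in>S. (1 + \<bar>real_of_int j\<bar>) powr (-(2*g))) \<le> C0" by auto
  define K where "K = min 1 (c/8) powr (-g)"
  have K: "K > 0" using c by (simp add: K_def)
  show ?thesis
  proof (intro exI[of _ "K * C0"] conjI allI impI)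
    show "K * C0 > 0" using K C0 by simp
    fix I :: "'a set" and p :: "'a \<Rightarrow> int" and M
    assume fin: "finite I" and inj: "inj_on p I"
      and sep: "\<forall>i\<in>I. \<forall>j\<in>I. c * (real_of_int (p i) - real_of_int (p j))\<^sup>2 \<le> \<bar>M i - M j\<bar>"
    have g0: "g > 0" using g by simp
    obtain q where q: "\<And>i. i\<in>I \<Longrightarrow> jbr (M i) powr (-g) \<le> K * (1 + \<bar>real_of_int (p i - q)\<bar>) powr (-(2*g))"
      using jbr_separated_powr[OF c fin g0, of p M] sep unfolding K_def by blast
    have "(\<Sum>i\<in>I. jbr (M i) powr (-g)) \<le> (\<Sum>i\<in>I. K * (1 + \<bar>real_of_int (p i - q)\<bar>) powr (-(2*g)))"
      by (rule sum_mono[OF q])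
    also have "\<dots> = K * (\<Sum>j\<in>(\<lambda>i. p i - q) ` I. (1 + \<bar>real_of_int j\<bar>) powr (-(2*g)))"
      using inj by (subst sum.reindex) (auto simp: inj_on_def sum_distrib_left)
    also have "\<dots> \<le> K * C0" using K fin by (intro mult_left_mono C0) auto
    finally show "(\<Sum>i\<in>I. jbr (M i) powr (-g)) \<le> K * C0" .
  qed
qed

text \<open>The exponent \<open>1/4\<close> is below the threshold \<open>1/2\<close>, but the
  weight makes up for it: \<open>1 + 2 * (1/4) = 3/2 > 1\<close>. The weight is centred at
  \<open>0\<close> and the bracket at \<open>q\<close>, and these two centres may be far
  apart.\<close>

lemma separated_weighted_sum_bound:
  assumes c: "c > (0::real)"
  shows "\<exists>C>0. \<forall>(I :: 'a set) (p :: 'a \<Rightarrow> int) M. finite I \<longrightarrow> inj_on p I \<longrightarrow>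
     (\<forall>i\<in>I. p i \<noteq> 0) \<longrightarrow>
     (\<forall>i\<in>I. \<forall>j\<in>I. c * (real_of_int (p i) - real_of_int (p j))\<^sup>2 \<le> \<bar>M i - M j\<bar>) \<longrightarrow>
     (\<Sum>i\<in>I. 1 / \<bar>real_of_int (p i)\<bar> * jbr (M i) powr (-(1/4))) \<le> C"
proof -
  from int_powr_sum_bound[of "3/2"] obtain C0 where C0: "C0 > 0"
    "\<And>S::int set. finite S \<Longrightarrow> (\<Sum>j\<in>S. (1 + \<bar>real_of_int j\<bar>) powr (-(3/2))) \<le> C0" by auto
  define K where "K = min 1 (c/8) powr (-(1/4))"
  have K: "K > 0" using c by (simp add: K_def)
  show ?thesis
  proof (intro exI[of _ "K * (2 * (C0 + C0))"] conjI allI impI)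
    show "K * (2 * (C0 + C0)) > 0" using K C0 by simp
    fix I :: "'a set" and p :: "'a \<Rightarrow> int" and M
    assume fin: "finite I" and inj: "inj_on p I" and nz: "\<forall>i\<in>I. p i \<noteq> 0"
      and sep: "\<forall>i\<in>I. \<forall>j\<in>I. c * (real_of_int (p i) - real_of_int (p j))\<^sup>2 \<le> \<bar>M i - M j\<bar>"
    obtain q where q: "\<And>i. i\<in>I \<Longrightarrow> jbr (M i) powr (-(1/4)) \<le> K * (1 + \<bar>real_of_int (p i - q)\<bar>) powr (-(1/2))"
      using jbr_separated_powr[OF c fin, of "1/4" p M] sep unfolding K_def by auto
    \<comment> \<open>A product with two centres is reduced to a sum of two one-centre terms by
      replacing the larger of the two bases by the smaller. The \<open>2\<close> comes from
      \<open>1 / \<bar>a\<bar> \<le> 2 / (1 + \<bar>a\<bar>)\<close>, valid for integers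
      \<open>a \<noteq> 0\<close>.\<close>
    have young: "1 / \<bar>real_of_int a\<bar> * (1 + \<bar>real_of_int b\<bar>) powr (-(1/2))
       \<le> 2 * ((1 + \<bar>real_of_int a\<bar>) powr (-(3/2)) + (1 + \<bar>real_of_int b\<bar>) powr (-(3/2)))" if "a \<noteq> 0" for a b
    proof -
      define A where "A = 1 + \<bar>real_of_int a\<bar>"
      define B where "B = 1 + \<bar>real_of_int b\<bar>"
      have a1: "1 \<le> \<bar>real_of_int a\<bar>" using that by linarith
      have AB: "A \<ge> 1" "B \<ge> 1" by (auto simp: A_def B_def)
      have "1 / \<bar>real_of_int a\<bar> \<le> 2 / A" using a1 by (simp add: A_def field_simps)
      also have "2 / A = 2 * A powr (-1)" using AB by (simp add: powr_minus_divide)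
      finally have "1 / \<bar>real_of_int a\<bar> * B powr (-(1/2)) \<le> 2 * A powr (-1) * B powr (-(1/2))"
        by (intro mult_right_mono) auto
      moreover have "A powr (-1) * B powr (-(1/2)) \<le> A powr (-(3/2)) + B powr (-(3/2))"
      proof (cases "A \<le> B")
        case True
        then have "B powr (-(1/2)) \<le> A powr (-(1/2))" using AB by (intro powr_mono2') auto
        then have "A powr (-1) * B powr (-(1/2)) \<le> A powr (-1) * A powr (-(1/2))" by (intro mult_left_mono) auto
        also have "\<dots> = A powr (-(3/2))" by (subst powr_add[symmetric]) simp
        finally show ?thesis by (simp add: add_increasing2)
      next
        case False
        then have "A powr (-1) \<le> B powr (-1)" using AB by (intro powr_mono2') auto
        then have "A powr (-1) * B powr (-(1/2)) \<le> B powr (-1) * B powr (-(1/2))" by (intro mult_right_mono) auto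
        also have "\<dots> = B powr (-(3/2))" by (subst powr_add[symmetric]) simp
        finally show ?thesis by (simp add: add_increasing)
      qed
      ultimately show ?thesis by (simp add: A_def B_def)
    qed
    have "(\<Sum>i\<in>I. 1 / \<bar>real_of_int (p i)\<bar> * jbr (M i) powr (-(1/4)))
      \<le> (\<Sum>i\<in>I. K * (2 * ((1 + \<bar>real_of_int (p i)\<bar>) powr (-(3/2)) + (1 + \<bar>real_of_int (p i - q)\<bar>) powr (-(3/2)))))"
    proof (rule sum_mono)
      fix i assume i: "i \<in> I"
      have "1 / \<bar>real_of_int (p i)\<bar> * jbr (M i) powr (-(1/4))
        \<le> 1 / \<bar>real_of_int (p i)\<bar> * (K * (1 + \<bar>real_of_int (p i - q)\<bar>) powr (-(1/2)))"
        by (intro mult_left_mono q i) auto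
      also have "\<dots> = K * (1 / \<bar>real_of_int (p i)\<bar> * (1 + \<bar>real_of_int (p i - q)\<bar>) powr (-(1/2)))" by simp
      also have "\<dots> \<le> K * (2 * ((1 + \<bar>real_of_int (p i)\<bar>) powr (-(3/2)) + (1 + \<bar>real_of_int (p i - q)\<bar>) powr (-(3/2))))"
        using K i nz by (intro mult_left_mono young) auto
      finally show "1 / \<bar>real_of_int (p i)\<bar> * jbr (M i) powr (-(1/4)) \<le> \<dots>" .
    qed
    also have "\<dots> = K * (2 * ((\<Sum>j\<in>p ` I. (1 + \<bar>real_of_int j\<bar>) powr (-(3/2)))
         + (\<Sum>j\<in>(\<lambda>i. p i - q) ` I. (1 + \<bar>real_of_int j\<bar>) powr (-(3/2)))))"
      using inj by (subst (1 2) sum.reindex) (auto simp: inj_on_def sum.distrib simp flip: sum_distrib_left)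
    also have "\<dots> \<le> K * (2 * (C0 + C0))" using K fin by (intro mult_left_mono add_mono C0) auto
    finally show "(\<Sum>i\<in>I. 1 / \<bar>real_of_int (p i)\<bar> * jbr (M i) powr (-(1/4))) \<le> K * (2 * (C0 + C0))" .
  qed
qed

section \<open>The resonance function\<close>

lemma mesh_pos: "N > 0 \<Longrightarrow> mesh N > 0"
  by (simp add: mesh_def)

lemma freqs_mesh:
  assumes "N > 0" "k \<in> freqs N"
  shows "\<bar>mesh N * of_int k\<bar> \<le> pi"
proof -
  have "\<bar>real_of_int k\<bar> \<le> real N" using assms(2) by (auto simp: freqs_def abs_le_iff)
  then have "mesh N * \<bar>real_of_int k\<bar> \<le> mesh N * real N"
    using mesh_pos[OF assms(1)] by (intro mult_left_mono) auto
  also have "\<dots> = pi" using assms(1) by (simp add: mesh_def)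
  finally show ?thesis using mesh_pos[OF assms(1)] by (simp add: abs_mult)
qed

section \<open>Frequency triads and aliasing\<close>

lemma freqs_cong_unique:
  assumes "a \<in> freqs N" "b \<in> freqs N" "2 * int N dvd a - b"
  shows "a = b"
proof (rule ccontr)
  assume "a \<noteq> b"
  then have "\<bar>2 * int N\<bar> \<le> \<bar>a - b\<bar>" using assms(3) by (intro dvd_imp_le_int) auto
  then show False using assms(1,2) by (auto simp: freqs_def)
qed

text \<open>Products of grid functions see frequencies only modulo \<open>2 * N\<close>, so a triad
  may wrap around. The inputs omit \<open>0\<close>, the frequency that mean zero removes, whereas
  the output may be \<open>0\<close>.\<close>

definition triads :: "nat \<Rightarrow> (int \<times> int \<times> int) set"
  where "triads N = {(k1, k2, k). k1 \<in> freqs N - {0} \<and> k2 \<in> freqs N - {0} \<and> k \<in> freqs N \<and>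
    2 * int N dvd k1 + k2 - k}"

text \<open>For \<open>\<sigma> = 1\<close> this is \<open>x - y - z\<close>, where \<open>x = \<tau> - disp N k\<close> is the modulation of the output and
  \<open>y = \<tau>1 - disp N k1\<close>, \<open>z = \<tau>2 + disp N k2\<close> are those of the inputs: the propagator shifts the
  time frequency \<open>\<tau>2\<close> of the second factor, so that \<open>\<tau> = \<tau>1 + \<tau>2 + 2 k2 / h\<^sup>2\<close>.\<close>

definition resonance :: "nat \<Rightarrow> int \<times> int \<times> int \<Rightarrow> real"
  where "resonance N = (\<lambda>(k1, k2, k). disp N k1 - disp N k2 - disp N k + 2 * of_int k2 / (mesh N)\<^sup>2)"

text \<open>Square of the factor that \<open>1 / h\<close> is traded for by the largest modulation.\<close>

definition res_weight :: "nat \<Rightarrow> int \<times> int \<times> int \<Rightarrow> real"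
  where "res_weight N i = 3 / ((mesh N)\<^sup>2 * \<bar>resonance N i\<bar>)"

lemma res_weight_nonneg: "0 \<le> res_weight N i"
  by (simp add: res_weight_def)

lemma finite_triads: "finite (triads N)"
  by (rule finite_subset[of _ "freqs N \<times> freqs N \<times> freqs N"]) (auto simp: triads_def freqs_def)

text \<open>Two entries fix the third modulo \<open>2 * N\<close>, and \<open>freqs N\<close> holds
  at most one representative of each class. Every fibre below can therefore be indexed by a single
  frequency.\<close>

lemma triads_determined:
  assumes "i \<in> triads N" "j \<in> triads N"
  shows "fst i = fst j \<Longrightarrow> fst (snd i) = fst (snd j) \<Longrightarrow> i = j"
    and "fst i = fst j \<Longrightarrow> snd (snd i) = snd (snd j) \<Longrightarrow> i = j"
    and "fst (snd i) = fst (snd j) \<Longrightarrow> snd (snd i) = snd (snd j) \<Longrightarrow> i = j"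
proof -
  obtain a b c where i: "i = (a, b, c)" by (cases i)
  obtain a' b' c' where j: "j = (a', b', c')" by (cases j)
  have d: "2 * int N dvd a + b - c" "2 * int N dvd a' + b' - c'"
    and f: "a \<in> freqs N" "b \<in> freqs N" "c \<in> freqs N" "a' \<in> freqs N" "b' \<in> freqs N" "c' \<in> freqs N"
    using assms by (auto simp: triads_def i j)
  have d3: "2 * int N dvd (a + b - c) - (a' + b' - c')" using d by (rule dvd_diff)
  show "fst i = fst j \<Longrightarrow> fst (snd i) = fst (snd j) \<Longrightarrow> i = j"
    using d3 freqs_cong_unique[OF f(6) f(3)] by (auto simp: i j)
  show "fst i = fst j \<Longrightarrow> snd (snd i) = snd (snd j) \<Longrightarrow> i = j"
    using d3 freqs_cong_unique[OF f(2) f(5)] by (auto simp: i j)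
  show "fst (snd i) = fst (snd j) \<Longrightarrow> snd (snd i) = snd (snd j) \<Longrightarrow> i = j"
    using d3 freqs_cong_unique[OF f(1) f(4)] by (auto simp: i j)
qed

text \<open>At most one wrap fits into the range of three frequencies. Its direction forces the sign
  of \<open>k2\<close>, strictly so because the frequency range is half-open. The sign shows later
  that \<open>sin (h * k2 / 2)\<close> does not work against the wrap.\<close>

lemma triads_alias_cases:
  assumes "(k1, k2, k) \<in> triads N" "k1 + k2 \<noteq> k"
  shows "k1 + k2 - k = 2 * int N \<and> k2 > 0 \<or> k1 + k2 - k = - (2 * int N) \<and> k2 < 0"
proof -
  from assms obtain m where m: "k1 + k2 - k = 2 * int N * m" by (auto simp: triads_def)
  have r: "- int N \<le> k1" "k1 < int N" "- int N \<le> k2" "k2 < int N" "- int N \<le> k" "k < int N"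
    using assms by (auto simp: triads_def freqs_def)
  have "N > 0" using r by linarith
  have "int N * (2 * m) < int N * 4" "int N * (-4) < int N * (2 * m)" using m r by linarith+
  then have "2 * m < 4" "-4 < 2 * m"
    using \<open>N > 0\<close> by (simp_all only: mult_less_cancel_left_pos of_nat_0_less_iff)
  moreover have "m \<noteq> 0" using m assms(2) by auto
  ultimately have "m = 1 \<or> m = -1" by linarith
  then show ?thesis using m r by auto
qed

text \<open>The propagator term \<open>2 * k2 / h\<^sup>2\<close> reverses the sign of the linear
  part of \<open>- disp N k2\<close>, so that the linear parts add up to the wrap
  \<open>k1 + k2 - k\<close>: zero without aliasing, \<open>2 * N\<close> in absolute value with
  it.\<close>

lemma resonance_cubed:
  assumes "N > 0"
  shows "mesh N ^ 3 * resonance N (k1, k2, k) = mesh N * of_int (k1 + k2 - k)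
    + 2 * (sin (mesh N * of_int k / 2) - sin (mesh N * of_int k1 / 2) + sin (mesh N * of_int k2 / 2))"
  using mesh_pos[OF assms]
  by (simp add: resonance_def disp_def field_simps power2_eq_square power3_eq_cube)

text \<open>Sum-to-product twice: the first difference yields \<open>sin b\<close>, and the cosine
  left over combines with the \<open>cos b\<close> from the double angle in
  \<open>sin (2 * b)\<close>.\<close>

lemma sin_resonance_identity:
  fixes a b :: real
  shows "sin (2 * (a + b)) - sin (2 * a) + sin (2 * b) = 4 * sin b * cos (a + b) * cos a"
proof -
  have "sin (2 * (a + b)) - sin (2 * a) = 2 * sin ((2 * (a + b) - 2 * a) / 2) * cos ((2 * (a + b) + 2 * a) / 2)"
    by (rule sin_diff_sin)
  also have "(2 * (a + b) - 2 * a) / 2 = b" by (simp add: field_simps)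
  also have "(2 * (a + b) + 2 * a) / 2 = 2 * a + b" by (simp add: field_simps)
  finally have "sin (2 * (a + b)) - sin (2 * a) = 2 * sin b * cos (2 * a + b)" .
  moreover have "cos (2 * a + b) + cos b = 2 * cos (a + b) * cos a"
    by (simp add: cos_plus_cos add_divide_distrib add.commute)
  moreover have "sin (2 * b) = 2 * sin b * cos b" by (rule sin_double)
  ultimately have "sin (2 * (a + b)) - sin (2 * a) + sin (2 * b) = 2 * sin b * (2 * cos (a + b) * cos a)"
    by (metis distrib_left)
  then show ?thesis by simp
qed

lemma resonance_unaliased:
  assumes "N > 0" "k = k1 + k2"
  shows "resonance N (k1, k2, k) = 8 / mesh N ^ 3 * (sin (mesh N * of_int k2 / 4) *
     cos (mesh N * of_int k / 4) * cos (mesh N * of_int k1 / 4))"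
proof -
  define a b where "a = mesh N * of_int k1 / 4" and "b = mesh N * of_int k2 / 4"
  have "mesh N ^ 3 * resonance N (k1, k2, k) = 2 * (sin (2 * (a + b)) - sin (2 * a) + sin (2 * b))"
    unfolding resonance_cubed[OF assms(1)] assms(2) by (simp add: a_def b_def algebra_simps add_divide_distrib)
  also have "\<dots> = 8 * (sin b * cos (a + b) * cos a)" unfolding sin_resonance_identity by simp
  also have "a + b = mesh N * of_int k / 4" by (simp add: a_def b_def assms(2) algebra_simps add_divide_distrib)
  finally show ?thesis using mesh_pos[OF assms(1)] by (simp add: a_def b_def field_simps)
qed

lemma freqs_quarter:
  assumes "N > 0" "k \<in> freqs N"
  shows "\<bar>mesh N * of_int k / 4\<bar> \<le> pi / 4"
  using freqs_mesh[OF assms] by simp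

lemma cos_quarter_ge:
  fixes x :: real
  assumes "\<bar>x\<bar> \<le> pi / 4"
  shows "sqrt 2 / 2 \<le> cos x"
proof -
  have "cos (pi/4) \<le> cos \<bar>x\<bar>" using assms by (intro cos_monotone_0_pi_le) auto
  then show ?thesis by (simp add: cos_45)
qed

text \<open>Quarter angles stay within \<open>pi / 4\<close>: both cosines are at least
  \<open>sqrt 2 / 2\<close>, and the chord bound applies to the sine of \<open>k2\<close>. Hence the
  resonance is at least \<open>2 * \<bar>k2\<bar> / (pi * h\<^sup>2)\<close> in absolute value; the
  constant \<open>5\<close> rounds up \<open>3 * pi / 2\<close>.\<close>

lemma res_weight_unaliased:
  assumes N: "N > 0" and t: "(k1, k2, k) \<in> triads N" and k: "k1 + k2 = k"
  shows "res_weight N (k1, k2, k) \<le> 5 / \<bar>of_int k2\<bar>" and "resonance N (k1, k2, k) \<noteq> 0"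
proof -
  define h where "h = mesh N"
  have h: "h > 0" using mesh_pos[OF N] by (simp add: h_def)
  have f: "k1 \<in> freqs N" "k2 \<in> freqs N" "k \<in> freqs N" "k2 \<noteq> 0" using t by (auto simp: triads_def)
  have k2: "\<bar>real_of_int k2\<bar> > 0" using f(4) by simp
  have s: "2 / pi * \<bar>h * of_int k2 / 4\<bar> \<le> \<bar>sin (h * of_int k2 / 4)\<bar>"
    using freqs_quarter[OF N f(2)] pi_gt_zero by (intro abs_sin_ge) (auto simp: h_def)
  have c: "sqrt 2 / 2 \<le> cos (h * of_int k / 4)" "sqrt 2 / 2 \<le> cos (h * of_int k1 / 4)"
    using cos_quarter_ge freqs_quarter[OF N] f by (auto simp: h_def)
  have cc: "1/2 \<le> cos (h * of_int k / 4) * cos (h * of_int k1 / 4)"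
  proof -
    have "1/2 = (sqrt 2 / 2) * (sqrt 2 / 2)" by simp
    also have "\<dots> \<le> cos (h * of_int k / 4) * cos (h * of_int k1 / 4)"
      using c by (intro mult_mono) (auto intro: order_trans[of 0 "sqrt 2 / 2"])
    finally show ?thesis .
  qed
  have "8 / h ^ 3 * ((2 / pi * (h * \<bar>of_int k2\<bar> / 4)) * (1/2))
     \<le> 8 / h ^ 3 * (\<bar>sin (h * of_int k2 / 4)\<bar> * \<bar>cos (h * of_int k / 4) * cos (h * of_int k1 / 4)\<bar>)"
    using s h by (intro mult_left_mono mult_mono order_trans[OF cc abs_ge_self]) (auto simp: abs_mult)
  also have "\<dots> = \<bar>resonance N (k1, k2, k)\<bar>"
    using h by (simp add: resonance_unaliased[OF N k[symmetric]] abs_mult h_def)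
  finally have low: "2 * \<bar>of_int k2\<bar> / (pi * h\<^sup>2) \<le> \<bar>resonance N (k1, k2, k)\<bar>"
    using h by (simp add: field_simps power2_eq_square power3_eq_cube)
  have pos: "2 * \<bar>of_int k2\<bar> / (pi * h\<^sup>2) > 0" using k2 h by simp
  then show "resonance N (k1, k2, k) \<noteq> 0" using low by auto
  have "res_weight N (k1, k2, k) \<le> 3 / (h\<^sup>2 * (2 * \<bar>of_int k2\<bar> / (pi * h\<^sup>2)))"
    unfolding res_weight_def h_def[symmetric]
    using low pos h by (intro divide_left_mono mult_left_mono mult_pos_pos) auto
  also have "\<dots> = (3 * pi / 2) / \<bar>of_int k2\<bar>" using h by (simp add: field_simps)
  also have "\<dots> \<le> 5 / \<bar>of_int k2\<bar>"
    using k2 pi_less_4 pi_approx by (intro divide_right_mono) auto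
  finally show "res_weight N (k1, k2, k) \<le> 5 / \<bar>of_int k2\<bar>" .
qed

text \<open>The wrap contributes \<open>2 * pi\<close> in absolute value. Of the three sines the one
  of \<open>k2\<close> has the sign of the wrap, so the sines can cancel at most \<open>4\<close>,
  and \<open>2 * pi - 4 > 2\<close> remains. The constant \<open>2\<close> rounds up
  \<open>3 / 2\<close>.\<close>

lemma res_weight_aliased:
  assumes N: "N > 0" and t: "(k1, k2, k) \<in> triads N" and k: "k1 + k2 \<noteq> k"
  shows "res_weight N (k1, k2, k) \<le> 2 * mesh N" and "resonance N (k1, k2, k) \<noteq> 0"
proof -
  define h where "h = mesh N"
  have h: "h > 0" using mesh_pos[OF N] by (simp add: h_def)
  have f: "k2 \<in> freqs N" using t by (auto simp: triads_def)
  define S where "S = sin (h * of_int k / 2) - sin (h * of_int k1 / 2) + sin (h * of_int k2 / 2)"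
  have hN: "h * (2 * real N) = 2 * pi" using N by (simp add: h_def mesh_def)
  have ident: "h ^ 3 * resonance N (k1, k2, k) = h * of_int (k1 + k2 - k) + 2 * S"
    using resonance_cubed[OF N] by (simp add: h_def S_def)
  have b: "\<bar>h * of_int k2\<bar> \<le> pi" using freqs_mesh[OF N f] by (simp add: h_def)
  have "2 \<le> \<bar>h ^ 3 * resonance N (k1, k2, k)\<bar>"
    using triads_alias_cases[OF t k]
  proof (elim disjE conjE)
    assume e: "k1 + k2 - k = 2 * int N" and p: "k2 > 0"
    have "0 \<le> h * of_int k2" using p h by simp
    then have "0 \<le> sin (h * of_int k2 / 2)" using b pi_gt_zero by (intro sin_ge_zero) linarith+
    then have "S \<ge> -2" using sin_ge_minus_one[of "h * of_int k / 2"] sin_le_one[of "h * of_int k1 / 2"]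
      unfolding S_def by linarith
    moreover have "h * of_int (k1 + k2 - k) = 2 * pi" unfolding e using hN by simp
    ultimately show ?thesis using ident pi_gt3 by linarith
  next
    assume e: "k1 + k2 - k = - (2 * int N)" and p: "k2 < 0"
    have "h * of_int k2 \<le> 0" using p h by (simp add: mult_le_0_iff)
    then have "0 \<le> sin (- (h * of_int k2 / 2))" using b pi_gt_zero by (intro sin_ge_zero) linarith+
    then have "S \<le> 2" using sin_ge_minus_one[of "h * of_int k1 / 2"] sin_le_one[of "h * of_int k / 2"]
      unfolding S_def sin_minus by linarith
    moreover have "h * of_int (k1 + k2 - k) = - (2 * pi)" unfolding e using hN by simp
    ultimately show ?thesis using ident pi_gt3 by linarith
  qed
  then have low: "2 / h ^ 3 \<le> \<bar>resonance N (k1, k2, k)\<bar>" using h by (simp add: abs_mult field_simps)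
  have pos: "2 / h ^ 3 > 0" using h by simp
  then show "resonance N (k1, k2, k) \<noteq> 0" using low by auto
  have "res_weight N (k1, k2, k) \<le> 3 / (h\<^sup>2 * (2 / h ^ 3))"
    unfolding res_weight_def h_def[symmetric]
    using low pos h by (intro divide_left_mono mult_left_mono mult_pos_pos) auto
  also have "\<dots> = 3 / 2 * h" using h by (simp add: field_simps power2_eq_square power3_eq_cube)
  also have "\<dots> \<le> 2 * h" using h by simp
  finally show "res_weight N (k1, k2, k) \<le> 2 * mesh N" by (simp add: h_def)
qed

lemma resonance_nonzero:
  assumes "N > 0" "i \<in> triads N"
  shows "resonance N i \<noteq> 0"
  using assms res_weight_unaliased(2) res_weight_aliased(2) by (cases i) metis

text \<open>With the output or the first input fixed, the resonance is an amplitude of order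
  \<open>1 / h ^ 3\<close> times a shifted sine of one free integer \<open>m\<close>. Separation of
  the sines costs \<open>h\<^sup>2\<close>, which leaves \<open>1 / h\<close>, at least
  \<open>1\<close>. The halved difference anticipates that \<open>m\<close> moves by
  \<open>2\<close> when \<open>k2\<close> moves by \<open>1\<close>.\<close>

lemma sin_form_separation:
  fixes m m' :: real
  assumes h: "0 < h" "h \<le> 1" and u: "\<bar>u\<bar> \<le> pi / 4"
    and m: "\<bar>h * m / 4\<bar> \<le> pi / 2" "\<bar>h * m' / 4\<bar> \<le> pi / 2"
  shows "1 / pi\<^sup>2 * ((m - m') / 2)\<^sup>2 \<le>
    \<bar>4 / h ^ 3 * cos u * (r + sin (h * m / 4)) - 4 / h ^ 3 * cos u * (r + sin (h * m' / 4))\<bar>"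
proof -
  have c: "1/2 \<le> cos u"
  proof -
    have "1 \<le> sqrt 2" by simp
    then show ?thesis using cos_quarter_ge[OF u] by linarith
  qed
  have "1 / pi\<^sup>2 * ((m - m') / 2)\<^sup>2 \<le> 1 / h * (1 / pi\<^sup>2 * ((m - m') / 2)\<^sup>2)"
  proof -
    have "1 * (1 / pi\<^sup>2 * ((m - m') / 2)\<^sup>2) \<le> 1 / h * (1 / pi\<^sup>2 * ((m - m') / 2)\<^sup>2)"
      using h by (intro mult_right_mono) auto
    then show ?thesis by simp
  qed
  also have "\<dots> = 4 / h ^ 3 * (1/2) * (2 * ((h * m / 4 - h * m' / 4) / pi)\<^sup>2)"
    using h by (simp add: power2_eq_square power3_eq_cube field_simps)
  also have "\<dots> \<le> 4 / h ^ 3 * cos u * \<bar>sin (h * m / 4) - sin (h * m' / 4)\<bar>"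
    using c h by (intro mult_mono abs_sin_diff_ge m mult_left_mono mult_nonneg_nonneg) auto
  also have "\<dots> = \<bar>4 / h ^ 3 * cos u * (sin (h * m / 4) - sin (h * m' / 4))\<bar>"
    using c h by (simp add: abs_mult)
  also have "4 / h ^ 3 * cos u * (sin (h * m / 4) - sin (h * m' / 4)) =
     4 / h ^ 3 * cos u * (r + sin (h * m / 4)) - 4 / h ^ 3 * cos u * (r + sin (h * m' / 4))"
    by (simp only: right_diff_distrib distrib_left add_diff_cancel_left)
  finally show ?thesis .
qed

text \<open>The sine in \<open>k2\<close> and the cosine in \<open>k1\<close> combine to sines of
  \<open>h * k / 4\<close> and \<open>h * (k2 - k1) / 4\<close>. The second angle stays between
  \<open>- pi / 2\<close> and \<open>pi / 2\<close>, where sine is injective, so no reflection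
  occurs in this fibre.\<close>

lemma resonance_separation_k:
  assumes N: "N > 0" "mesh N \<le> 1" and t: "(a, b, k) \<in> triads N" "(a', b', k) \<in> triads N"
    and k: "a + b = k" "a' + b' = k"
  shows "1 / pi\<^sup>2 * (of_int b - of_int b')\<^sup>2 \<le> \<bar>resonance N (a, b, k) - resonance N (a', b', k)\<bar>"
proof -
  define h where "h = mesh N"
  have h: "h > 0" "h \<le> 1" using mesh_pos[OF N(1)] N by (auto simp: h_def)
  have form: "resonance N (a, b, k) = 4 / h ^ 3 * cos (h * of_int k / 4) *
      (sin (h * of_int k / 4) + sin (h * of_int (b - a) / 4))" if "a + b = k" for a b
  proof -
    have "2 * (sin (h * of_int b / 4) * cos (h * of_int a / 4)) = sin (h * of_int k / 4) + sin (h * of_int (b - a) / 4)"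
      unfolding sin_times_cos that[symmetric] by (simp add: algebra_simps add_divide_distrib diff_divide_distrib)
    then show ?thesis unfolding resonance_unaliased[OF N(1) that[symmetric]] h_def[symmetric] 
      by (simp add: mult.commute mult.left_commute)
  qed
  have r: "\<bar>h * of_int (b - a) / 4\<bar> \<le> pi / 2" if "(a, b, k) \<in> triads N" for a b
  proof -
    have "\<bar>h * of_int a\<bar> \<le> pi" "\<bar>h * of_int b\<bar> \<le> pi"
      using freqs_mesh[OF N(1)] that by (auto simp: triads_def h_def)
    moreover have "h * of_int (b - a) / 4 = h * of_int b / 4 - h * of_int a / 4" by (simp add: algebra_simps diff_divide_distrib)
    ultimately show ?thesis by (simp only: abs_le_iff) linarith
  qed
  have "1 / pi\<^sup>2 * ((of_int (b - a) - of_int (b' - a')) / 2)\<^sup>2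
     \<le> \<bar>resonance N (a, b, k) - resonance N (a', b', k)\<bar>"
    unfolding form[OF k(1)] form[OF k(2)]
    using freqs_quarter[OF N(1), of k] t by (intro sin_form_separation h r) (auto simp: triads_def h_def)
  moreover have "(real_of_int (b - a) - real_of_int (b' - a')) / 2 = real_of_int b - real_of_int b'"
  proof -
    have "real_of_int a + real_of_int b = real_of_int a' + real_of_int b'" using k by (metis of_int_add)
    then show ?thesis by simp
  qed
  ultimately show ?thesis by (simp only:)
qed

text \<open>Here the factors in \<open>k2\<close> and \<open>k\<close> are combined, and
  \<open>k2 + k\<close> is the free integer; it moves twice as fast as \<open>k2\<close>.\<close>

lemma resonance_separation_k1:
  assumes N: "N > 0" "mesh N \<le> 1" and t: "(a, b, k) \<in> triads N" "(a, b', k') \<in> triads N"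
    and k: "a + b = k" "a + b' = k'"
  shows "1 / pi\<^sup>2 * (of_int b - of_int b')\<^sup>2 \<le> \<bar>resonance N (a, b, k) - resonance N (a, b', k')\<bar>"
proof -
  define h where "h = mesh N"
  have h: "h > 0" "h \<le> 1" using mesh_pos[OF N(1)] N by (auto simp: h_def)
  have form: "resonance N (a, b, k) = 4 / h ^ 3 * cos (h * of_int a / 4) *
      (sin (h * of_int (- a) / 4) + sin (h * of_int (b + k) / 4))" if "a + b = k" for b k
  proof -
    have e: "sin (h * of_int (- a) / 4) = sin (h * of_int b / 4 - h * of_int k / 4)"
      by (rule arg_cong[where f = sin]) (simp add: that[symmetric] algebra_simps add_divide_distrib)
    have "2 * (sin (h * of_int b / 4) * cos (h * of_int k / 4)) = sin (h * of_int (- a) / 4) + sin (h * of_int (b + k) / 4)"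
      unfolding sin_times_cos e by (simp add: algebra_simps add_divide_distrib)
    then show ?thesis unfolding resonance_unaliased[OF N(1) that[symmetric]] h_def[symmetric] 
      by (simp add: mult.commute mult.left_commute)
  qed
  have r: "\<bar>h * of_int (b + k) / 4\<bar> \<le> pi / 2" if "(a, b, k) \<in> triads N" for b k
  proof -
    have "\<bar>h * of_int k\<bar> \<le> pi" "\<bar>h * of_int b\<bar> \<le> pi"
      using freqs_mesh[OF N(1)] that by (auto simp: triads_def h_def)
    moreover have "h * of_int (b + k) / 4 = h * of_int b / 4 + h * of_int k / 4" by (simp add: algebra_simps add_divide_distrib)
    ultimately show ?thesis by (simp only: abs_le_iff) linarith
  qed
  have "1 / pi\<^sup>2 * ((of_int (b + k) - of_int (b' + k')) / 2)\<^sup>2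
     \<le> \<bar>resonance N (a, b, k) - resonance N (a, b', k')\<bar>"
    unfolding form[OF k(1)] form[OF k(2)]
    using freqs_quarter[OF N(1), of a] t by (intro sin_form_separation h r) (auto simp: triads_def h_def)
  moreover have "(real_of_int (b + k) - real_of_int (b' + k')) / 2 = real_of_int b - real_of_int b'"
    by (simp add: k[symmetric])
  ultimately show ?thesis by (simp only:)
qed

text \<open>The factors in \<open>k1\<close> and \<open>k\<close> combine to a cosine of
  \<open>h * (k1 + k) / 4\<close>. It is even, so opposite values of \<open>k1 + k\<close> give
  equal resonances; the sign hypothesis selects one of the two branches. The powers of
  \<open>h\<close> cancel exactly: \<open>1 / h ^ 3\<close> in front, \<open>h\<close> from the sine
  since \<open>\<bar>k2\<bar> \<ge> 1\<close>, and \<open>h\<^sup>2\<close> from the cosine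
  difference.\<close>

lemma resonance_separation_k2:
  assumes N: "N > 0" and t: "(a, b, k) \<in> triads N" "(a', b, k') \<in> triads N"
    and k: "a + b = k" "a' + b = k'" and sgn: "a + k \<ge> 0 \<and> a' + k' \<ge> 0 \<or> a + k < 0 \<and> a' + k' < 0"
  shows "1 / pi ^ 3 * (of_int a - of_int a')\<^sup>2 \<le> \<bar>resonance N (a, b, k) - resonance N (a', b, k')\<bar>"
proof -
  define h where "h = mesh N"
  have h: "h > 0" using mesh_pos[OF N(1)] N by (auto simp: h_def)
  have form: "resonance N (a, b, k) = 4 / h ^ 3 * sin (h * of_int b / 4) *
      (cos (h * of_int b / 4) + cos (h * of_int (a + k) / 4))" if "a + b = k" for a k
  proof -
    have e: "cos (h * of_int b / 4) = cos (h * of_int k / 4 - h * of_int a / 4)"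
      by (rule arg_cong[where f = cos]) (simp add: that[symmetric] algebra_simps add_divide_distrib)
    have "2 * (cos (h * of_int k / 4) * cos (h * of_int a / 4)) = cos (h * of_int b / 4) + cos (h * of_int (a + k) / 4)"
      unfolding cos_times_cos e by (simp add: algebra_simps add_divide_distrib)
    then show ?thesis unfolding resonance_unaliased[OF N(1) that[symmetric]] h_def[symmetric] 
      by (simp add: mult.commute mult.left_commute)
  qed
  have r: "\<bar>h * of_int (a + k) / 4\<bar> \<le> pi / 2" if "(a, b, k) \<in> triads N" for a k
  proof -
    have "\<bar>h * of_int k\<bar> \<le> pi" "\<bar>h * of_int a\<bar> \<le> pi"
      using freqs_mesh[OF N(1)] that by (auto simp: triads_def h_def)
    moreover have "h * of_int (a + k) / 4 = h * of_int a / 4 + h * of_int k / 4" by (simp add: algebra_simps add_divide_distrib)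
    ultimately show ?thesis by (simp only: abs_le_iff) linarith
  qed
  define p p' where "p = real_of_int (a + k)" and "p' = real_of_int (a' + k')"
  have pp: "p - p' = 2 * (of_int a - of_int a')" by (simp add: p_def p'_def k[symmetric])
  \<comment> \<open>Equal signs give \<open>\<bar>p - p'\<bar> \<le> \<bar>p + p'\<bar>\<close>, so
    the difference of the squares dominates the square of the difference.\<close>
  have "(p - p')\<^sup>2 = \<bar>p - p'\<bar> * \<bar>p - p'\<bar>" by (simp add: power2_eq_square)
  also have "\<dots> \<le> \<bar>p - p'\<bar> * \<bar>p + p'\<bar>"
    using sgn by (intro mult_left_mono) (auto simp: p_def p'_def)
  also have "\<dots> = \<bar>p\<^sup>2 - p'\<^sup>2\<bar>" by (simp add: power2_eq_square square_diff_square_factored abs_mult mult.commute)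
  also have "(p - p')\<^sup>2 = 4 * (of_int a - of_int a')\<^sup>2" unfolding pp power_mult_distrib by simp
  finally have sq: "4 * (of_int a - of_int a')\<^sup>2 \<le> \<bar>p\<^sup>2 - p'\<^sup>2\<bar>" .
  have b: "b \<in> freqs N" "b \<noteq> 0" using t by (auto simp: triads_def)
  have "2 / pi * (h / 4) \<le> 2 / pi * \<bar>h * of_int b / 4\<bar>"
  proof -
    have "1 \<le> \<bar>real_of_int b\<bar>" using b(2) by linarith
    then have "h * 1 \<le> h * \<bar>real_of_int b\<bar>" using h by (intro mult_left_mono) auto
    then show ?thesis using h by (intro mult_left_mono) (auto simp: abs_mult)
  qed
  also have "\<dots> \<le> \<bar>sin (h * of_int b / 4)\<bar>"
    using freqs_quarter[OF N b(1)] pi_gt_zero by (intro abs_sin_ge) (auto simp: h_def)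
  finally have s: "2 / pi * (h / 4) \<le> \<bar>sin (h * of_int b / 4)\<bar>" .
  have c: "2 / pi\<^sup>2 * \<bar>(h * p / 4)\<^sup>2 - (h * p' / 4)\<^sup>2\<bar> \<le> \<bar>cos (h * p / 4) - cos (h * p' / 4)\<bar>"
    unfolding p_def p'_def by (intro abs_cos_diff_ge r t)
  have e: "(h * p / 4)\<^sup>2 - (h * p' / 4)\<^sup>2 = h\<^sup>2 / 16 * (p\<^sup>2 - p'\<^sup>2)" by (simp add: power2_eq_square algebra_simps)
  have c': "2 / pi\<^sup>2 * (h\<^sup>2 / 16 * (4 * (of_int a - of_int a')\<^sup>2)) \<le> \<bar>cos (h * p / 4) - cos (h * p' / 4)\<bar>"
  proof -
    have "2 / pi\<^sup>2 * (h\<^sup>2 / 16 * (4 * (of_int a - of_int a')\<^sup>2)) \<le> 2 / pi\<^sup>2 * (h\<^sup>2 / 16 * \<bar>p\<^sup>2 - p'\<^sup>2\<bar>)"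
      using sq by (intro mult_left_mono) auto
    also have "\<dots> = 2 / pi\<^sup>2 * \<bar>(h * p / 4)\<^sup>2 - (h * p' / 4)\<^sup>2\<bar>" unfolding e by (simp add: abs_mult)
    finally show ?thesis using c by linarith
  qed
  have "1 / pi ^ 3 * (of_int a - of_int a')\<^sup>2 =
      4 / h ^ 3 * (2 / pi * (h / 4)) * (2 / pi\<^sup>2 * (h\<^sup>2 / 16 * (4 * (of_int a - of_int a')\<^sup>2)))"
    using h by (simp add: power2_eq_square power3_eq_cube field_simps)
  also have "\<dots> \<le> 4 / h ^ 3 * \<bar>sin (h * of_int b / 4)\<bar> * \<bar>cos (h * p / 4) - cos (h * p' / 4)\<bar>"
    using h by (intro mult_mono s c' mult_left_mono mult_nonneg_nonneg) auto
  also have "\<dots> = \<bar>4 / h ^ 3 * sin (h * of_int b / 4) * (cos (h * p / 4) - cos (h * p' / 4))\<bar>"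
    using h by (simp add: abs_mult)
  also have "4 / h ^ 3 * sin (h * of_int b / 4) * (cos (h * p / 4) - cos (h * p' / 4)) =
      resonance N (a, b, k) - resonance N (a', b, k')"
    unfolding form[OF k(1)] form[OF k(2)] p_def p'_def by (simp only: algebra_simps)
  finally show ?thesis .
qed

section \<open>Sums over resonant triads\<close>

lemma card_freqs: "card (freqs N) = 2 * N"
  by (simp add: freqs_def)

text \<open>Counting suffices: the brackets are at most \<open>1\<close>, each weight is at most
  \<open>2 * h\<close>, there are at most \<open>2 * N\<close> terms, and
  \<open>2 * N * (2 * h) = 4 * pi\<close>.\<close>

lemma aliased_sum_bound:
  assumes N: "N > 0" and g: "g \<ge> 0" and F: "F \<subseteq> triads N" and inj: "inj_on p F" and p: "p ` F \<subseteq> freqs N"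
    and al: "\<And>k1 k2 k. (k1, k2, k) \<in> F \<Longrightarrow> k1 + k2 \<noteq> k"
  shows "(\<Sum>i\<in>F. res_weight N i * jbr (M i) powr (-g)) \<le> 16"
proof -
  have fin: "finite F" using F finite_triads finite_subset by blast
  have "card F \<le> card (freqs N)"
    using inj p by (rule card_inj_on_le) (simp add: freqs_def)
  then have cd: "card F \<le> 2 * N" by (simp add: card_freqs)
  have "(\<Sum>i\<in>F. res_weight N i * jbr (M i) powr (-g)) \<le> (\<Sum>i\<in>F. 2 * mesh N)"
  proof (rule sum_mono)
    fix i assume i: "i \<in> F"
    have "res_weight N i \<le> 2 * mesh N"
      using res_weight_aliased(1)[OF N] al i F by (cases i) blast
    moreover have "jbr (M i) powr (-g) \<le> 1" using g jbr_ge_1[of "M i"] powr_mono2'[of "-g" 1 "jbr (M i)"] by simp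
    ultimately have "res_weight N i * jbr (M i) powr (-g) \<le> 2 * mesh N * 1"
      using mesh_pos[OF N] by (intro mult_mono) auto
    then show "res_weight N i * jbr (M i) powr (-g) \<le> 2 * mesh N" by simp
  qed
  also have "\<dots> = real (card F) * (2 * mesh N)" by simp
  also have "\<dots> \<le> real (2 * N) * (2 * mesh N)"
    using cd mesh_pos[OF N] by (intro mult_right_mono) (auto simp del: of_nat_mult)
  also have "\<dots> = 4 * pi" using N by (simp add: mesh_def)
  also have "\<dots> \<le> 16" using pi_less_4 by simp
  finally show ?thesis .
qed

lemma fiber_inj:
  shows "inj_on (\<lambda>i. fst (snd i)) {i\<in>triads N. snd (snd i) = q}"
    and "inj_on (\<lambda>i. fst (snd i)) {i\<in>triads N. fst i = q}"
    and "inj_on fst {i\<in>triads N. fst (snd i) = q}"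
  by (rule inj_onI, simp, metis triads_determined(3), rule inj_onI, simp, metis triads_determined(1),
      rule inj_onI, simp, metis triads_determined(1))

definition unaliased :: "int \<times> int \<times> int \<Rightarrow> bool"
  where "unaliased i \<longleftrightarrow> fst i + fst (snd i) = snd (snd i)"

lemma sum_split_aliased:
  assumes N: "N > 0" and g: "g \<ge> 0" and F: "F \<subseteq> triads N" and inj: "inj_on p F" and p: "p ` F \<subseteq> freqs N"
    and un: "(\<Sum>i\<in>{i\<in>F. unaliased i}. 1 / \<bar>of_int (fst (snd i))\<bar> * jbr (M i) powr (-g)) \<le> C"
  shows "(\<Sum>i\<in>F. res_weight N i * jbr (M i) powr (-g)) \<le> 5 * C + 16"
proof -
  have fin: "finite F" using F finite_triads finite_subset by blast
  let ?U = "{i\<in>F. unaliased i}" and ?A = "{i\<in>F. \<not> unaliased i}"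
  have "(\<Sum>i\<in>F. res_weight N i * jbr (M i) powr (-g)) =
     (\<Sum>i\<in>?U. res_weight N i * jbr (M i) powr (-g)) + (\<Sum>i\<in>?A. res_weight N i * jbr (M i) powr (-g))"
    using fin by (subst sum.union_disjoint[symmetric]) (auto intro!: sum.cong)
  also have "(\<Sum>i\<in>?A. res_weight N i * jbr (M i) powr (-g)) \<le> 16"
    using F p by (intro aliased_sum_bound[OF N g _ inj_on_subset[OF inj]]) (auto simp: unaliased_def)
  also have "(\<Sum>i\<in>?U. res_weight N i * jbr (M i) powr (-g)) \<le>
     (\<Sum>i\<in>?U. 5 * (1 / \<bar>of_int (fst (snd i))\<bar> * jbr (M i) powr (-g)))"
  proof (rule sum_mono)
    fix i assume i: "i \<in> ?U"
    have "res_weight N i \<le> 5 / \<bar>of_int (fst (snd i))\<bar>"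
      using res_weight_unaliased(1)[OF N, of "fst i" "fst (snd i)" "snd (snd i)"] i F by (auto simp: unaliased_def)
    then have "res_weight N i * jbr (M i) powr (-g) \<le> 5 / \<bar>of_int (fst (snd i))\<bar> * jbr (M i) powr (-g)"
      by (intro mult_right_mono) auto
    then show "res_weight N i * jbr (M i) powr (-g) \<le> 5 * (1 / \<bar>of_int (fst (snd i))\<bar> * jbr (M i) powr (-g))"
      by simp
  qed
  also have "\<dots> \<le> 5 * C" unfolding sum_distrib_left[symmetric] using un by simp
  finally show ?thesis by simp
qed

lemma modulation_separation:
  fixes r :: real
  assumes "\<sigma> \<in> {1, -1::real}" "x \<le> \<bar>a - b\<bar>"
  shows "x \<le> \<bar>(r - \<sigma> * a) - (r - \<sigma> * b)\<bar>"
  using assms abs_minus_commute[of a b] by (elim insertE) simp_all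

lemma triple_separation:
  assumes N: "N > 0" "mesh N \<le> 1" and ij: "i \<in> triads N" "j \<in> triads N" "unaliased i" "unaliased j"
  shows "snd (snd i) = snd (snd j) \<Longrightarrow> 1 / pi\<^sup>2 * (of_int (fst (snd i)) - of_int (fst (snd j)))\<^sup>2
      \<le> \<bar>resonance N i - resonance N j\<bar>"
    and "fst i = fst j \<Longrightarrow> 1 / pi\<^sup>2 * (of_int (fst (snd i)) - of_int (fst (snd j)))\<^sup>2
      \<le> \<bar>resonance N i - resonance N j\<bar>"
    and "fst (snd i) = fst (snd j) \<Longrightarrow>
      fst i + snd (snd i) \<ge> 0 \<and> fst j + snd (snd j) \<ge> 0 \<or> fst i + snd (snd i) < 0 \<and> fst j + snd (snd j) < 0 \<Longrightarrow>
      1 / pi ^ 3 * (of_int (fst i) - of_int (fst j))\<^sup>2 \<le> \<bar>resonance N i - resonance N j\<bar>"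
proof -
  obtain a b c where i: "i = (a, b, c)" by (cases i)
  obtain a' b' c' where j: "j = (a', b', c')" by (cases j)
  have t: "(a, b, c) \<in> triads N" "(a', b', c') \<in> triads N" "a + b = c" "a' + b' = c'"
    using ij by (auto simp: i j unaliased_def)
  show "1 / pi\<^sup>2 * (of_int (fst (snd i)) - of_int (fst (snd j)))\<^sup>2 \<le> \<bar>resonance N i - resonance N j\<bar>"
    if "snd (snd i) = snd (snd j)"
    using resonance_separation_k[OF N, of a b c a' b'] t that unfolding i j fst_conv snd_conv by blast
  show "1 / pi\<^sup>2 * (of_int (fst (snd i)) - of_int (fst (snd j)))\<^sup>2 \<le> \<bar>resonance N i - resonance N j\<bar>"
    if "fst i = fst j"
    using resonance_separation_k1[OF N, of a b c b' c'] t that unfolding i j fst_conv snd_conv by blast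
  show "1 / pi ^ 3 * (of_int (fst i) - of_int (fst j))\<^sup>2 \<le> \<bar>resonance N i - resonance N j\<bar>"
    if "fst (snd i) = fst (snd j)" "fst i + snd (snd i) \<ge> 0 \<and> fst j + snd (snd j) \<ge> 0 \<or>
      fst i + snd (snd i) < 0 \<and> fst j + snd (snd j) < 0"
    using resonance_separation_k2[OF N(1), of a b c a' c'] t that unfolding i j fst_conv snd_conv by blast
qed

text \<open>\<open>k2\<close> is the label in the first two fibres, where the weight decays with it.
  In the third fibre the weight no longer helps, \<open>k1\<close> is the label and the bracket
  alone has to be summable. Uniformity in \<open>r\<close> lets it stand for the modulation that is
  held fixed in Cauchy--Schwarz.\<close>

proposition triad_sum_bounds:
  shows "\<exists>C>0. \<forall>N>0. mesh N \<le> 1 \<longrightarrow> (\<forall>\<sigma>\<in>{1, -1::real}. \<forall>q r.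
     (\<Sum>i\<in>{i\<in>triads N. snd (snd i) = q}. res_weight N i * jbr (r - \<sigma> * resonance N i) powr (-(1/4))) \<le> C \<and>
     (\<Sum>i\<in>{i\<in>triads N. fst i = q}. res_weight N i * jbr (r - \<sigma> * resonance N i) powr (-(1/4))) \<le> C \<and>
     (\<Sum>i\<in>{i\<in>triads N. fst (snd i) = q}. res_weight N i * jbr (r - \<sigma> * resonance N i) powr (-(5/8))) \<le> C)"
proof -
  have "1 / pi\<^sup>2 > 0" "1 / pi ^ 3 > 0" "(5/8::real) > 1/2" by simp_all
  note pos = this
  from separated_weighted_sum_bound[where 'a = "int \<times> int \<times> int", OF pos(1)] obtain C1 where C1: "C1 > 0"
    "\<forall>(I :: (int \<times> int \<times> int) set) (p :: _ \<Rightarrow> int) M. finite I \<longrightarrow> inj_on p I \<longrightarrow>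
     (\<forall>i\<in>I. p i \<noteq> 0) \<longrightarrow>
     (\<forall>i\<in>I. \<forall>j\<in>I. 1 / pi\<^sup>2 * (real_of_int (p i) - real_of_int (p j))\<^sup>2 \<le> \<bar>M i - M j\<bar>) \<longrightarrow>
     (\<Sum>i\<in>I. 1 / \<bar>real_of_int (p i)\<bar> * jbr (M i) powr (-(1/4))) \<le> C1" by blast
  from separated_sum_bound[where 'a = "int \<times> int \<times> int", OF pos(2,3)] obtain C2 where C2: "C2 > 0"
    "\<forall>(I :: (int \<times> int \<times> int) set) (p :: _ \<Rightarrow> int) M. finite I \<longrightarrow> inj_on p I \<longrightarrow>
     (\<forall>i\<in>I. \<forall>j\<in>I. 1 / pi ^ 3 * (real_of_int (p i) - real_of_int (p j))\<^sup>2 \<le> \<bar>M i - M j\<bar>) \<longrightarrow>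
     (\<Sum>i\<in>I. jbr (M i) powr (-(5/8))) \<le> C2" by blast
  show ?thesis
  proof (intro exI[of _ "5 * (C1 + C2 + C2) + 16"] conjI allI impI ballI)
    show "5 * (C1 + C2 + C2) + 16 > 0" using C1(1) C2(1) by simp
    fix N :: nat and \<sigma> q :: real and k :: int and r
    assume N: "N > 0" and h1: "mesh N \<le> 1" and \<sigma>: "\<sigma> \<in> {1, -1::real}"
    let ?M = "\<lambda>i. r - \<sigma> * resonance N i"
    have nz: "fst (snd i) \<noteq> 0" if "i \<in> triads N" for i using that by (auto simp: triads_def)
    have fq: "fst (snd i) \<in> freqs N" "fst i \<in> freqs N" if "i \<in> triads N" for i using that by (auto simp: triads_def)
    show "(\<Sum>i\<in>{i\<in>triads N. snd (snd i) = k}. res_weight N i * jbr (?M i) powr (-(1/4))) \<le> 5 * (C1 + C2 + C2) + 16"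
    proof -
      let ?F = "{i\<in>triads N. snd (snd i) = k}"
      have "(\<Sum>i\<in>{i\<in>?F. unaliased i}. 1 / \<bar>real_of_int (fst (snd i))\<bar> * jbr (?M i) powr (-(1/4))) \<le> C1"
      proof (rule C1(2)[THEN spec, THEN spec, THEN spec, THEN mp, THEN mp, THEN mp, THEN mp], goal_cases)
        case 1 show ?case using finite_triads[of N] by simp
        case 2 show ?case by (rule inj_on_subset[OF fiber_inj(1)]) auto
        case 3 show ?case using nz by auto
        case 4 show ?case
          by (intro ballI modulation_separation[OF \<sigma>])
             (rule triple_separation(1)[OF N h1], auto)
      qed
      then have "(\<Sum>i\<in>?F. res_weight N i * jbr (?M i) powr (-(1/4))) \<le> 5 * C1 + 16"
        using fq by (intro sum_split_aliased[OF N _ _ fiber_inj(1)]) auto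
      then show ?thesis using C2(1) by simp
    qed
    show "(\<Sum>i\<in>{i\<in>triads N. fst i = k}. res_weight N i * jbr (?M i) powr (-(1/4))) \<le> 5 * (C1 + C2 + C2) + 16"
    proof -
      let ?F = "{i\<in>triads N. fst i = k}"
      have "(\<Sum>i\<in>{i\<in>?F. unaliased i}. 1 / \<bar>real_of_int (fst (snd i))\<bar> * jbr (?M i) powr (-(1/4))) \<le> C1"
      proof (rule C1(2)[THEN spec, THEN spec, THEN spec, THEN mp, THEN mp, THEN mp, THEN mp], goal_cases)
        case 1 show ?case using finite_triads[of N] by simp
        case 2 show ?case by (rule inj_on_subset[OF fiber_inj(2)]) auto
        case 3 show ?case using nz by auto
        case 4 show ?case
          by (intro ballI modulation_separation[OF \<sigma>])
             (rule triple_separation(2)[OF N h1], auto)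
      qed
      then have "(\<Sum>i\<in>?F. res_weight N i * jbr (?M i) powr (-(1/4))) \<le> 5 * C1 + 16"
        using fq by (intro sum_split_aliased[OF N _ _ fiber_inj(2)]) auto
      then show ?thesis using C2(1) by simp
    qed
    show "(\<Sum>i\<in>{i\<in>triads N. fst (snd i) = k}. res_weight N i * jbr (?M i) powr (-(5/8))) \<le> 5 * (C1 + C2 + C2) + 16"
    proof -
      let ?F = "{i\<in>triads N. fst (snd i) = k}"
      \<comment> \<open>The two signs of \<open>k1 + k\<close> are treated separately because the
        unaliased resonance is even in that sum; on either half the label \<open>k1\<close>
        separates.\<close>
      have half: "(\<Sum>i\<in>{i\<in>?F. unaliased i \<and> P (fst i + snd (snd i))}. jbr (?M i) powr (-(5/8))) \<le> C2"
        if P: "P = (\<lambda>m. m \<ge> 0) \<or> P = (\<lambda>m. m < 0)" for P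
      proof (rule C2(2)[THEN spec, THEN spec[of _ fst], THEN spec, THEN mp, THEN mp, THEN mp], goal_cases)
        case 1 show ?case using finite_triads[of N] by simp
        case 2 show ?case by (rule inj_on_subset[OF fiber_inj(3)]) auto
        case 3 show ?case
          by (intro ballI modulation_separation[OF \<sigma>])
             (rule triple_separation(3)[OF N h1], use P in auto)
      qed
      have "(\<Sum>i\<in>{i\<in>?F. unaliased i}. 1 / \<bar>real_of_int (fst (snd i))\<bar> * jbr (?M i) powr (-(5/8)))
        \<le> (\<Sum>i\<in>{i\<in>?F. unaliased i}. jbr (?M i) powr (-(5/8)))"
      proof (rule sum_mono)
        fix i assume "i \<in> {i\<in>?F. unaliased i}"
        then have "\<bar>real_of_int (fst (snd i))\<bar> \<ge> 1" using nz[of i] by (simp add: Ints_nonzero_abs_ge1)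
        then have "1 / \<bar>real_of_int (fst (snd i))\<bar> \<le> 1" by simp
        then show "1 / \<bar>real_of_int (fst (snd i))\<bar> * jbr (?M i) powr (-(5/8)) \<le> jbr (?M i) powr (-(5/8))"
          by (intro mult_left_le_one_le) auto
      qed
      also have "\<dots> = (\<Sum>i\<in>{i\<in>?F. unaliased i \<and> fst i + snd (snd i) \<ge> 0}. jbr (?M i) powr (-(5/8)))
          + (\<Sum>i\<in>{i\<in>?F. unaliased i \<and> fst i + snd (snd i) < 0}. jbr (?M i) powr (-(5/8)))"
        using finite_triads[of N] by (subst sum.union_disjoint[symmetric]) (auto intro!: sum.cong)
      also have "\<dots> \<le> C2 + C2"
        using half[of "\<lambda>m. m \<ge> 0"] half[of "\<lambda>m. m < 0"] by (intro add_mono) auto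
      finally have "(\<Sum>i\<in>?F. res_weight N i * jbr (?M i) powr (-(5/8))) \<le> 5 * (C2 + C2) + 16"
        using fq by (intro sum_split_aliased[OF N _ _ fiber_inj(3)]) auto
      then show ?thesis using C1(1) by simp
    qed
  qed
qed

section \<open>Bracket integrals and Cauchy--Schwarz\<close>

lemma nn_integral_reflect:
  fixes f :: "real \<Rightarrow> ennreal"
  assumes [measurable]: "f \<in> borel_measurable borel"
  shows "(\<integral>\<^sup>+x. f (a - x) \<partial>lborel) = (\<integral>\<^sup>+x. f x \<partial>lborel)"
  using nn_integral_real_affine[of f "-1" a] by simp

lemma nn_integral_shift:
  fixes f :: "real \<Rightarrow> ennreal"
  assumes [measurable]: "f \<in> borel_measurable borel"
  shows "(\<integral>\<^sup>+x. f (x + a) \<partial>lborel) = (\<integral>\<^sup>+x. f x \<partial>lborel)"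
  using nn_integral_real_affine[of f 1 a] by (simp add: add.commute)

lemma jbr_powr_integral:
  fixes p :: real
  assumes "p > 1"
  shows "\<exists>C>0. (\<integral>\<^sup>+x. ennreal (jbr x powr (-p)) \<partial>lborel) \<le> ennreal C"
proof -
  define F where "F x = - ((1 + x) powr (1 - p)) / (p - 1)" for x :: real
  have half: "(\<integral>\<^sup>+x. ennreal ((1 + x) powr (-p)) * indicator {0..} x \<partial>lborel) = ennreal (0 - F 0)"
  proof (rule nn_integral_FTC_atLeast)
    show "(\<lambda>x. (1 + x) powr (-p)) \<in> borel_measurable borel" by measurable
    show "DERIV F x :> (1 + x) powr (-p)" if "0 \<le> x" for x
    proof -
      have "((\<lambda>x. (1 + x) powr (1 - p)) has_real_derivative (1 - p) * (1 + x) powr (-p)) (at x)"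
        using that assms by (auto intro!: derivative_eq_intros)
      from DERIV_cdivide[OF DERIV_minus[OF this], of "p - 1"]
      have "DERIV F x :> - ((1 - p) * (1 + x) powr (-p)) / (p - 1)" by (simp add: F_def[abs_def])
      also have "- ((1 - p) * (1 + x) powr (-p)) / (p - 1) = (1 + x) powr (-p)"
        using assms by (simp add: field_simps)
      finally show ?thesis .
    qed
    show "(F \<longlongrightarrow> 0) at_top"
    proof -
      have "((\<lambda>x. (1 + x) powr (1 - p)) \<longlongrightarrow> 0) at_top"
        using assms by real_asymp
      then have "((\<lambda>x. - ((1 + x) powr (1 - p)) / (p - 1)) \<longlongrightarrow> - 0 / (p - 1)) at_top"
        using assms by (intro tendsto_intros) auto
      then show ?thesis unfolding F_def[abs_def] by simp
    qed
  qed auto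
  have pw: "jbr x powr (-p) \<le> 2 powr p * (1 + \<bar>x\<bar>) powr (-p)" for x
  proof -
    have "jbr x powr (-p) \<le> ((1 + \<bar>x\<bar>) / 2) powr (-p)"
      using one_plus_abs_le_jbr[of x] assms by (intro powr_mono2') auto
    also have "\<dots> = 2 powr p * (1 + \<bar>x\<bar>) powr (-p)"
      by (simp add: powr_divide powr_minus field_simps)
    finally show ?thesis .
  qed
  let ?h = "\<lambda>x. ennreal ((1 + x) powr (-p)) * indicator {0..} x"
  have "(\<integral>\<^sup>+x. ennreal (jbr x powr (-p)) \<partial>lborel) \<le> (\<integral>\<^sup>+x. ennreal (2 powr p) * (?h x + ?h (0 - x)) \<partial>lborel)"
  proof (rule nn_integral_mono)
    fix x :: real
    have "ennreal (jbr x powr (-p)) \<le> ennreal (2 powr p) * ennreal ((1 + \<bar>x\<bar>) powr (-p))"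
      using pw[of x] by (simp add: ennreal_mult[symmetric] ennreal_leI)
    also have "\<dots> \<le> ennreal (2 powr p) * (?h x + ?h (0 - x))"
      by (intro mult_left_mono) (cases "x \<ge> 0", auto simp: indicator_def)
    finally show "ennreal (jbr x powr (-p)) \<le> ennreal (2 powr p) * (?h x + ?h (0 - x))" .
  qed
  also have "\<dots> = ennreal (2 powr p) * (integral\<^sup>N lborel ?h + (\<integral>\<^sup>+x. ?h (0 - x) \<partial>lborel))"
    by (simp add: nn_integral_cmult nn_integral_add)
  also have "(\<integral>\<^sup>+x. ?h (0 - x) \<partial>lborel) = integral\<^sup>N lborel ?h"
    by (rule nn_integral_reflect) measurable
  also have "integral\<^sup>N lborel ?h = ennreal (1 / (p - 1))" unfolding half by (simp add: F_def)
  also have "ennreal (2 powr p) * (ennreal (1 / (p - 1)) + ennreal (1 / (p - 1))) = ennreal (2 powr p * (1/(p-1) + 1/(p-1)))"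
    using assms by (simp add: ennreal_mult[symmetric] ennreal_plus[symmetric] del: ennreal_plus)
  finally show ?thesis using assms by (intro exI[of _ "2 powr p * (1/(p-1) + 1/(p-1))"]) auto
qed

text \<open>The larger of the two brackets is at least \<open>jbr M / 3\<close>. It yields
  \<open>g\<close> of its exponent to \<open>jbr M\<close>; all that is left,
  \<open>a + b - g\<close> in total, is moved to the smaller bracket, where it is integrable. The
  strict inequality \<open>a + b - g > 1\<close> avoids the logarithm of the endpoint.\<close>

lemma jbr_convolution:
  fixes a b g :: real
  assumes g: "0 \<le> g" "g \<le> a" "g \<le> b" and s: "1 < a + b - g"
  shows "\<exists>C>0. \<forall>M. (\<integral>\<^sup>+x. ennreal (jbr x powr (-a) * jbr (M - x) powr (-b)) \<partial>lborel)
     \<le> ennreal (C * jbr M powr (-g))"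
proof -
  define q where "q = a + b - g"
  obtain C where C: "C > 0" "(\<integral>\<^sup>+x. ennreal (jbr x powr (-q)) \<partial>lborel) \<le> ennreal C"
    using jbr_powr_integral[of q] s by (auto simp: q_def)
  \<comment> \<open>\<open>m\<close> is the larger and \<open>n\<close> the smaller bracket. The
    exponents are bound anew here, so that the claim serves both orders.\<close>
  have key: "m powr (-a) * n powr (-b) \<le> (jbr M / 3) powr (-g) * n powr (-q)"
    if "1 \<le> n" "n \<le> m" "jbr M \<le> 3 * m" "g \<le> a" "q = a + b - g" for m n M a b :: real
  proof -
    have "m powr (-a) = m powr (-g) * m powr (-(a - g))" by (simp flip: powr_add)
    also have "\<dots> \<le> (jbr M / 3) powr (-g) * n powr (-(a - g))"
      using that g jbr_pos[of M] by (intro mult_mono powr_mono2') auto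
    finally have "m powr (-a) * n powr (-b) \<le> (jbr M / 3) powr (-g) * n powr (-(a - g)) * n powr (-b)"
      by (intro mult_right_mono) auto
    also have "\<dots> = (jbr M / 3) powr (-g) * n powr (-(a - g) + - b)"
      by (simp only: mult.assoc powr_add)
    also have "-(a - g) + - b = - q" using that by simp
    finally show ?thesis .
  qed
  have pw: "jbr x powr (-a) * jbr (M - x) powr (-b) \<le>
     3 powr g * jbr M powr (-g) * (jbr x powr (-q) + jbr (M - x) powr (-q))" for x M
  proof -
    have eq: "(jbr M / 3) powr (-g) = 3 powr g * jbr M powr (-g)"
      using jbr_pos[of M] by (simp add: powr_divide powr_minus field_simps)
    have tri: "jbr M \<le> 2 * jbr x + jbr (M - x)" "jbr M \<le> jbr x + 2 * jbr (M - x)"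
      using jbr_le[of M] one_plus_abs_le_jbr[of x] one_plus_abs_le_jbr[of "M-x"] jbr_ge_abs[of x] jbr_ge_abs[of "M - x"] abs_triangle_ineq[of x "M - x"]
      by (auto simp del: abs_triangle_ineq)
    show ?thesis
    proof (cases "jbr (M - x) \<le> jbr x")
      case True
      have "jbr x powr (-a) * jbr (M - x) powr (-b) \<le> (jbr M / 3) powr (-g) * jbr (M - x) powr (-q)"
        using True tri g(2) jbr_ge_1[of "M - x"] by (intro key) (auto simp: q_def)
      also have "\<dots> \<le> (jbr M / 3) powr (-g) * (jbr x powr (-q) + jbr (M - x) powr (-q))"
        by (intro mult_left_mono) auto
      finally show ?thesis unfolding eq .
    next
      case False
      have "jbr (M - x) powr (-b) * jbr x powr (-a) \<le> (jbr M / 3) powr (-g) * jbr x powr (-q)"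
        using False tri g(3) jbr_ge_1[of x] by (intro key) (auto simp: q_def)
      also have "\<dots> \<le> (jbr M / 3) powr (-g) * (jbr x powr (-q) + jbr (M - x) powr (-q))"
        by (intro mult_left_mono) auto
      finally show ?thesis unfolding eq by (simp add: mult.commute)
    qed
  qed
  show ?thesis
  proof (intro exI[of _ "3 powr g * (C + C)"] conjI allI)
    show "3 powr g * (C + C) > 0" using C(1) by simp
    fix M
    let ?D = "3 powr g * jbr M powr (-g)"
    have "(\<integral>\<^sup>+x. ennreal (jbr x powr (-a) * jbr (M - x) powr (-b)) \<partial>lborel) \<le>
      (\<integral>\<^sup>+x. ennreal ?D * (ennreal (jbr x powr (-q)) + ennreal (jbr (M - x) powr (-q))) \<partial>lborel)"
      using pw[of _ M] by (intro nn_integral_mono) (simp add: ennreal_mult[symmetric] ennreal_plus[symmetric] ennreal_leI del: ennreal_plus)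
    also have "\<dots> = ennreal ?D * ((\<integral>\<^sup>+x. ennreal (jbr x powr (-q)) \<partial>lborel) + (\<integral>\<^sup>+x. ennreal (jbr (M - x) powr (-q)) \<partial>lborel))"
      by (simp add: nn_integral_cmult nn_integral_add)
    also have "(\<integral>\<^sup>+x. ennreal (jbr (M - x) powr (-q)) \<partial>lborel) = (\<integral>\<^sup>+x. ennreal (jbr x powr (-q)) \<partial>lborel)"
      by (rule nn_integral_reflect) measurable
    also have "ennreal ?D * ((\<integral>\<^sup>+x. ennreal (jbr x powr (-q)) \<partial>lborel) + (\<integral>\<^sup>+x. ennreal (jbr x powr (-q)) \<partial>lborel)) \<le> ennreal ?D * (ennreal C + ennreal C)"
      using C(2) by (intro mult_left_mono add_mono) auto
    also have "\<dots> = ennreal (3 powr g * (C + C) * jbr M powr (-g))"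
      using C(1) by (simp add: ennreal_mult[symmetric] ennreal_plus[symmetric] mult_ac del: ennreal_plus)
    finally show "(\<integral>\<^sup>+x. ennreal (jbr x powr (-a) * jbr (M - x) powr (-b)) \<partial>lborel) \<le> ennreal (3 powr g * (C + C) * jbr M powr (-g))" .
  qed
qed

text \<open>Sum and integral form a single integral over the product with counting measure on
  \<open>A\<close>, to which the integral inequality applies at once.\<close>

lemma Cauchy_Schwarz_sum_nn_integral:
  fixes f g :: "'i \<Rightarrow> 'a \<Rightarrow> ennreal"
  assumes "sigma_finite_measure M" and fin: "finite A"
    and f: "\<And>i. i \<in> A \<Longrightarrow> f i \<in> borel_measurable M" and g: "\<And>i. i \<in> A \<Longrightarrow> g i \<in> borel_measurable M"
  shows "(\<Sum>i\<in>A. \<integral>\<^sup>+x. f i x * g i x \<partial>M)\<^sup>2 \<le> (\<Sum>i\<in>A. \<integral>\<^sup>+x. (f i x)\<^sup>2 \<partial>M) * (\<Sum>i\<in>A. \<integral>\<^sup>+x. (g i x)\<^sup>2 \<partial>M)"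
proof -
  interpret sigma_finite_measure M by fact
  let ?P = "count_space A \<Otimes>\<^sub>M M"
  have m: "(\<lambda>z. h (fst z) (snd z)) \<in> borel_measurable ?P" if "\<And>i. i \<in> A \<Longrightarrow> h i \<in> borel_measurable M" for h :: "'i \<Rightarrow> 'a \<Rightarrow> ennreal"
    using fin that by (intro measurable_pair_measure_countable1) (auto intro: countable_finite)
  have i: "(\<Sum>i\<in>A. \<integral>\<^sup>+x. h i x \<partial>M) = (\<integral>\<^sup>+z. h (fst z) (snd z) \<partial>?P)" if "\<And>i. i \<in> A \<Longrightarrow> h i \<in> borel_measurable M" for h :: "'i \<Rightarrow> 'a \<Rightarrow> ennreal"
    using fin m[OF that] by (subst nn_integral_fst[symmetric]) (auto simp: nn_integral_count_space_finite)
  have "(\<Sum>i\<in>A. \<integral>\<^sup>+x. f i x * g i x \<partial>M) = (\<integral>\<^sup>+z. f (fst z) (snd z) * g (fst z) (snd z) \<partial>?P)"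
    using f g by (intro i) auto
  moreover have "(\<Sum>i\<in>A. \<integral>\<^sup>+x. (f i x)\<^sup>2 \<partial>M) = (\<integral>\<^sup>+z. (f (fst z) (snd z))\<^sup>2 \<partial>?P)"
    using f by (intro i) auto
  moreover have "(\<Sum>i\<in>A. \<integral>\<^sup>+x. (g i x)\<^sup>2 \<partial>M) = (\<integral>\<^sup>+z. (g (fst z) (snd z))\<^sup>2 \<partial>?P)"
    using g by (intro i) auto
  ultimately show ?thesis
    using Cauchy_Schwarz_nn_integral[OF m m, of f g] f g by simp
qed

section \<open>Schur bounds\<close>

text \<open>The natural exponent is \<open>-1/2\<close>.  The slightly weaker \<open>-7/16\<close> leaves a factor \<open>jbr x powr (-9/16)\<close>,
  which is square integrable, of \<open>jbr x powr (-1)\<close> in the \<open>L\<^sup>1\<close> part of the \<open>Z\<close> norm.\<close>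

definition jw :: "real \<Rightarrow> real"
  where "jw x = jbr x powr (-(7/16))"

lemma jw_nonneg[simp]: "0 \<le> jw x"
  by (simp add: jw_def)

lemma jw_measurable[measurable]: "jw \<in> borel_measurable borel"
  unfolding jw_def by measurable

lemma jw_minus: "jw (a - b) = jw (b - a)"
  using jbr_minus[of "a - b"] by (simp add: jw_def)

lemma jw_square: "(jw x)\<^sup>2 = jbr x powr (-(7/8))"
  by (simp add: jw_def power2_eq_square flip: powr_add)

lemma nn_integral_product_shift:
  fixes f g :: "real \<Rightarrow> ennreal"
  assumes [measurable]: "f \<in> borel_measurable borel" "g \<in> borel_measurable borel"
  shows "(\<integral>\<^sup>+x. \<integral>\<^sup>+y. f y * g (x - y - a) \<partial>lborel \<partial>lborel) = (\<integral>\<^sup>+y. f y \<partial>lborel) * (\<integral>\<^sup>+y. g y \<partial>lborel)"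
proof -
  have "(\<integral>\<^sup>+x. \<integral>\<^sup>+y. f y * g (x - y - a) \<partial>lborel \<partial>lborel) = (\<integral>\<^sup>+y. \<integral>\<^sup>+x. f y * g (x - y - a) \<partial>lborel \<partial>lborel)"
    by (rule lborel_pair.Fubini') measurable
  also have "\<dots> = (\<integral>\<^sup>+y. f y * (\<integral>\<^sup>+x. g x \<partial>lborel) \<partial>lborel)"
    using nn_integral_shift[of g "- _ - a"] by (intro nn_integral_cong) (simp add: nn_integral_cmult algebra_simps)
  finally show ?thesis by (simp add: nn_integral_multc)
qed

lemma nn_integral_reflect_shift:
  fixes g :: "real \<Rightarrow> ennreal"
  assumes "g \<in> borel_measurable borel"
  shows "(\<integral>\<^sup>+y. g (x - y - a) \<partial>lborel) = (\<integral>\<^sup>+y. g y \<partial>lborel)"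
  using nn_integral_reflect[OF assms, of "x - a"] by (simp add: algebra_simps)

lemma sum_fiber_le:
  fixes G :: "int \<Rightarrow> ennreal"
  assumes "finite A" "finite K" "q ` A \<subseteq> K" "inj_on q A"
  shows "(\<Sum>i\<in>A. G (q i)) \<le> (\<Sum>k\<in>K. G k)"
proof -
  have "(\<Sum>i\<in>A. G (q i)) = (\<Sum>k\<in>q ` A. G k)" using assms by (simp add: sum.reindex)
  also have "\<dots> \<le> (\<Sum>k\<in>K. G k)" using assms by (intro sum_mono2) auto
  finally show ?thesis .
qed

text \<open>The modulation of the first input is the largest one.  The factor \<open>g\<close> is taken out by
  Cauchy--Schwarz at fixed output, and the kernel is then summed with the first input fixed, which
  avoids a duality argument.\<close>

lemma schur_bound:
  fixes f g :: "int \<Rightarrow> real \<Rightarrow> ennreal" and w \<eta> :: "'i \<Rightarrow> real" and p q r :: "'i \<Rightarrow> int"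
  assumes fin: "finite I" "finite K" and K: "p ` I \<subseteq> K" "q ` I \<subseteq> K" "r ` I \<subseteq> K"
    and inj: "\<And>k. inj_on q {i\<in>I. r i = k}"
    and w: "\<And>i. 0 \<le> w i" and C0: "0 \<le> C0"
    and conv: "\<And>M. (\<integral>\<^sup>+x. ennreal ((jw x)\<^sup>2 * (jw (M - x))\<^sup>2) \<partial>lborel) \<le> ennreal (C0 * jbr M powr (-(5/8)))"
    and bound: "\<And>k y. (\<Sum>i\<in>{i\<in>I. p i = k}. w i * jbr (y + \<eta> i) powr (-(5/8))) \<le> C"
    and [measurable]: "\<And>k. f k \<in> borel_measurable borel" "\<And>k. g k \<in> borel_measurable borel"
  shows "(\<Sum>k\<in>K. \<integral>\<^sup>+x. (\<Sum>i\<in>{i\<in>I. r i = k}.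
      \<integral>\<^sup>+y. ennreal (sqrt (w i) * jw x * jw (x - y - \<eta> i)) * f (p i) y * g (q i) (x - y - \<eta> i) \<partial>lborel)\<^sup>2 \<partial>lborel)
    \<le> ennreal (C0 * C) * (\<Sum>k\<in>K. \<integral>\<^sup>+y. (f k y)\<^sup>2 \<partial>lborel) * (\<Sum>k\<in>K. \<integral>\<^sup>+y. (g k y)\<^sup>2 \<partial>lborel)"
proof -
  let ?I = "\<lambda>k. {i\<in>I. r i = k}"
  let ?G = "\<Sum>k\<in>K. \<integral>\<^sup>+y. (g k y)\<^sup>2 \<partial>lborel"
  \<comment> \<open>The square of kernel times \<open>f\<close>, after \<open>g\<close> has been
    split off. The argument of the second \<open>jw\<close> is reversed so that the integral in
    \<open>x\<close> becomes a convolution.\<close>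
  let ?E = "\<lambda>i x y. ennreal (w i * ((jw x)\<^sup>2 * (jw (y + \<eta> i - x))\<^sup>2)) * (f (p i) y)\<^sup>2"
  have "(\<Sum>i\<in>?I k. \<integral>\<^sup>+y. ennreal (sqrt (w i) * jw x * jw (x - y - \<eta> i)) * f (p i) y * g (q i) (x - y - \<eta> i) \<partial>lborel)\<^sup>2
     \<le> (\<Sum>i\<in>?I k. \<integral>\<^sup>+y. ?E i x y \<partial>lborel) * ?G" for k x
  proof -
    have "(\<Sum>i\<in>?I k. \<integral>\<^sup>+y. ennreal (sqrt (w i) * jw x * jw (x - y - \<eta> i)) * f (p i) y * g (q i) (x - y - \<eta> i) \<partial>lborel)\<^sup>2
      \<le> (\<Sum>i\<in>?I k. \<integral>\<^sup>+y. (ennreal (sqrt (w i) * jw x * jw (x - y - \<eta> i)) * f (p i) y)\<^sup>2 \<partial>lborel)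
        * (\<Sum>i\<in>?I k. \<integral>\<^sup>+y. (g (q i) (x - y - \<eta> i))\<^sup>2 \<partial>lborel)"
      using fin by (intro Cauchy_Schwarz_sum_nn_integral lborel.sigma_finite_measure_axioms) (auto intro!: borel_measurable_times)
    also have "(\<Sum>i\<in>?I k. \<integral>\<^sup>+y. (g (q i) (x - y - \<eta> i))\<^sup>2 \<partial>lborel) = (\<Sum>i\<in>?I k. \<integral>\<^sup>+y. (g (q i) y)\<^sup>2 \<partial>lborel)"
      by (intro sum.cong refl nn_integral_reflect_shift[of "\<lambda>y. (g _ y)\<^sup>2"]) measurable
    also have "\<dots> \<le> ?G"
      using fin K inj by (intro sum_fiber_le) auto
    also have "(\<Sum>i\<in>?I k. \<integral>\<^sup>+y. (ennreal (sqrt (w i) * jw x * jw (x - y - \<eta> i)) * f (p i) y)\<^sup>2 \<partial>lborel)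
       = (\<Sum>i\<in>?I k. \<integral>\<^sup>+y. ?E i x y \<partial>lborel)"
    proof (intro sum.cong refl nn_integral_cong)
      fix i y
      have "jw (x - y - \<eta> i) = jw (y + \<eta> i - x)" using jw_minus[of x "y + \<eta> i"] by (simp add: algebra_simps)
      then have "(sqrt (w i) * jw x * jw (x - y - \<eta> i))\<^sup>2 = w i * ((jw x)\<^sup>2 * (jw (y + \<eta> i - x))\<^sup>2)"
        using w[of i] by (simp add: power_mult_distrib)
      moreover have "(ennreal (sqrt (w i) * jw x * jw (x - y - \<eta> i)))\<^sup>2 = ennreal ((sqrt (w i) * jw x * jw (x - y - \<eta> i))\<^sup>2)"
        using w[of i] by (intro ennreal_power) simp
      ultimately show "(ennreal (sqrt (w i) * jw x * jw (x - y - \<eta> i)) * f (p i) y)\<^sup>2 = ?E i x y"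
        by (simp only: power_mult_distrib[of "ennreal _"])
    qed
    finally show ?thesis by (simp add: mult_left_mono)
  qed
  then have "(\<Sum>k\<in>K. \<integral>\<^sup>+x. (\<Sum>i\<in>?I k.
      \<integral>\<^sup>+y. ennreal (sqrt (w i) * jw x * jw (x - y - \<eta> i)) * f (p i) y * g (q i) (x - y - \<eta> i) \<partial>lborel)\<^sup>2 \<partial>lborel)
    \<le> (\<Sum>k\<in>K. \<integral>\<^sup>+x. (\<Sum>i\<in>?I k. \<integral>\<^sup>+y. ?E i x y \<partial>lborel) * ?G \<partial>lborel)"
    by (intro sum_mono nn_integral_mono)
  also have "\<dots> = (\<Sum>k\<in>K. \<Sum>i\<in>?I k. \<integral>\<^sup>+x. \<integral>\<^sup>+y. ?E i x y \<partial>lborel \<partial>lborel) * ?G"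
    by (simp add: nn_integral_multc nn_integral_sum sum_distrib_right)
  also have "(\<Sum>k\<in>K. \<Sum>i\<in>?I k. \<integral>\<^sup>+x. \<integral>\<^sup>+y. ?E i x y \<partial>lborel \<partial>lborel) = (\<Sum>i\<in>I. \<integral>\<^sup>+x. \<integral>\<^sup>+y. ?E i x y \<partial>lborel \<partial>lborel)"
    by (rule sum.group) (use fin K in auto)
  also have "\<dots> \<le> (\<Sum>i\<in>I. \<integral>\<^sup>+y. ennreal (C0 * (w i * jbr (y + \<eta> i) powr (-(5/8)))) * (f (p i) y)\<^sup>2 \<partial>lborel)"
  proof (rule sum_mono)
    fix i
    have "(\<integral>\<^sup>+x. \<integral>\<^sup>+y. ?E i x y \<partial>lborel \<partial>lborel) = (\<integral>\<^sup>+y. \<integral>\<^sup>+x. ?E i x y \<partial>lborel \<partial>lborel)"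
      by (rule lborel_pair.Fubini') measurable
    also have "\<dots> = (\<integral>\<^sup>+y. ennreal (w i) * (\<integral>\<^sup>+x. ennreal ((jw x)\<^sup>2 * (jw (y + \<eta> i - x))\<^sup>2) \<partial>lborel) * (f (p i) y)\<^sup>2 \<partial>lborel)"
      unfolding ennreal_mult'[OF w]
      by (intro nn_integral_cong) (subst nn_integral_multc, measurable, subst nn_integral_cmult, measurable)
    also have "\<dots> \<le> (\<integral>\<^sup>+y. ennreal (w i) * ennreal (C0 * jbr (y + \<eta> i) powr (-(5/8))) * (f (p i) y)\<^sup>2 \<partial>lborel)"
      by (intro nn_integral_mono mult_right_mono mult_left_mono conv) auto
    also have "\<dots> = (\<integral>\<^sup>+y. ennreal (C0 * (w i * jbr (y + \<eta> i) powr (-(5/8)))) * (f (p i) y)\<^sup>2 \<partial>lborel)"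
      using w C0 by (intro nn_integral_cong) (simp add: ennreal_mult[symmetric] mult_ac)
    finally show "(\<integral>\<^sup>+x. \<integral>\<^sup>+y. ?E i x y \<partial>lborel \<partial>lborel) \<le> \<dots>" .
  qed
  \<comment> \<open>Regrouping by the first input makes \<open>f\<close> common to each fibre, so
    that the weights can be summed against the bracket left by the convolution.\<close>
  also have "\<dots> = (\<Sum>k\<in>K. \<Sum>i\<in>{i\<in>I. p i = k}. \<integral>\<^sup>+y. ennreal (C0 * (w i * jbr (y + \<eta> i) powr (-(5/8)))) * (f (p i) y)\<^sup>2 \<partial>lborel)"
    by (rule sum.group[symmetric]) (use fin K in auto)
  also have "\<dots> = (\<Sum>k\<in>K. \<Sum>i\<in>{i\<in>I. p i = k}. \<integral>\<^sup>+y. ennreal (C0 * (w i * jbr (y + \<eta> i) powr (-(5/8)))) * (f k y)\<^sup>2 \<partial>lborel)"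
    by (intro sum.cong refl) auto
  also have "\<dots> = (\<Sum>k\<in>K. \<integral>\<^sup>+y. ennreal (C0 * (\<Sum>i\<in>{i\<in>I. p i = k}. w i * jbr (y + \<eta> i) powr (-(5/8)))) * (f k y)\<^sup>2 \<partial>lborel)"
    using C0 w by (simp add: nn_integral_sum[symmetric] sum_distrib_right[symmetric] sum_distrib_left)
  also have "\<dots> \<le> (\<Sum>k\<in>K. \<integral>\<^sup>+y. ennreal (C0 * C) * (f k y)\<^sup>2 \<partial>lborel)"
    using C0 by (intro sum_mono nn_integral_mono mult_right_mono ennreal_leI mult_left_mono bound) auto
  also have "\<dots> = ennreal (C0 * C) * (\<Sum>k\<in>K. \<integral>\<^sup>+y. (f k y)\<^sup>2 \<partial>lborel)"
    by (simp add: nn_integral_cmult sum_distrib_left)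
  finally show ?thesis by (simp add: mult_right_mono)
qed

lemma pair_sum_le:
  fixes F G :: "int \<Rightarrow> ennreal"
  assumes fin: "finite I" "finite K" and K: "p ` I \<subseteq> K" "q ` I \<subseteq> K" "r ` I \<subseteq> K"
    and inj: "inj_on (\<lambda>i. (p i, q i)) I"
  shows "(\<Sum>k\<in>K. \<Sum>i\<in>{i\<in>I. r i = k}. F (p i) * G (q i)) \<le> (\<Sum>k\<in>K. F k) * (\<Sum>k\<in>K. G k)"
proof -
  have "(\<Sum>k\<in>K. \<Sum>i\<in>{i\<in>I. r i = k}. F (p i) * G (q i)) = (\<Sum>i\<in>I. F (p i) * G (q i))"
    by (rule sum.group) (use fin K in auto)
  also have "\<dots> = (\<Sum>(a, b)\<in>(\<lambda>i. (p i, q i)) ` I. F a * G b)"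
    using inj by (simp add: sum.reindex)
  also have "\<dots> \<le> (\<Sum>(a, b)\<in>K \<times> K. F a * G b)"
    using fin K by (intro sum_mono2) auto
  also have "\<dots> = (\<Sum>k\<in>K. F k) * (\<Sum>k\<in>K. G k)"
    by (simp add: sum_product sum.cartesian_product)
  finally show ?thesis .
qed

text \<open>The modulation of the output is the largest one.\<close>

lemma output_bounds:
  fixes f g :: "int \<Rightarrow> real \<Rightarrow> ennreal" and w \<eta> :: "'i \<Rightarrow> real" and p q r :: "'i \<Rightarrow> int"
  assumes fin: "finite I" "finite K" and K: "p ` I \<subseteq> K" "q ` I \<subseteq> K" "r ` I \<subseteq> K"
    and inj: "inj_on (\<lambda>i. (p i, q i)) I"
    and w: "\<And>i. 0 \<le> w i" and C0: "0 \<le> C0" and C1: "0 \<le> C1"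
    and conv: "\<And>M. (\<integral>\<^sup>+x. ennreal ((jw x)\<^sup>2 * (jw (M - x))\<^sup>2) \<partial>lborel) \<le> ennreal (C0 * jbr M powr (-(5/8)))"
    and conv1: "\<And>M. (\<integral>\<^sup>+x. ennreal (jbr x powr (-1) * jbr (M - x) powr (-(5/8))) \<partial>lborel) \<le> ennreal (C1 * jbr M powr (-(1/4)))"
    and bound: "\<And>k x. (\<Sum>i\<in>{i\<in>I. r i = k}. w i * jbr (x - \<eta> i) powr (-(1/4))) \<le> C"
    and [measurable]: "\<And>k. f k \<in> borel_measurable borel" "\<And>k. g k \<in> borel_measurable borel"
  shows "(\<Sum>k\<in>K. \<integral>\<^sup>+x. (\<Sum>i\<in>{i\<in>I. r i = k}.
      \<integral>\<^sup>+y. ennreal (sqrt (w i) * jw y * jw (x - y - \<eta> i)) * (f (p i) y * g (q i) (x - y - \<eta> i)) \<partial>lborel)\<^sup>2 \<partial>lborel)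
    \<le> ennreal (C0 * C) * ((\<Sum>k\<in>K. \<integral>\<^sup>+y. (f k y)\<^sup>2 \<partial>lborel) * (\<Sum>k\<in>K. \<integral>\<^sup>+y. (g k y)\<^sup>2 \<partial>lborel))" (is ?X)
  and "(\<Sum>k\<in>K. (\<integral>\<^sup>+x. ennreal (jbr x powr (-(1/2))) * (\<Sum>i\<in>{i\<in>I. r i = k}.
      \<integral>\<^sup>+y. ennreal (sqrt (w i) * jw y * jw (x - y - \<eta> i)) * (f (p i) y * g (q i) (x - y - \<eta> i)) \<partial>lborel) \<partial>lborel)\<^sup>2)
    \<le> ennreal (C0 * C1 * C) * ((\<Sum>k\<in>K. \<integral>\<^sup>+y. (f k y)\<^sup>2 \<partial>lborel) * (\<Sum>k\<in>K. \<integral>\<^sup>+y. (g k y)\<^sup>2 \<partial>lborel))" (is ?Z)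
proof -
  let ?I = "\<lambda>k. {i\<in>I. r i = k}"
  let ?FG = "(\<Sum>k\<in>K. \<integral>\<^sup>+y. (f k y)\<^sup>2 \<partial>lborel) * (\<Sum>k\<in>K. \<integral>\<^sup>+y. (g k y)\<^sup>2 \<partial>lborel)"
  let ?a = "\<lambda>i x y. ennreal (sqrt (w i) * jw y * jw (x - y - \<eta> i))"
  let ?b = "\<lambda>i x y. f (p i) y * g (q i) (x - y - \<eta> i)"
  have kern: "(\<integral>\<^sup>+y. (?a i x y)\<^sup>2 \<partial>lborel) \<le> ennreal (C0 * (w i * jbr (x - \<eta> i) powr (-(5/8))))" for i x
  proof -
    have "(\<integral>\<^sup>+y. (?a i x y)\<^sup>2 \<partial>lborel) = (\<integral>\<^sup>+y. ennreal (w i) * ennreal ((jw y)\<^sup>2 * (jw ((x - \<eta> i) - y))\<^sup>2) \<partial>lborel)"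
      using w by (intro nn_integral_cong) (simp add: power_mult_distrib ennreal_power ennreal_mult[symmetric] algebra_simps)
    also have "\<dots> \<le> ennreal (w i) * ennreal (C0 * jbr (x - \<eta> i) powr (-(5/8)))"
      by (subst nn_integral_cmult) (auto intro!: mult_left_mono conv)
    also have "\<dots> = ennreal (C0 * (w i * jbr (x - \<eta> i) powr (-(5/8))))"
      using w C0 by (simp add: ennreal_mult[symmetric] mult_ac)
    finally show ?thesis .
  qed
  have fg: "(\<Sum>k\<in>K. \<Sum>i\<in>?I k. \<integral>\<^sup>+x. \<integral>\<^sup>+y. (?b i x y)\<^sup>2 \<partial>lborel \<partial>lborel) \<le> ?FG"
  proof -
    have "(\<integral>\<^sup>+x. \<integral>\<^sup>+y. (?b i x y)\<^sup>2 \<partial>lborel \<partial>lborel) = (\<integral>\<^sup>+y. (f (p i) y)\<^sup>2 \<partial>lborel) * (\<integral>\<^sup>+y. (g (q i) y)\<^sup>2 \<partial>lborel)" for i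
      unfolding power_mult_distrib by (rule nn_integral_product_shift[of "\<lambda>y. (f _ y)\<^sup>2" "\<lambda>y. (g _ y)\<^sup>2"]) measurable
    then show ?thesis
      using pair_sum_le[OF fin K inj, of "\<lambda>k. \<integral>\<^sup>+y. (f k y)\<^sup>2 \<partial>lborel" "\<lambda>k. \<integral>\<^sup>+y. (g k y)\<^sup>2 \<partial>lborel"] by simp
  qed
  show ?X
  proof -
    have "(\<Sum>i\<in>?I k. \<integral>\<^sup>+y. ?a i x y * ?b i x y \<partial>lborel)\<^sup>2 \<le> ennreal (C0 * C) * (\<Sum>i\<in>?I k. \<integral>\<^sup>+y. (?b i x y)\<^sup>2 \<partial>lborel)" for k x
    proof -
      have "(\<Sum>i\<in>?I k. \<integral>\<^sup>+y. (?a i x y)\<^sup>2 \<partial>lborel) \<le> (\<Sum>i\<in>?I k. ennreal (C0 * (w i * jbr (x - \<eta> i) powr (-(5/8)))))"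
        by (intro sum_mono kern)
      also have "\<dots> = ennreal (C0 * (\<Sum>i\<in>?I k. w i * jbr (x - \<eta> i) powr (-(5/8))))"
        using w C0 by (simp add: sum_distrib_left)
      also have "\<dots> \<le> ennreal (C0 * C)"
      proof (intro ennreal_leI mult_left_mono C0)
        \<comment> \<open>Brackets are at least \<open>1\<close>, so the bound with exponent
          \<open>1/4\<close> covers \<open>5/8\<close>.\<close>
        have "(\<Sum>i\<in>?I k. w i * jbr (x - \<eta> i) powr (-(5/8))) \<le> (\<Sum>i\<in>?I k. w i * jbr (x - \<eta> i) powr (-(1/4)))"
          using w jbr_ge_1 by (intro sum_mono mult_left_mono powr_mono) auto
        then show "(\<Sum>i\<in>?I k. w i * jbr (x - \<eta> i) powr (-(5/8))) \<le> C" using bound[where k = k and x = x] by linarith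
      qed
      finally have "(\<Sum>i\<in>?I k. \<integral>\<^sup>+y. (?a i x y)\<^sup>2 \<partial>lborel) \<le> ennreal (C0 * C)" .
      then have "(\<Sum>i\<in>?I k. \<integral>\<^sup>+y. (?a i x y)\<^sup>2 \<partial>lborel) * (\<Sum>i\<in>?I k. \<integral>\<^sup>+y. (?b i x y)\<^sup>2 \<partial>lborel)
          \<le> ennreal (C0 * C) * (\<Sum>i\<in>?I k. \<integral>\<^sup>+y. (?b i x y)\<^sup>2 \<partial>lborel)" by (rule mult_right_mono) simp
      moreover have "(\<Sum>i\<in>?I k. \<integral>\<^sup>+y. ?a i x y * ?b i x y \<partial>lborel)\<^sup>2
          \<le> (\<Sum>i\<in>?I k. \<integral>\<^sup>+y. (?a i x y)\<^sup>2 \<partial>lborel) * (\<Sum>i\<in>?I k. \<integral>\<^sup>+y. (?b i x y)\<^sup>2 \<partial>lborel)"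
        using fin by (intro Cauchy_Schwarz_sum_nn_integral lborel.sigma_finite_measure_axioms) auto
      ultimately show ?thesis by (rule order_trans[rotated])
    qed
    then have "(\<Sum>k\<in>K. \<integral>\<^sup>+x. (\<Sum>i\<in>?I k. \<integral>\<^sup>+y. ?a i x y * ?b i x y \<partial>lborel)\<^sup>2 \<partial>lborel)
      \<le> (\<Sum>k\<in>K. \<integral>\<^sup>+x. ennreal (C0 * C) * (\<Sum>i\<in>?I k. \<integral>\<^sup>+y. (?b i x y)\<^sup>2 \<partial>lborel) \<partial>lborel)"
      by (intro sum_mono nn_integral_mono)
    also have "\<dots> = ennreal (C0 * C) * (\<Sum>k\<in>K. \<Sum>i\<in>?I k. \<integral>\<^sup>+x. \<integral>\<^sup>+y. (?b i x y)\<^sup>2 \<partial>lborel \<partial>lborel)"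
      by (simp add: nn_integral_cmult nn_integral_sum sum_distrib_left)
    also have "\<dots> \<le> ennreal (C0 * C) * ?FG" using fg by (rule mult_left_mono) simp
    finally show ?thesis .
  qed
  show ?Z
  proof -
    let ?L = "lborel \<Otimes>\<^sub>M lborel :: (real \<times> real) measure"
    let ?j = "\<lambda>x. ennreal (jbr x powr (-(1/2)))"
    have "(\<integral>\<^sup>+x. ?j x * (\<Sum>i\<in>?I k. \<integral>\<^sup>+y. ?a i x y * ?b i x y \<partial>lborel) \<partial>lborel)\<^sup>2
       \<le> ennreal (C0 * C1 * C) * (\<Sum>i\<in>?I k. \<integral>\<^sup>+x. \<integral>\<^sup>+y. (?b i x y)\<^sup>2 \<partial>lborel \<partial>lborel)" for k
    proof -
      \<comment> \<open>Cauchy--Schwarz runs over \<open>i\<close>, \<open>x\<close> and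
        \<open>y\<close> jointly. The factor \<open>jbr x powr (-(1/2))\<close> goes with the
        kernel; its square \<open>jbr x powr (-1)\<close>, convolved with the bracket of exponent
        \<open>5/8\<close>, leaves \<open>jbr (\<eta> i) powr (-(1/4))\<close>.\<close>
      let ?A = "\<lambda>i z. ?j (fst z) * ?a i (fst z) (snd z)" and ?B = "\<lambda>i z. ?b i (fst z) (snd z)"
      have "(\<integral>\<^sup>+x. ?j x * (\<Sum>i\<in>?I k. \<integral>\<^sup>+y. ?a i x y * ?b i x y \<partial>lborel) \<partial>lborel)
        = (\<Sum>i\<in>?I k. \<integral>\<^sup>+x. \<integral>\<^sup>+y. ?j x * ?a i x y * ?b i x y \<partial>lborel \<partial>lborel)"
        by (simp add: sum_distrib_left nn_integral_sum nn_integral_cmult[symmetric] mult.assoc)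
      also have "\<dots> = (\<Sum>i\<in>?I k. \<integral>\<^sup>+z. ?A i z * ?B i z \<partial>?L)"
        by (subst lborel.nn_integral_fst[symmetric]) auto
      finally have e: "(\<integral>\<^sup>+x. ?j x * (\<Sum>i\<in>?I k. \<integral>\<^sup>+y. ?a i x y * ?b i x y \<partial>lborel) \<partial>lborel)
          = (\<Sum>i\<in>?I k. \<integral>\<^sup>+z. ?A i z * ?B i z \<partial>?L)" .
      have s: "sigma_finite_measure ?L" by (rule lborel_pair.sigma_finite_measure_axioms)
      have "(\<Sum>i\<in>?I k. \<integral>\<^sup>+z. ?A i z * ?B i z \<partial>?L)\<^sup>2 \<le> (\<Sum>i\<in>?I k. \<integral>\<^sup>+z. (?A i z)\<^sup>2 \<partial>?L) * (\<Sum>i\<in>?I k. \<integral>\<^sup>+z. (?B i z)\<^sup>2 \<partial>?L)"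
        using fin by (intro Cauchy_Schwarz_sum_nn_integral s) auto
      also have "(\<Sum>i\<in>?I k. \<integral>\<^sup>+z. (?B i z)\<^sup>2 \<partial>?L) = (\<Sum>i\<in>?I k. \<integral>\<^sup>+x. \<integral>\<^sup>+y. (?b i x y)\<^sup>2 \<partial>lborel \<partial>lborel)"
        by (subst lborel.nn_integral_fst[symmetric]) auto
      also have "(\<Sum>i\<in>?I k. \<integral>\<^sup>+z. (?A i z)\<^sup>2 \<partial>?L) \<le> ennreal (C0 * C1 * C)"
      proof -
        have "(\<integral>\<^sup>+z. (?A i z)\<^sup>2 \<partial>?L) \<le> ennreal (C0 * C1 * (w i * jbr (\<eta> i) powr (-(1/4))))" for i
        proof -
          have jj: "(?j x)\<^sup>2 = ennreal (jbr x powr (-1))" for x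
          proof -
            have "(?j x)\<^sup>2 = ennreal ((jbr x powr (-(1/2)))\<^sup>2)" by (rule ennreal_power) simp
            also have "(jbr x powr (-(1/2)))\<^sup>2 = jbr x powr (-(1/2) + -(1/2))"
              by (simp only: power2_eq_square powr_add)
            finally show ?thesis by simp
          qed
          have "(\<integral>\<^sup>+z. (?A i z)\<^sup>2 \<partial>?L) = (\<integral>\<^sup>+x. \<integral>\<^sup>+y. (?j x * ?a i x y)\<^sup>2 \<partial>lborel \<partial>lborel)"
            by (subst lborel.nn_integral_fst[symmetric]) auto
          also have "\<dots> = (\<integral>\<^sup>+x. ennreal (jbr x powr (-1)) * (\<integral>\<^sup>+y. (?a i x y)\<^sup>2 \<partial>lborel) \<partial>lborel)"
            unfolding power_mult_distrib jj by (intro nn_integral_cong nn_integral_cmult) measurable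
          also have "\<dots> \<le> (\<integral>\<^sup>+x. ennreal (jbr x powr (-1)) * ennreal (C0 * (w i * jbr (x - \<eta> i) powr (-(5/8)))) \<partial>lborel)"
            by (intro nn_integral_mono mult_left_mono kern) auto
          also have "\<dots> = (\<integral>\<^sup>+x. ennreal (C0 * w i) * ennreal (jbr x powr (-1) * jbr (\<eta> i - x) powr (-(5/8))) \<partial>lborel)"
            using w C0 jbr_minus[of "_ - \<eta> i"] by (intro nn_integral_cong) (simp add: ennreal_mult[symmetric] mult_ac)
          also have "\<dots> \<le> ennreal (C0 * w i) * ennreal (C1 * jbr (\<eta> i) powr (-(1/4)))"
            by (subst nn_integral_cmult, measurable) (intro mult_left_mono conv1 zero_le)
          also have "\<dots> = ennreal (C0 * C1 * (w i * jbr (\<eta> i) powr (-(1/4))))"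
            using w C0 C1 by (simp add: ennreal_mult[symmetric] mult_ac)
          finally show ?thesis .
        qed
        then have "(\<Sum>i\<in>?I k. \<integral>\<^sup>+z. (?A i z)\<^sup>2 \<partial>?L) \<le> (\<Sum>i\<in>?I k. ennreal (C0 * C1 * (w i * jbr (\<eta> i) powr (-(1/4)))))"
          by (intro sum_mono)
        also have "\<dots> = ennreal (C0 * C1 * (\<Sum>i\<in>?I k. w i * jbr (\<eta> i) powr (-(1/4))))"
          using w C0 C1 by (simp add: sum_distrib_left)
        \<comment> \<open>Taking \<open>x = 0\<close> turns the bracket in \<open>bound\<close> into
          \<open>jbr (- \<eta> i)\<close>, and \<open>jbr\<close> is even.\<close>
        also have "\<dots> \<le> ennreal (C0 * C1 * C)"
          using bound[where x = 0 and k = k] C0 C1 by (intro ennreal_leI mult_left_mono) auto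
        finally show ?thesis .
      qed
      finally show ?thesis unfolding e by (simp add: mult_right_mono)
    qed
    then have "(\<Sum>k\<in>K. (\<integral>\<^sup>+x. ?j x * (\<Sum>i\<in>?I k. \<integral>\<^sup>+y. ?a i x y * ?b i x y \<partial>lborel) \<partial>lborel)\<^sup>2)
      \<le> (\<Sum>k\<in>K. ennreal (C0 * C1 * C) * (\<Sum>i\<in>?I k. \<integral>\<^sup>+x. \<integral>\<^sup>+y. (?b i x y)\<^sup>2 \<partial>lborel \<partial>lborel))"
      by (intro sum_mono)
    also have "\<dots> = ennreal (C0 * C1 * C) * (\<Sum>k\<in>K. \<Sum>i\<in>?I k. \<integral>\<^sup>+x. \<integral>\<^sup>+y. (?b i x y)\<^sup>2 \<partial>lborel \<partial>lborel)"
      by (simp add: sum_distrib_left)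
    also have "\<dots> \<le> ennreal (C0 * C1 * C) * ?FG" using fg by (rule mult_left_mono) simp
    finally show ?thesis .
  qed
qed

section \<open>The bilinear estimate on the Fourier side\<close>

text \<open>As \<open>\<eta> = x - y - z\<close>, one of the three brackets is at least
  \<open>\<bar>\<eta>\<bar> / 3\<close>. Its power \<open>-1/2\<close> absorbs \<open>1 / h\<close>;
  this is the origin of the \<open>3\<close> in \<open>res_weight\<close>.\<close>

lemma modulation_cases:
  fixes h :: real
  assumes h: "h > 0" and \<eta>: "\<eta> \<noteq> 0" and w: "w = 3 / (h\<^sup>2 * \<bar>\<eta>\<bar>)" and z: "z = x - y - \<eta>"
  obtains "1 / h * jbr x powr (-(1/2)) \<le> sqrt w" | "1 / h * jbr y powr (-(1/2)) \<le> sqrt w"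
    | "1 / h * jbr z powr (-(1/2)) \<le> sqrt w"
proof -
  have *: "1 / h * u powr (-(1/2)) \<le> sqrt w" if "\<bar>\<eta>\<bar> / 3 \<le> u" for u
  proof -
    have "u powr (-(1/2)) \<le> (\<bar>\<eta>\<bar> / 3) powr (-(1/2))" using that \<eta> by (intro powr_mono2') auto
    also have "\<dots> = sqrt (3 / \<bar>\<eta>\<bar>)"
      using \<eta> by (simp add: powr_minus powr_half_sqrt real_sqrt_divide)
    finally have "1 / h * u powr (-(1/2)) \<le> 1 / h * sqrt (3 / \<bar>\<eta>\<bar>)" using h by (intro mult_left_mono) auto
    also have "\<dots> = sqrt w" using h by (simp add: w real_sqrt_divide real_sqrt_mult)
    finally show ?thesis .
  qed
  have "\<bar>\<eta>\<bar> \<le> jbr x + jbr y + jbr z"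
    using jbr_ge_abs[of x] jbr_ge_abs[of y] jbr_ge_abs[of z] unfolding z by linarith
  then have "\<bar>\<eta>\<bar> / 3 \<le> jbr x \<or> \<bar>\<eta>\<bar> / 3 \<le> jbr y \<or> \<bar>\<eta>\<bar> / 3 \<le> jbr z" by linarith
  then show ?thesis using * that by blast
qed

lemma jbr_powr_le_jw: "jbr x powr (-(1/2)) \<le> jw x"
  unfolding jw_def using jbr_ge_1[of x] by (intro powr_mono) auto

lemma jbr_powr_inverse_jw: "jbr x powr (-1) = jbr x powr (-(9/16)) * jw x"
  unfolding jw_def by (simp flip: powr_add)

lemma jbr_powr_inverse_half: "jbr x powr (-1) = jbr x powr (-(1/2)) * jbr x powr (-(1/2))"
  by (simp flip: powr_add)

text \<open>Whichever modulation dominates pays for \<open>1 / h\<close>, the other two keep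
  \<open>jw\<close>, and the three cases are added up. In the second bound a dominant output uses
  only half of its exponent \<open>1\<close>, the other half staying outside, while for a dominant
  input the output factor splits as \<open>9/16 + 7/16\<close>, the latter being
  \<open>jw x\<close>.\<close>

lemma kernel_split:
  fixes h :: real
  assumes h: "h > 0" and \<eta>: "\<eta> \<noteq> 0" and w: "w = 3 / (h\<^sup>2 * \<bar>\<eta>\<bar>)" and z: "z = x - y - \<eta>"
  shows "jbr x powr (-(1/2)) * (1 / h * jbr y powr (-(1/2)) * jbr z powr (-(1/2)))
      \<le> sqrt w * jw y * jw z + sqrt w * jw x * jw z + sqrt w * jw x * jw y"
    and "jbr x powr (-1) * (1 / h * jbr y powr (-(1/2)) * jbr z powr (-(1/2)))
      \<le> jbr x powr (-(1/2)) * (sqrt w * jw y * jw z) + jbr x powr (-(9/16)) * (sqrt w * jw x * jw z)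
        + jbr x powr (-(9/16)) * (sqrt w * jw x * jw y)"
proof -
  let ?P = "\<lambda>u. jbr u powr (-(1/2))"
  note J = jbr_powr_le_jw
  have sw: "0 \<le> sqrt w" using h by (simp add: w)
  consider "1 / h * ?P x \<le> sqrt w" | "1 / h * ?P y \<le> sqrt w" | "1 / h * ?P z \<le> sqrt w"
    using modulation_cases[OF h \<eta> w z] by blast
  then show "?P x * (1 / h * ?P y * ?P z) \<le> sqrt w * jw y * jw z + sqrt w * jw x * jw z + sqrt w * jw x * jw y"
  proof cases
    case 1
    have "(1 / h * ?P x) * ?P y * ?P z \<le> sqrt w * jw y * jw z"
      using 1 h by (intro mult_mono J mult_nonneg_nonneg sw) auto
    then show ?thesis using sw by (simp add: mult_ac add_increasing2)
  next
    case 2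
    have "(1 / h * ?P y) * ?P x * ?P z \<le> sqrt w * jw x * jw z"
      using 2 h by (intro mult_mono J mult_nonneg_nonneg sw) auto
    then show ?thesis using sw by (simp add: mult_ac add_increasing2 add_increasing)
  next
    case 3
    have "(1 / h * ?P z) * ?P x * ?P y \<le> sqrt w * jw x * jw y"
      using 3 h by (intro mult_mono J mult_nonneg_nonneg sw) auto
    then show ?thesis using sw by (simp add: mult_ac add_increasing)
  qed
  consider "1 / h * ?P x \<le> sqrt w" | "1 / h * ?P y \<le> sqrt w" | "1 / h * ?P z \<le> sqrt w"
    using modulation_cases[OF h \<eta> w z] by blast
  then show "jbr x powr (-1) * (1 / h * ?P y * ?P z)
      \<le> ?P x * (sqrt w * jw y * jw z) + jbr x powr (-(9/16)) * (sqrt w * jw x * jw z)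
        + jbr x powr (-(9/16)) * (sqrt w * jw x * jw y)"
  proof cases
    case 1
    have "?P x * ((1 / h * ?P x) * ?P y * ?P z) \<le> ?P x * (sqrt w * jw y * jw z)"
      using 1 h by (intro mult_left_mono mult_mono J mult_nonneg_nonneg sw) auto
    then show ?thesis using sw unfolding jbr_powr_inverse_half[of x] by (simp add: mult_ac add_increasing2)
  next
    case 2
    have "jbr x powr (-(9/16)) * (jw x * ((1 / h * ?P y) * ?P z)) \<le> jbr x powr (-(9/16)) * (jw x * (sqrt w * jw z))"
      using 2 h by (intro mult_left_mono mult_mono J mult_nonneg_nonneg sw) auto
    then show ?thesis using sw unfolding jbr_powr_inverse_jw[of x] by (simp add: mult_ac add_increasing2 add_increasing)
  next
    case 3
    have "jbr x powr (-(9/16)) * (jw x * ((1 / h * ?P z) * ?P y)) \<le> jbr x powr (-(9/16)) * (jw x * (sqrt w * jw y))"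
      using 3 h by (intro mult_left_mono mult_mono J mult_nonneg_nonneg sw) auto
    then show ?thesis using sw unfolding jbr_powr_inverse_jw[of x] by (simp add: mult_ac add_increasing)
  qed
qed

lemma ennreal_sum3_square_le:
  fixes a b c :: ennreal
  shows "(a + b + c)\<^sup>2 \<le> 3 * (a\<^sup>2 + b\<^sup>2 + c\<^sup>2)"
proof (cases "a = top \<or> b = top \<or> c = top")
  case True
  then have "a\<^sup>2 + b\<^sup>2 + c\<^sup>2 = top" by (auto simp: power2_eq_square)
  then have "3 * (a\<^sup>2 + b\<^sup>2 + c\<^sup>2) = 3 * (top :: ennreal)" by (simp only:)
  also have "\<dots> = top" by (simp add: ennreal_mult_top)
  finally show ?thesis by (simp only: top_greatest)
next
  case False
  then obtain a' b' c' where r: "a = ennreal a'" "b = ennreal b'" "c = ennreal c'" "0 \<le> a'" "0 \<le> b'" "0 \<le> c'"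
    by (metis ennreal_cases)
  have "(a' + b' + c')\<^sup>2 \<le> 3 * (a'\<^sup>2 + b'\<^sup>2 + c'\<^sup>2)"
    using sum_squares_ge_zero[of "a' - b'" "b' - c'"] zero_le_power2[of "a' - c'"]
    by (simp add: power2_eq_square algebra_simps)
  then have "ennreal ((a' + b' + c')\<^sup>2) \<le> ennreal (3 * (a'\<^sup>2 + b'\<^sup>2 + c'\<^sup>2))" by (rule ennreal_leI)
  also have "ennreal (3 * (a'\<^sup>2 + b'\<^sup>2 + c'\<^sup>2)) = 3 * ((ennreal a')\<^sup>2 + (ennreal b')\<^sup>2 + (ennreal c')\<^sup>2)"
    using r(4-6) by (simp only: ennreal_mult ennreal_plus ennreal_power ennreal_numeral zero_le_power2
      add_nonneg_nonneg zero_le_numeral)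
  also have "ennreal ((a' + b' + c')\<^sup>2) = (ennreal a' + ennreal b' + ennreal c')\<^sup>2"
    using r(4-6) by (simp only: ennreal_plus ennreal_power[symmetric] add_nonneg_nonneg)
  finally show ?thesis unfolding r .
qed

lemma ennreal_three_sum:
  fixes F :: ennreal
  assumes "0 \<le> a" "0 \<le> b" "0 \<le> c"
  shows "3 * (ennreal a * F + ennreal b * F + ennreal c * F) = ennreal (3 * (a + b + c)) * F"
  using assms by (simp only: ennreal_mult ennreal_plus ennreal_numeral distrib_right mult.assoc
      add_nonneg_nonneg zero_le_numeral)

definition mass :: "int set \<Rightarrow> (int \<Rightarrow> real \<Rightarrow> ennreal) \<Rightarrow> ennreal"
  where "mass K f = (\<Sum>k\<in>K. \<integral>\<^sup>+y. (f k y)\<^sup>2 \<partial>lborel)"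

text \<open>\<open>f\<close> and \<open>g\<close> stand for Fourier transforms already multiplied by
  their \<open>X\<close> weights, so the kernel divides the modulation weights out again. The factor
  \<open>1 / mesh N\<close> is the part of the derivative that the modulations have to pay. All time
  variables are modulations.\<close>

definition bilin :: "nat \<Rightarrow> real \<Rightarrow> (int \<Rightarrow> real \<Rightarrow> ennreal) \<Rightarrow> (int \<Rightarrow> real \<Rightarrow> ennreal) \<Rightarrow> int \<Rightarrow> real \<Rightarrow> ennreal"
  where "bilin N \<sigma> f g k x = (\<Sum>i\<in>{i\<in>triads N. snd (snd i) = k}. \<integral>\<^sup>+y.
    ennreal (1 / mesh N * jbr y powr (-(1/2)) * jbr (x - y - \<sigma> * resonance N i) powr (-(1/2))) *
      (f (fst i) y * g (fst (snd i)) (x - y - \<sigma> * resonance N i)) \<partial>lborel)"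

text \<open>The kernels of \<open>kernel_split\<close> give \<open>S1\<close> (output dominant),
  \<open>S2\<close> (first input) and \<open>S3\<close> (second input). \<open>S1\<close> needs its
  own bound for each of the two norms; for \<open>S2\<close> and \<open>S3\<close> the L1 bound
  follows from the L2 bound by Cauchy--Schwarz against \<open>jbr x powr (-(9/16))\<close>.\<close>

proposition bilinear_estimate:
  "\<exists>C>0. \<forall>N>0. mesh N \<le> 1 \<longrightarrow> (\<forall>\<sigma>\<in>{1, -1::real}. \<forall>f g.
     (\<forall>k. f k \<in> borel_measurable borel) \<longrightarrow> (\<forall>k. g k \<in> borel_measurable borel) \<longrightarrow>
     (\<Sum>k\<in>freqs N. \<integral>\<^sup>+x. (ennreal (jbr x powr (-(1/2))) * bilin N \<sigma> f g k x)\<^sup>2 \<partial>lborel)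
        \<le> ennreal C * (mass (freqs N) f * mass (freqs N) g) \<and>
     (\<Sum>k\<in>freqs N. (\<integral>\<^sup>+x. ennreal (jbr x powr (-1)) * bilin N \<sigma> f g k x \<partial>lborel)\<^sup>2)
        \<le> ennreal C * (mass (freqs N) f * mass (freqs N) g))"
proof -
  obtain C where C: "C > 0" and sums: "\<forall>N>0. mesh N \<le> 1 \<longrightarrow> (\<forall>\<sigma>\<in>{1, -1::real}. \<forall>q r.
     (\<Sum>i\<in>{i\<in>triads N. snd (snd i) = q}. res_weight N i * jbr (r - \<sigma> * resonance N i) powr (-(1/4))) \<le> C \<and>
     (\<Sum>i\<in>{i\<in>triads N. fst i = q}. res_weight N i * jbr (r - \<sigma> * resonance N i) powr (-(1/4))) \<le> C \<and>
     (\<Sum>i\<in>{i\<in>triads N. fst (snd i) = q}. res_weight N i * jbr (r - \<sigma> * resonance N i) powr (-(5/8))) \<le> C)"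
    using triad_sum_bounds by blast
  \<comment> \<open>The exponents are admissible: \<open>7/8 + 7/8 - 5/8 = 9/8\<close> here and
    \<open>1 + 5/8 - 1/4 = 11/8\<close> for \<open>C1\<close>, both above \<open>1\<close>.\<close>
  obtain C0 where C0: "C0 > 0" and conv0: "\<forall>M. (\<integral>\<^sup>+x. ennreal (jbr x powr (-(7/8)) * jbr (M - x) powr (-(7/8))) \<partial>lborel)
     \<le> ennreal (C0 * jbr M powr (-(5/8)))"
    using jbr_convolution[of "5/8" "7/8" "7/8"] by auto
  have conv: "\<And>M. (\<integral>\<^sup>+x. ennreal ((jw x)\<^sup>2 * (jw (M - x))\<^sup>2) \<partial>lborel) \<le> ennreal (C0 * jbr M powr (-(5/8)))"
    using conv0 unfolding jw_square by blast
  obtain C1 where C1: "C1 > 0" and conv1: "\<forall>M. (\<integral>\<^sup>+x. ennreal (jbr x powr (-1) * jbr (M - x) powr (-(5/8))) \<partial>lborel)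
     \<le> ennreal (C1 * jbr M powr (-(1/4)))"
    using jbr_convolution[of "1/4" 1 "5/8"] by auto
  obtain C2 where C2: "C2 > 0" "(\<integral>\<^sup>+x. ennreal (jbr x powr (-(9/8))) \<partial>lborel) \<le> ennreal C2"
    using jbr_powr_integral[of "9/8"] by auto
  \<comment> \<open>The outer \<open>3\<close> in either half comes from the square of a three-term
    sum.\<close>
  define D where "D = 3 * (C0 * C + C0 * C + C0 * C) + 3 * (C0 * C1 * C + C2 * (C0 * C) + C2 * (C0 * C))"
  show ?thesis
  proof (intro exI[of _ D] conjI allI impI ballI)
    show "D > 0" using C C0 C1 C2 by (auto simp: D_def intro!: add_pos_pos mult_pos_pos)
    fix N :: nat and \<sigma> :: real and f g :: "int \<Rightarrow> real \<Rightarrow> ennreal"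
    assume N: "N > 0" and h1: "mesh N \<le> 1" and \<sigma>: "\<sigma> \<in> {1, -1}"
      and meas: "\<forall>k. f k \<in> borel_measurable borel" "\<forall>k. g k \<in> borel_measurable borel"
    note [measurable] = meas[rule_format]
    define h where "h = mesh N"
    have h: "h > 0" using mesh_pos[OF N] by (simp add: h_def)
    define K where "K = freqs N"
    define p q r where "p = (fst :: int \<times> int \<times> int \<Rightarrow> int)" and "q = (\<lambda>i :: int \<times> int \<times> int. fst (snd i))"
      and "r = (\<lambda>i :: int \<times> int \<times> int. snd (snd i))"
    define w where "w = res_weight N"
    define \<eta> where "\<eta> i = \<sigma> * resonance N i" for i
    let ?I = "\<lambda>k. {i\<in>triads N. r i = k}"
    have finK: "finite K" by (simp add: K_def freqs_def)
    have sub: "p ` triads N \<subseteq> K" "q ` triads N \<subseteq> K" "r ` triads N \<subseteq> K"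
      by (auto simp: p_def q_def r_def K_def triads_def)
    have w0: "0 \<le> w i" for i by (simp add: w_def res_weight_nonneg)
    have injpq: "inj_on (\<lambda>i. (p i, q i)) (triads N)"
      using triads_determined(1) by (auto simp: inj_on_def p_def q_def)
    have injq: "inj_on q (?I k)" for k unfolding q_def r_def by (rule fiber_inj)
    have injp: "inj_on p (?I k)" for k
      unfolding p_def r_def by (rule inj_onI, simp, metis triads_determined(2))
    have bA: "(\<Sum>i\<in>?I k. w i * jbr (x - \<eta> i) powr (-(1/4))) \<le> C" for k x
      using sums N h1 \<sigma> unfolding w_def \<eta>_def r_def by blast
    \<comment> \<open>With an input fixed, the resonance enters with the opposite sign; as
      \<open>jbr\<close> is even, this is absorbed by taking \<open>r = - y\<close>.\<close>
    have ev: "jbr (y + \<eta> i) = jbr ((- y) - \<sigma> * resonance N i)" for y i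
      using jbr_minus[of "y + \<eta> i"] by (simp add: \<eta>_def)
    have bB: "(\<Sum>i\<in>{i\<in>triads N. p i = k}. w i * jbr (y + \<eta> i) powr (-(5/8))) \<le> C" for k y
    proof -
      have "(\<Sum>i\<in>{i\<in>triads N. p i = k}. w i * jbr (y + \<eta> i) powr (-(5/8)))
         \<le> (\<Sum>i\<in>{i\<in>triads N. p i = k}. w i * jbr (y + \<eta> i) powr (-(1/4)))"
        using w0 jbr_ge_1 by (intro sum_mono mult_left_mono powr_mono) auto
      also have "\<dots> \<le> C" using sums N h1 \<sigma> unfolding ev w_def p_def by blast
      finally show ?thesis .
    qed
    have bC: "(\<Sum>i\<in>{i\<in>triads N. q i = k}. w i * jbr (y + \<eta> i) powr (-(5/8))) \<le> C" for k y
      using sums N h1 \<sigma> unfolding ev w_def q_def by blast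
    let ?FG = "mass K f * mass K g"
    let ?z = "\<lambda>i x y. x - y - \<eta> i"
    let ?fg = "\<lambda>i x y. f (p i) y * g (q i) (?z i x y)"
    define S1 where "S1 k x = (\<Sum>i\<in>?I k. \<integral>\<^sup>+y. ennreal (sqrt (w i) * jw y * jw (?z i x y)) * ?fg i x y \<partial>lborel)" for k x
    define S2 where "S2 k x = (\<Sum>i\<in>?I k. \<integral>\<^sup>+y. ennreal (sqrt (w i) * jw x * jw (?z i x y)) * ?fg i x y \<partial>lborel)" for k x
    define S3 where "S3 k x = (\<Sum>i\<in>?I k. \<integral>\<^sup>+y. ennreal (sqrt (w i) * jw x * jw y) * ?fg i x y \<partial>lborel)" for k x
    have [measurable]: "S1 k \<in> borel_measurable borel" "S2 k \<in> borel_measurable borel" "S3 k \<in> borel_measurable borel" for k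
      unfolding S1_def[abs_def] S2_def[abs_def] S3_def[abs_def] by measurable
    have B1: "(\<Sum>k\<in>K. \<integral>\<^sup>+x. (S1 k x)\<^sup>2 \<partial>lborel) \<le> ennreal (C0 * C) * ?FG"
      and B1': "(\<Sum>k\<in>K. (\<integral>\<^sup>+x. ennreal (jbr x powr (-(1/2))) * S1 k x \<partial>lborel)\<^sup>2) \<le> ennreal (C0 * C1 * C) * ?FG"
      using output_bounds[where f = f and g = g, OF finite_triads finK sub injpq w0 less_imp_le[OF C0] less_imp_le[OF C1] conv conv1[rule_format] bA meas[rule_format]]
      unfolding S1_def mass_def by blast+
    have B2: "(\<Sum>k\<in>K. \<integral>\<^sup>+x. (S2 k x)\<^sup>2 \<partial>lborel) \<le> ennreal (C0 * C) * ?FG"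
      using schur_bound[where f = f and g = g, OF finite_triads finK sub injq w0 less_imp_le[OF C0] conv bB meas[rule_format]]
      unfolding S2_def mass_def by (simp only: mult.assoc)
    have B3: "(\<Sum>k\<in>K. \<integral>\<^sup>+x. (S3 k x)\<^sup>2 \<partial>lborel) \<le> ennreal (C0 * C) * ?FG"
    proof -
      \<comment> \<open>Substituting the second modulation for \<open>y\<close> interchanges the
        inputs, so that the second one takes the place of the first in
        \<open>schur_bound\<close>.\<close>
      have "S3 k x = (\<Sum>i\<in>?I k. \<integral>\<^sup>+y. ennreal (sqrt (w i) * jw x * jw (?z i x y)) * g (q i) y * f (p i) (?z i x y) \<partial>lborel)" for k x
        unfolding S3_def
      proof (intro sum.cong refl)
        fix i
        have "(\<integral>\<^sup>+y. ennreal (sqrt (w i) * jw x * jw (?z i x y)) * g (q i) y * f (p i) (?z i x y) \<partial>lborel)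
          = (\<integral>\<^sup>+y. (\<lambda>y. ennreal (sqrt (w i) * jw x * jw y) * ?fg i x y) (?z i x y) \<partial>lborel)"
          by (intro nn_integral_cong) (simp add: algebra_simps)
        also have "\<dots> = (\<integral>\<^sup>+y. ennreal (sqrt (w i) * jw x * jw y) * ?fg i x y \<partial>lborel)"
          by (rule nn_integral_reflect_shift) measurable
        finally show "(\<integral>\<^sup>+y. ennreal (sqrt (w i) * jw x * jw y) * ?fg i x y \<partial>lborel) =
          (\<integral>\<^sup>+y. ennreal (sqrt (w i) * jw x * jw (?z i x y)) * g (q i) y * f (p i) (?z i x y) \<partial>lborel)" by simp
      qed
      then show ?thesis
        using schur_bound[where f = g and g = f, OF finite_triads finK sub(2,1,3) injp w0 less_imp_le[OF C0] conv bC meas(2)[rule_format] meas(1)[rule_format]]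
        unfolding mass_def by (simp only: mult.assoc mult.commute mult.left_commute)
    qed
    have \<eta>nz: "\<eta> i \<noteq> 0" if "i \<in> triads N" for i
      using resonance_nonzero[OF N that] \<sigma> by (auto simp: \<eta>_def)
    have weq: "w i = 3 / (h\<^sup>2 * \<bar>\<eta> i\<bar>)" for i
      using \<sigma> by (auto simp: w_def res_weight_def \<eta>_def h_def abs_mult)
    have bilin_eq: "bilin N \<sigma> f g k x = (\<Sum>i\<in>?I k. \<integral>\<^sup>+y. ennreal (1 / h * jbr y powr (-(1/2)) * jbr (?z i x y) powr (-(1/2))) * ?fg i x y \<partial>lborel)" for k x
      unfolding bilin_def r_def p_def q_def \<eta>_def h_def ..
    \<comment> \<open>The coefficients are left free so that the same inequality serves both output
      weights, \<open>jbr x powr (-(1/2))\<close> and \<open>jbr x powr (-1)\<close>.\<close>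
    have S_gen: "ennreal c * bilin N \<sigma> f g k x \<le> ennreal c1 * S1 k x + ennreal c2 * S2 k x + ennreal c2 * S3 k x"
      if c: "0 \<le> c" "0 \<le> c1" "0 \<le> c2" and
        le: "\<And>i y. i \<in> triads N \<Longrightarrow> c * (1 / h * jbr y powr (-(1/2)) * jbr (?z i x y) powr (-(1/2)))
           \<le> c1 * (sqrt (w i) * jw y * jw (?z i x y)) + c2 * (sqrt (w i) * jw x * jw (?z i x y)) + c2 * (sqrt (w i) * jw x * jw y)"
      for c c1 c2 k x
    proof -
      have "ennreal c * bilin N \<sigma> f g k x = (\<Sum>i\<in>?I k. \<integral>\<^sup>+y. ennreal (c * (1 / h * jbr y powr (-(1/2)) * jbr (?z i x y) powr (-(1/2)))) * ?fg i x y \<partial>lborel)"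
        unfolding bilin_eq using c h by (simp add: sum_distrib_left nn_integral_cmult[symmetric] ennreal_mult[symmetric] mult.assoc[symmetric])
      also have "\<dots> \<le> (\<Sum>i\<in>?I k. \<integral>\<^sup>+y. ennreal (c1 * (sqrt (w i) * jw y * jw (?z i x y)) + c2 * (sqrt (w i) * jw x * jw (?z i x y)) + c2 * (sqrt (w i) * jw x * jw y)) * ?fg i x y \<partial>lborel)"
        by (intro sum_mono nn_integral_mono mult_right_mono ennreal_leI le) auto
      also have "\<dots> = (\<Sum>i\<in>?I k. \<integral>\<^sup>+y. ennreal c1 * (ennreal (sqrt (w i) * jw y * jw (?z i x y)) * ?fg i x y)
         + ennreal c2 * (ennreal (sqrt (w i) * jw x * jw (?z i x y)) * ?fg i x y) + ennreal c2 * (ennreal (sqrt (w i) * jw x * jw y) * ?fg i x y) \<partial>lborel)"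
        using c w0 by (intro sum.cong refl nn_integral_cong) (simp add: ennreal_plus ennreal_mult distrib_right mult.assoc)
      also have "\<dots> = ennreal c1 * S1 k x + ennreal c2 * S2 k x + ennreal c2 * S3 k x"
        unfolding S1_def S2_def S3_def by (simp add: nn_integral_add nn_integral_cmult sum.distrib sum_distrib_left)
      finally show ?thesis .
    qed
    have X: "ennreal (jbr x powr (-(1/2))) * bilin N \<sigma> f g k x \<le> S1 k x + S2 k x + S3 k x" for k x
      using S_gen[of "jbr x powr (-(1/2))" 1 1 x k] kernel_split(1)[OF h \<eta>nz weq refl, of _ x] by simp
    have Z: "ennreal (jbr x powr (-1)) * bilin N \<sigma> f g k x \<le> ennreal (jbr x powr (-(1/2))) * S1 k x
       + ennreal (jbr x powr (-(9/16))) * S2 k x + ennreal (jbr x powr (-(9/16))) * S3 k x" for k x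
      using kernel_split(2)[OF h \<eta>nz weq refl, of _ x] by (intro S_gen) auto
    have "(\<Sum>k\<in>K. \<integral>\<^sup>+x. (ennreal (jbr x powr (-(1/2))) * bilin N \<sigma> f g k x)\<^sup>2 \<partial>lborel)
      \<le> (\<Sum>k\<in>K. \<integral>\<^sup>+x. 3 * ((S1 k x)\<^sup>2 + (S2 k x)\<^sup>2 + (S3 k x)\<^sup>2) \<partial>lborel)"
      by (intro sum_mono nn_integral_mono order_trans[OF power_mono[OF X] ennreal_sum3_square_le]) simp
    also have "\<dots> = 3 * ((\<Sum>k\<in>K. \<integral>\<^sup>+x. (S1 k x)\<^sup>2 \<partial>lborel) + (\<Sum>k\<in>K. \<integral>\<^sup>+x. (S2 k x)\<^sup>2 \<partial>lborel) + (\<Sum>k\<in>K. \<integral>\<^sup>+x. (S3 k x)\<^sup>2 \<partial>lborel))"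
      by (simp add: nn_integral_cmult nn_integral_add sum.distrib sum_distrib_left)
    also have "\<dots> \<le> 3 * (ennreal (C0 * C) * ?FG + ennreal (C0 * C) * ?FG + ennreal (C0 * C) * ?FG)"
      by (intro mult_left_mono add_mono B1 B2 B3) simp
    also have "\<dots> = ennreal (3 * (C0 * C + C0 * C + C0 * C)) * ?FG"
      using C C0 by (intro ennreal_three_sum) auto
    also have "\<dots> \<le> ennreal D * ?FG"
      using C C0 C1 C2 by (intro mult_right_mono ennreal_leI) (auto simp: D_def)
    finally show "(\<Sum>k\<in>freqs N. \<integral>\<^sup>+x. (ennreal (jbr x powr (-(1/2))) * bilin N \<sigma> f g k x)\<^sup>2 \<partial>lborel)
        \<le> ennreal D * (mass (freqs N) f * mass (freqs N) g)" unfolding K_def .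
    have CS: "(\<integral>\<^sup>+x. ennreal (jbr x powr (-(9/16))) * S x \<partial>lborel)\<^sup>2 \<le> ennreal C2 * (\<integral>\<^sup>+x. (S x)\<^sup>2 \<partial>lborel)"
      if [measurable]: "S \<in> borel_measurable borel" for S
    proof -
      have "(\<integral>\<^sup>+x. ennreal (jbr x powr (-(9/16))) * S x \<partial>lborel)\<^sup>2 \<le> (\<integral>\<^sup>+x. (ennreal (jbr x powr (-(9/16))))\<^sup>2 \<partial>lborel) * (\<integral>\<^sup>+x. (S x)\<^sup>2 \<partial>lborel)"
        by (rule Cauchy_Schwarz_nn_integral) measurable
      also have "(\<lambda>x. (ennreal (jbr x powr (-(9/16))))\<^sup>2) = (\<lambda>x. ennreal (jbr x powr (-(9/8))))"
      proof
        fix x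
        have "(ennreal (jbr x powr (-(9/16))))\<^sup>2 = ennreal ((jbr x powr (-(9/16)))\<^sup>2)" by (rule ennreal_power) simp
        also have "(jbr x powr (-(9/16)))\<^sup>2 = jbr x powr (-(9/16) + -(9/16))"
          by (simp only: power2_eq_square powr_add)
        finally show "(ennreal (jbr x powr (-(9/16))))\<^sup>2 = ennreal (jbr x powr (-(9/8)))" by simp
      qed
      finally show ?thesis using C2(2) by (meson mult_right_mono order_trans zero_le)
    qed
    have "(\<Sum>k\<in>K. (\<integral>\<^sup>+x. ennreal (jbr x powr (-1)) * bilin N \<sigma> f g k x \<partial>lborel)\<^sup>2)
      \<le> (\<Sum>k\<in>K. 3 * ((\<integral>\<^sup>+x. ennreal (jbr x powr (-(1/2))) * S1 k x \<partial>lborel)\<^sup>2 +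
         ennreal C2 * (\<integral>\<^sup>+x. (S2 k x)\<^sup>2 \<partial>lborel) + ennreal C2 * (\<integral>\<^sup>+x. (S3 k x)\<^sup>2 \<partial>lborel)))"
    proof (rule sum_mono)
      fix k
      have "(\<integral>\<^sup>+x. ennreal (jbr x powr (-1)) * bilin N \<sigma> f g k x \<partial>lborel) \<le>
        (\<integral>\<^sup>+x. ennreal (jbr x powr (-(1/2))) * S1 k x + ennreal (jbr x powr (-(9/16))) * S2 k x + ennreal (jbr x powr (-(9/16))) * S3 k x \<partial>lborel)"
        by (intro nn_integral_mono Z)
      also have "\<dots> = (\<integral>\<^sup>+x. ennreal (jbr x powr (-(1/2))) * S1 k x \<partial>lborel) + (\<integral>\<^sup>+x. ennreal (jbr x powr (-(9/16))) * S2 k x \<partial>lborel)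
         + (\<integral>\<^sup>+x. ennreal (jbr x powr (-(9/16))) * S3 k x \<partial>lborel)"
        by (simp add: nn_integral_add)
      finally have "(\<integral>\<^sup>+x. ennreal (jbr x powr (-1)) * bilin N \<sigma> f g k x \<partial>lborel)\<^sup>2 \<le>
        3 * ((\<integral>\<^sup>+x. ennreal (jbr x powr (-(1/2))) * S1 k x \<partial>lborel)\<^sup>2 + (\<integral>\<^sup>+x. ennreal (jbr x powr (-(9/16))) * S2 k x \<partial>lborel)\<^sup>2
         + (\<integral>\<^sup>+x. ennreal (jbr x powr (-(9/16))) * S3 k x \<partial>lborel)\<^sup>2)"
        by (rule order_trans[OF power_mono ennreal_sum3_square_le]) simp
      also have "\<dots> \<le> 3 * ((\<integral>\<^sup>+x. ennreal (jbr x powr (-(1/2))) * S1 k x \<partial>lborel)\<^sup>2 +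
         ennreal C2 * (\<integral>\<^sup>+x. (S2 k x)\<^sup>2 \<partial>lborel) + ennreal C2 * (\<integral>\<^sup>+x. (S3 k x)\<^sup>2 \<partial>lborel))"
        by (intro mult_left_mono add_mono CS order_refl) auto
      finally show "(\<integral>\<^sup>+x. ennreal (jbr x powr (-1)) * bilin N \<sigma> f g k x \<partial>lborel)\<^sup>2 \<le> \<dots>" .
    qed
    also have "\<dots> = 3 * ((\<Sum>k\<in>K. (\<integral>\<^sup>+x. ennreal (jbr x powr (-(1/2))) * S1 k x \<partial>lborel)\<^sup>2) +
         ennreal C2 * (\<Sum>k\<in>K. \<integral>\<^sup>+x. (S2 k x)\<^sup>2 \<partial>lborel) + ennreal C2 * (\<Sum>k\<in>K. \<integral>\<^sup>+x. (S3 k x)\<^sup>2 \<partial>lborel))"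
      by (simp only: sum.distrib[symmetric] sum_distrib_left)
    also have "\<dots> \<le> 3 * (ennreal (C0 * C1 * C) * ?FG + ennreal C2 * (ennreal (C0 * C) * ?FG) + ennreal C2 * (ennreal (C0 * C) * ?FG))"
      by (intro mult_left_mono add_mono B1' B2 B3) simp_all
    also have "\<dots> = 3 * (ennreal (C0 * C1 * C) * ?FG + ennreal (C2 * (C0 * C)) * ?FG + ennreal (C2 * (C0 * C)) * ?FG)"
      using C2(1) by (simp only: ennreal_mult' less_imp_le mult.assoc)
    also have "\<dots> = ennreal (3 * (C0 * C1 * C + C2 * (C0 * C) + C2 * (C0 * C))) * ?FG"
      using C C0 C1 C2(1) by (intro ennreal_three_sum) auto
    also have "\<dots> \<le> ennreal D * ?FG"
      using C C0 C1 C2 by (intro mult_right_mono ennreal_leI) (auto simp: D_def)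
    finally show "(\<Sum>k\<in>freqs N. (\<integral>\<^sup>+x. ennreal (jbr x powr (-1)) * bilin N \<sigma> f g k x \<partial>lborel)\<^sup>2)
        \<le> ennreal D * (mass (freqs N) f * mass (freqs N) g)" unfolding K_def .
  qed
qed

section \<open>The Fourier transform of Schwartz functions\<close>

definition ft :: "(real \<Rightarrow> complex) \<Rightarrow> real \<Rightarrow> complex"
  where "ft f \<tau> = (\<integral>t. exp (- (\<i> * of_real t * of_real \<tau>)) * f t \<partial>lborel)"

lemma jbr_powr_minus2: "jbr t powr (-2) = 1 / (1 + t\<^sup>2)"
proof -
  have "jbr t powr (-2) = inverse (jbr t powr 2)" by (simp add: powr_minus)
  also have "jbr t powr 2 = (jbr t)\<^sup>2" using jbr_pos[of t] by (simp add: powr_realpow[of _ 2, simplified])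
  finally show ?thesis by (simp add: jbr_sqrt inverse_eq_divide)
qed

lemma integrable_jbr_powr: "p > 1 \<Longrightarrow> integrable lborel (\<lambda>t. jbr t powr (-p))"
  using jbr_powr_integral[of p]
  by (intro integrableI_bounded) (auto intro: le_less_trans)

lemma integrable_by_jbr:
  fixes f :: "real \<Rightarrow> complex"
  assumes "f \<in> borel_measurable borel" "\<And>t. norm (f t) \<le> C * jbr t powr (-2)"
  shows "integrable lborel f"
  by (rule Bochner_Integration.integrable_bound[of _ "\<lambda>t. C * jbr t powr (-2)"])
     (use assms integrable_jbr_powr[of 2] in \<open>auto intro: order_trans[OF _ abs_ge_self]\<close>)

lemma norm_exp_imaginary[simp]:
  "norm (exp (- (\<i> * complex_of_real a * complex_of_real b))) = 1"
  "norm (exp (\<i> * complex_of_real a * complex_of_real b)) = 1"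
  using norm_exp_i_times[of "a * b"] norm_exp_i_times[of "- (a * b)"] by (simp_all add: mult.assoc)

lemma integrable_modulated:
  assumes "integrable lborel f"
  shows "integrable lborel (\<lambda>t. exp (- (\<i> * complex_of_real t * complex_of_real \<tau>)) * f t)"
  by (rule Bochner_Integration.integrable_bound[OF assms]) (use assms in \<open>auto simp: norm_mult\<close>)

lemma norm_ft_le:
  "norm (ft f \<tau>) \<le> (\<integral>t. norm (f t) \<partial>lborel)"
  unfolding ft_def using integral_norm_bound[of lborel "\<lambda>t. exp (- (\<i> * complex_of_real t * complex_of_real \<tau>)) * f t"]
  by (simp add: norm_mult)

lemma ft_measurable[measurable]:
  assumes [measurable]: "f \<in> borel_measurable borel"
  shows "ft f \<in> borel_measurable borel"
  unfolding ft_def[abs_def] by measurable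

text \<open>The whole tower of derivatives is made explicit, since integrating by parts with
  \<open>D j\<close> requires the decay of \<open>D (Suc j)\<close> as well.\<close>

definition schwartz_seq :: "(nat \<Rightarrow> real \<Rightarrow> complex) \<Rightarrow> bool"
  where "schwartz_seq D \<longleftrightarrow> (\<forall>j t. (D j has_vector_derivative D (Suc j) t) (at t)) \<and>
    (\<forall>j m. bounded (range (\<lambda>t. t ^ m *\<^sub>R D j t)))"

lemma schwartz_iff: "schwartz f \<longleftrightarrow> (\<exists>D. D 0 = f \<and> schwartz_seq D)"
  unfolding schwartz_def schwartz_seq_def by blast

lemma schwartz_seq_cont: "schwartz_seq D \<Longrightarrow> isCont (D j) t"
  unfolding schwartz_seq_def using has_vector_derivative_continuous by blast

lemma schwartz_seq_measurable: "schwartz_seq D \<Longrightarrow> D j \<in> borel_measurable borel"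
  by (intro borel_measurable_continuous_onI continuous_at_imp_continuous_on) (auto intro: schwartz_seq_cont)

lemma schwartz_seq_decay:
  assumes "schwartz_seq D"
  obtains C where "C > 0" "\<And>t. norm (D j t) \<le> C * jbr t powr (-2)"
proof -
  have b: "\<exists>B. \<forall>t. norm (t ^ m *\<^sub>R D j t) \<le> B" for m
    using assms unfolding schwartz_seq_def bounded_iff by auto
  from b[of 0] obtain B0 where B0: "\<And>t. norm (D j t) \<le> B0" by auto
  from b[of 2] obtain B2 where B2: "\<And>t. t\<^sup>2 * norm (D j t) \<le> B2" by auto
  have "norm (D j t) \<le> (\<bar>B0\<bar> + \<bar>B2\<bar> + 1) * jbr t powr (-2)" for t
  proof -
    have "(1 + t\<^sup>2) * norm (D j t) \<le> \<bar>B0\<bar> + \<bar>B2\<bar> + 1"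
      using B0[of t] B2[of t] by (simp add: distrib_right)
    moreover have "1 + t\<^sup>2 > 0" by (simp add: add_pos_nonneg)
    ultimately show ?thesis unfolding jbr_powr_minus2 by (simp add: field_simps)
  qed
  then show ?thesis by (intro that[of "\<bar>B0\<bar> + \<bar>B2\<bar> + 1"]) auto
qed

lemma schwartz_seq_integrable: "schwartz_seq D \<Longrightarrow> integrable lborel (D j)"
  using schwartz_seq_decay[of D j] schwartz_seq_measurable[of D j] by (metis integrable_by_jbr)

lemma schwartz_add:
  assumes "schwartz f" "schwartz g"
  shows "schwartz (\<lambda>t. f t + g t)"
proof -
  from assms obtain D E where D: "D 0 = f" "schwartz_seq D" and E: "E 0 = g" "schwartz_seq E"
    unfolding schwartz_iff by blast
  have "bounded (range (\<lambda>t. t ^ m *\<^sub>R (D j t + E j t)))" for j m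
    using bounded_plus_comp[of "\<lambda>t. t ^ m *\<^sub>R D j t" UNIV "\<lambda>t. t ^ m *\<^sub>R E j t"] D(2) E(2)
    unfolding schwartz_seq_def by (simp add: scaleR_add_right)
  then have "schwartz_seq (\<lambda>j t. D j t + E j t)"
    using D(2) E(2) unfolding schwartz_seq_def by (auto intro!: derivative_intros)
  then show ?thesis unfolding schwartz_iff using D(1) E(1) by (intro exI[of _ "\<lambda>j t. D j t + E j t"]) auto
qed

lemma schwartz_cmult:
  assumes "schwartz f"
  shows "schwartz (\<lambda>t. c * f t)"
proof -
  from assms obtain D where D: "D 0 = f" "schwartz_seq D"
    unfolding schwartz_iff by blast
  have "bounded (range (\<lambda>t. t ^ m *\<^sub>R (c * D j t)))" for j m
  proof -
    have "bounded (range (\<lambda>t. t ^ m *\<^sub>R D j t))" using D(2) unfolding schwartz_seq_def by blast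
    then obtain B where "\<And>t. norm (t ^ m *\<^sub>R D j t) \<le> B" unfolding bounded_iff by blast
    then have "norm (t ^ m *\<^sub>R (c * D j t)) \<le> norm c * B" for t
      using mult_left_mono[of "norm (t ^ m *\<^sub>R D j t)" B "norm c"] by (simp add: norm_mult mult_ac)
    then show ?thesis unfolding bounded_iff by blast
  qed
  then have "schwartz_seq (\<lambda>j t. c * D j t)"
    using D(2) unfolding schwartz_seq_def by (auto intro!: derivative_intros)
  then show ?thesis unfolding schwartz_iff using D(1) by (intro exI[of _ "\<lambda>j t. c * D j t"]) auto
qed

lemma schwartz_zero: "schwartz (\<lambda>t. 0)"
  unfolding schwartz_iff schwartz_seq_def
  by (intro exI[of _ "\<lambda>j t. 0"]) (auto intro!: derivative_eq_intros)

lemma schwartz_sum: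
  assumes "\<And>x. x \<in> A \<Longrightarrow> schwartz (f x)"
  shows "schwartz (\<lambda>t. \<Sum>x\<in>A. f x t)"
  using assms by (induction A rule: infinite_finite_induct) (auto intro: schwartz_zero schwartz_add)

lemma schwartz_diff: "schwartz f \<Longrightarrow> schwartz g \<Longrightarrow> schwartz (\<lambda>t. f t - g t)"
  using schwartz_add[of f "\<lambda>t. (-1) * g t"] schwartz_cmult[of g "-1"] by simp

lemma integral_derivative_zero:
  fixes F F' :: "real \<Rightarrow> complex"
  assumes F: "\<And>t. (F has_vector_derivative F' t) (at t)" and c: "\<And>t. isCont F' t"
    and i: "integrable lborel F'" and l: "(F \<longlongrightarrow> 0) at_top" "(F \<longlongrightarrow> 0) at_bot"
  shows "(\<integral>t. F' t \<partial>lborel) = 0"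
proof -
  have u: "einterval (-\<infinity>) \<infinity> = UNIV" by (auto simp: einterval_def)
  have "(LBINT x=-\<infinity>..\<infinity>. F' x) = 0 - 0"
    by (rule interval_integral_FTC_integrable[where F = F])
       (use assms in \<open>auto simp: u set_integrable_def ereal_tendsto_simps\<close>)
  then show ?thesis by (simp add: interval_lebesgue_integral_def u set_lebesgue_integral_def)
qed

text \<open>\<open>?F'\<close> is the derivative of the modulated function \<open>?F\<close>, which
  vanishes at both infinities, so its integral is zero; splitting that integral gives the
  claim.\<close>

lemma ft_derivative:
  assumes D: "schwartz_seq D"
  shows "ft (D (Suc j)) \<tau> = \<i> * of_real \<tau> * ft (D j) \<tau>"
proof -
  let ?e = "\<lambda>t. exp (- (\<i> * complex_of_real t * complex_of_real \<tau>))"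
  let ?F = "\<lambda>t. ?e t * D j t"
  let ?F' = "\<lambda>t. ?e t * D (Suc j) t - \<i> * of_real \<tau> * (?e t * D j t)"
  have e: "(?e has_vector_derivative - \<i> * of_real \<tau> * ?e t) (at t)" for t
    by (auto intro!: derivative_eq_intros has_vector_derivative_real_field)
  have int: "integrable lborel (\<lambda>t. ?e t * D k t)" for k
    by (intro integrable_modulated schwartz_seq_integrable D)
  have lim: "(?F \<longlongrightarrow> 0) at_top \<and> (?F \<longlongrightarrow> 0) at_bot"
  proof -
    obtain C where C: "\<And>t. norm (D j t) \<le> C * jbr t powr (-2)" using schwartz_seq_decay[OF D] by metis
    have b: "norm (?F t) \<le> C * (1 / (1 + t\<^sup>2))" for t
      using C[of t] by (simp add: norm_mult jbr_powr_minus2)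
    have "((\<lambda>t. C * (1 / (1 + t\<^sup>2))) \<longlongrightarrow> 0) at_top" "((\<lambda>t. C * (1 / (1 + t\<^sup>2))) \<longlongrightarrow> 0) at_bot"
      by real_asymp+
    then show ?thesis by (intro conjI Lim_null_comparison[OF always_eventually[OF allI[OF b]]])
  qed
  have "(\<integral>t. ?F' t \<partial>lborel) = 0"
  proof (rule integral_derivative_zero[where F = ?F])
    show "(?F has_vector_derivative ?F' t) (at t)" for t
    proof -
      have d: "(D j has_vector_derivative D (Suc j) t) (at t)" using D unfolding schwartz_seq_def by blast
      show ?thesis using has_vector_derivative_mult[OF e[of t] d] by (simp add: algebra_simps)
    qed
    show "isCont ?F' t" for t
      by (intro continuous_intros schwartz_seq_cont[OF D])
    show "integrable lborel ?F'" by (intro Bochner_Integration.integrable_diff integrable_mult_right int)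
  qed (use lim in auto)
  then show ?thesis unfolding ft_def using int by simp
qed

text \<open>Two derivatives produce the factor \<open>\<tau>\<^sup>2\<close>, and the L1 norms of
  \<open>f\<close> and of its second derivative bound the result. The exponent \<open>-2\<close>
  makes the transform integrable, as inversion and Fubini require.\<close>

lemma ft_schwartz_decay:
  assumes "schwartz f"
  obtains C where "C > 0" "\<And>\<tau>. norm (ft f \<tau>) \<le> C * jbr \<tau> powr (-2)"
proof -
  from assms obtain D where D: "D 0 = f" "schwartz_seq D" unfolding schwartz_iff by blast
  have "ft (D 2) \<tau> = - (of_real (\<tau>\<^sup>2) * ft f \<tau>)" for \<tau>
  proof -
    have "ft (D 2) \<tau> = \<i> * of_real \<tau> * (\<i> * of_real \<tau> * ft f \<tau>)"
      using ft_derivative[OF D(2), of 0 \<tau>] ft_derivative[OF D(2), of 1 \<tau>] D(1) by (simp add: numeral_2_eq_2)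
    also have "\<dots> = (\<i> * \<i>) * (of_real \<tau> * of_real \<tau> * ft f \<tau>)" by (simp only: mult_ac)
    finally show ?thesis by (simp add: power2_eq_square)
  qed
  then have "\<tau>\<^sup>2 * norm (ft f \<tau>) = norm (ft (D 2) \<tau>)" for \<tau> by (simp add: norm_mult norm_power)
  then have b2: "\<tau>\<^sup>2 * norm (ft f \<tau>) \<le> (\<integral>t. norm (D 2 t) \<partial>lborel)" for \<tau> using norm_ft_le[of "D 2"] by simp
  define C where "C = (\<integral>t. norm (f t) \<partial>lborel) + (\<integral>t. norm (D 2 t) \<partial>lborel) + 1"
  have "norm (ft f \<tau>) \<le> C * jbr \<tau> powr (-2)" for \<tau>
  proof -
    have "(1 + \<tau>\<^sup>2) * norm (ft f \<tau>) \<le> C"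
      using norm_ft_le[of f \<tau>] b2[of \<tau>] by (simp add: distrib_right C_def)
    moreover have "1 + \<tau>\<^sup>2 > 0" by (simp add: add_pos_nonneg)
    ultimately show ?thesis unfolding jbr_powr_minus2 by (simp add: field_simps)
  qed
  moreover have "C > 0" unfolding C_def by (simp add: add_nonneg_pos)
  ultimately show ?thesis using that by blast
qed

lemma schwartz_measurable: "schwartz f \<Longrightarrow> f \<in> borel_measurable borel"
  unfolding schwartz_iff using schwartz_seq_measurable by blast

lemma schwartz_integrable: "schwartz f \<Longrightarrow> integrable lborel f"
  unfolding schwartz_iff using schwartz_seq_integrable by blast

lemma schwartz_isCont: "schwartz f \<Longrightarrow> isCont f t"
  unfolding schwartz_iff using schwartz_seq_cont by blast

lemma schwartz_decay: "schwartz f \<Longrightarrow> \<exists>C>0. \<forall>t. norm (f t) \<le> C * jbr t powr (-2)"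
  unfolding schwartz_iff using schwartz_seq_decay by metis

lemma ft_schwartz_integrable: "schwartz f \<Longrightarrow> integrable lborel (ft f)"
  using ft_schwartz_decay[of f] schwartz_measurable[of f] by (metis ft_measurable integrable_by_jbr)

section \<open>Fourier inversion and products\<close>

text \<open>A rescaling of the characteristic function of the standard normal law. As
  \<open>e\<close> tends to \<open>0\<close>, the right-hand side concentrates at
  \<open>y = 0\<close> and acts as an approximate identity.\<close>

lemma gaussian_fourier:
  fixes e y :: real
  assumes e: "e > 0"
  shows "(\<integral>s. exp (\<i> * of_real s * of_real y) * of_real (std_normal_density (e * s)) \<partial>lborel)
    = of_real (sqrt (2 * pi) / e * std_normal_density (y / e))"
proof -
  define G where "G v = exp (\<i> * of_real v * of_real (y / e)) * complex_of_real (std_normal_density v)" for v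
  have c: "(\<integral>v. G v \<partial>lborel) = of_real (exp (- ((y / e)\<^sup>2) / 2))"
  proof -
    have "char std_normal_distribution (y / e) = (\<integral>v. std_normal_density v *\<^sub>R iexp ((y / e) * v) \<partial>lborel)"
      unfolding char_def by (subst integral_density) (auto simp: normal_density_nonneg)
    also have "\<dots> = (\<integral>v. G v \<partial>lborel)"
      by (intro Bochner_Integration.integral_cong refl) (simp add: G_def scaleR_conv_of_real mult_ac)
    finally show ?thesis by (simp add: char_std_normal_distribution)
  qed
  have "(\<integral>v. G v \<partial>lborel) = \<bar>e\<bar> *\<^sub>R (\<integral>s. G (0 + e * s) \<partial>lborel)"
    using e by (intro lborel_integral_real_affine) auto
  also have "(\<lambda>s. G (0 + e * s)) = (\<lambda>s. exp (\<i> * of_real s * of_real y) * of_real (std_normal_density (e * s)))"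
    using e by (auto simp: G_def fun_eq_iff mult.assoc)
  finally have "(\<integral>s. exp (\<i> * of_real s * of_real y) * of_real (std_normal_density (e * s)) \<partial>lborel) =
      (1 / e) *\<^sub>R complex_of_real (exp (- ((y / e)\<^sup>2) / 2))"
    using e c by simp
  also have "\<dots> = of_real (sqrt (2 * pi) / e * std_normal_density (y / e))"
    by (simp add: std_normal_density_def scaleR_conv_of_real)
  finally show ?thesis .
qed

lemma std_normal_density_bounds:
  "0 \<le> std_normal_density x" "std_normal_density x \<le> 1 / sqrt (2 * pi)"
  by (simp_all add: std_normal_density_def divide_right_mono)

lemma std_normal_density_measurable[measurable]: "std_normal_density \<in> borel_measurable borel"
  by simp

lemma std_normal_density_scaled_integrable:
  assumes "e > (0::real)"
  shows "integrable lborel (\<lambda>s. std_normal_density (e * s))"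
proof -
  have "integrable lborel std_normal_density" using integrable_std_normal_moment[of 0] by simp
  from lborel_integrable_real_affine[OF this, of e 0] assms show ?thesis by simp
qed

text \<open>The Gaussian factor makes the double integral absolutely convergent for every integrable
  \<open>f\<close>. Exchanging the integrals turns the damped inverse transform into an average of
  \<open>f\<close> around \<open>t0\<close> at scale \<open>e\<close>.\<close>

lemma fourier_gaussian_smoothing:
  fixes f :: "real \<Rightarrow> complex"
  assumes f: "integrable lborel f" and e: "e > 0"
  shows "(\<integral>s. ft f s * exp (\<i> * of_real s * of_real t0) * of_real (std_normal_density (e * s)) \<partial>lborel)
    = of_real (sqrt (2 * pi)) * (\<integral>y. f (t0 + e * y) * of_real (std_normal_density y) \<partial>lborel)"
proof -
  have [measurable]: "f \<in> borel_measurable borel" using f by auto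
  let ?h = "\<lambda>s t. exp (\<i> * of_real s * of_real (t0 - t)) * (f t * complex_of_real (std_normal_density (e * s)))"
  have n: "norm (exp (\<i> * of_real s * (of_real a - of_real b))) = 1" for s a b
    using norm_exp_imaginary(2)[of s "a - b"] by simp
  have int: "integrable (lborel \<Otimes>\<^sub>M lborel) (\<lambda>(s, t). ?h s t)"
  proof (rule Bochner_Integration.integrable_bound)
    show "integrable (lborel \<Otimes>\<^sub>M lborel) (\<lambda>(s, t). std_normal_density (e * s) * norm (f t))"
      by (intro lborel_pair.Fubini_integrable)
         (use f std_normal_density_scaled_integrable[OF e] std_normal_density_bounds in \<open>auto simp: abs_mult\<close>)
  qed (auto simp: norm_mult n std_normal_density_bounds)
  have "(\<integral>s. ft f s * exp (\<i> * of_real s * of_real t0) * of_real (std_normal_density (e * s)) \<partial>lborel)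
    = (\<integral>s. \<integral>t. ?h s t \<partial>lborel \<partial>lborel)"
  proof (intro Bochner_Integration.integral_cong refl)
    fix s
    have "ft f s * exp (\<i> * of_real s * of_real t0) * of_real (std_normal_density (e * s))
       = (\<integral>t. exp (- (\<i> * of_real t * of_real s)) * f t * (exp (\<i> * of_real s * of_real t0) * of_real (std_normal_density (e * s))) \<partial>lborel)"
      unfolding ft_def mult.assoc[of "integral\<^sup>L _ _"] by (rule integral_mult_left_zero[symmetric])
    also have "\<dots> = (\<integral>t. ?h s t \<partial>lborel)"
    proof (intro Bochner_Integration.integral_cong refl)
      fix t
      have "exp (\<i> * of_real s * complex_of_real (t0 - t)) = exp (- (\<i> * of_real t * of_real s)) * exp (\<i> * of_real s * of_real t0)"
        by (simp add: exp_add[symmetric] algebra_simps)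
      then show "exp (- (\<i> * of_real t * of_real s)) * f t * (exp (\<i> * of_real s * of_real t0) * of_real (std_normal_density (e * s))) = ?h s t"
        by (simp add: mult_ac)
    qed
    finally show "ft f s * exp (\<i> * of_real s * of_real t0) * of_real (std_normal_density (e * s)) = (\<integral>t. ?h s t \<partial>lborel)" .
  qed
  also have "\<dots> = (\<integral>t. \<integral>s. ?h s t \<partial>lborel \<partial>lborel)"
    by (rule lborel_pair.Fubini_integral[symmetric]) (rule int)
  also have "\<dots> = (\<integral>t. f t * of_real (sqrt (2 * pi) / e * std_normal_density ((t0 - t) / e)) \<partial>lborel)"
  proof (intro Bochner_Integration.integral_cong refl)
    fix t
    have "(\<integral>s. ?h s t \<partial>lborel) = (\<integral>s. f t * (exp (\<i> * of_real s * of_real (t0 - t)) * of_real (std_normal_density (e * s))) \<partial>lborel)"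
      by (intro Bochner_Integration.integral_cong refl) (simp add: mult_ac)
    also have "\<dots> = f t * (\<integral>s. exp (\<i> * of_real s * of_real (t0 - t)) * of_real (std_normal_density (e * s)) \<partial>lborel)"
      by (rule integral_mult_right_zero)
    finally show "(\<integral>s. ?h s t \<partial>lborel) = f t * of_real (sqrt (2 * pi) / e * std_normal_density ((t0 - t) / e))"
      by (simp only: gaussian_fourier[OF e])
  qed
  also have "\<dots> = \<bar>e\<bar> *\<^sub>R (\<integral>y. f (t0 + e * y) * of_real (sqrt (2 * pi) / e * std_normal_density ((t0 - (t0 + e * y)) / e)) \<partial>lborel)"
    using e by (intro lborel_integral_real_affine) auto
  also have "\<dots> = \<bar>e\<bar> *\<^sub>R (\<integral>y. of_real (sqrt (2 * pi) / e) * (f (t0 + e * y) * of_real (std_normal_density y)) \<partial>lborel)"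
    using e by (intro arg_cong[where f = "\<lambda>z. \<bar>e\<bar> *\<^sub>R z"] Bochner_Integration.integral_cong refl)
      (simp add: std_normal_density_def)
  also have "\<dots> = of_real (sqrt (2 * pi)) * (\<integral>y. f (t0 + e * y) * of_real (std_normal_density y) \<partial>lborel)"
    using e by (simp only: integral_mult_right_zero) (simp add: scaleR_conv_of_real)
  finally show ?thesis .
qed

text \<open>Both sides of the smoothed identity converge as the scale tends to \<open>0\<close>: on
  the left the damping tends to \<open>std_normal_density 0 = 1 / sqrt (2 * pi)\<close>, on the
  right the average tends to \<open>f t\<close>. The two factors \<open>sqrt (2 * pi)\<close>
  combine to \<open>2 * pi\<close>.\<close>

theorem fourier_inversion:
  fixes f :: "real \<Rightarrow> complex"
  assumes f: "schwartz f"
  shows "(\<integral>s. ft f s * exp (\<i> * of_real s * of_real t) \<partial>lborel) = of_real (2 * pi) * f t"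
proof -
  define e where "e n = 1 / real (Suc n)" for n
  have e: "e n > 0" for n by (simp add: e_def)
  have e0: "e \<longlonglongrightarrow> 0" unfolding e_def using LIMSEQ_inverse_real_of_nat by (simp add: inverse_eq_divide)
  have [measurable]: "f \<in> borel_measurable borel" by (rule schwartz_measurable[OF f])
  have sq: "sqrt (2 * pi) > 0" by simp
  have cont: "isCont std_normal_density 0"
    unfolding std_normal_density_def[abs_def] by (intro continuous_intros) auto
  have L: "(\<lambda>n. \<integral>s. ft f s * exp (\<i> * of_real s * of_real t) * of_real (std_normal_density (e n * s)) \<partial>lborel)
     \<longlonglongrightarrow> (\<integral>s. ft f s * exp (\<i> * of_real s * of_real t) * of_real (1 / sqrt (2 * pi)) \<partial>lborel)"
  proof (rule integral_dominated_convergence)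
    show "integrable lborel (\<lambda>s. norm (ft f s) * (1 / sqrt (2 * pi)))"
      using ft_schwartz_integrable[OF f] by auto
    show "AE s in lborel. (\<lambda>n. ft f s * exp (\<i> * of_real s * of_real t) * of_real (std_normal_density (e n * s)))
       \<longlonglongrightarrow> ft f s * exp (\<i> * of_real s * of_real t) * of_real (1 / sqrt (2 * pi))"
    proof (intro AE_I2)
      fix s
      have "(\<lambda>n. e n * s) \<longlonglongrightarrow> 0 * s" by (intro tendsto_intros e0)
      then have "(\<lambda>n. std_normal_density (e n * s)) \<longlonglongrightarrow> std_normal_density 0"
        using isCont_tendsto_compose[OF cont] by simp
      then have "(\<lambda>n. std_normal_density (e n * s)) \<longlonglongrightarrow> 1 / sqrt (2 * pi)" by (simp add: std_normal_density_def)
      then show "(\<lambda>n. ft f s * exp (\<i> * of_real s * of_real t) * of_real (std_normal_density (e n * s)))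
       \<longlonglongrightarrow> ft f s * exp (\<i> * of_real s * of_real t) * of_real (1 / sqrt (2 * pi))"
        by (intro tendsto_intros)
    qed
    show "AE s in lborel. norm (ft f s * exp (\<i> * of_real s * of_real t) * of_real (std_normal_density (e n * s)))
       \<le> norm (ft f s) * (1 / sqrt (2 * pi))" for n
    proof (intro AE_I2)
      fix s
      have "norm (ft f s) * std_normal_density (e n * s) \<le> norm (ft f s) * (1 / sqrt (2 * pi))"
        by (intro mult_left_mono std_normal_density_bounds) simp
      then show "norm (ft f s * exp (\<i> * of_real s * of_real t) * of_real (std_normal_density (e n * s)))
         \<le> norm (ft f s) * (1 / sqrt (2 * pi))"
        using std_normal_density_bounds(1) by (simp add: norm_mult)
    qed
  qed measurable
  obtain C where C: "C > 0" "\<And>t. norm (f t) \<le> C * jbr t powr (-2)" using schwartz_decay[OF f] by auto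
  have fb: "norm (f t) \<le> C" for t
  proof -
    have "C * jbr t powr (-2) \<le> C * 1" using C(1) powr_mono2'[of "-2" 1 "jbr t"] jbr_ge_1[of t] by (intro mult_left_mono) auto
    then show ?thesis using C(2)[of t] by simp
  qed
  have intn: "integrable lborel std_normal_density" using integrable_std_normal_moment[of 0] by simp
  have R: "(\<lambda>n. \<integral>y. f (t + e n * y) * of_real (std_normal_density y) \<partial>lborel)
    \<longlonglongrightarrow> (\<integral>y. f t * of_real (std_normal_density y) \<partial>lborel)"
  proof (rule integral_dominated_convergence)
    show "integrable lborel (\<lambda>y. C * std_normal_density y)" using intn by auto
    show "AE y in lborel. (\<lambda>n. f (t + e n * y) * of_real (std_normal_density y)) \<longlonglongrightarrow> f t * of_real (std_normal_density y)"
    proof (intro AE_I2)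
      fix y
      have "(\<lambda>n. t + e n * y) \<longlonglongrightarrow> t + 0 * y" by (intro tendsto_intros e0)
      then have "(\<lambda>n. f (t + e n * y)) \<longlonglongrightarrow> f t"
        using isCont_tendsto_compose[OF schwartz_isCont[OF f, of t]] by simp
      then show "(\<lambda>n. f (t + e n * y) * of_real (std_normal_density y)) \<longlonglongrightarrow> f t * of_real (std_normal_density y)"
        by (intro tendsto_intros)
    qed
    show "AE y in lborel. norm (f (t + e n * y) * of_real (std_normal_density y)) \<le> C * std_normal_density y" for n
      using fb std_normal_density_bounds by (intro AE_I2) (auto simp: norm_mult intro!: mult_right_mono)
  qed measurable
  have "(\<integral>y. f t * complex_of_real (std_normal_density y) \<partial>lborel) = f t"
  proof -
    have "(\<integral>y. std_normal_density y \<partial>lborel) = 1" using integral_std_normal_moment_even[of 0] by simp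
    then show ?thesis using intn by simp
  qed
  with R have "(\<lambda>n. of_real (sqrt (2 * pi)) * (\<integral>y. f (t + e n * y) * of_real (std_normal_density y) \<partial>lborel)) \<longlonglongrightarrow> of_real (sqrt (2 * pi)) * f t"
    by (intro tendsto_intros) simp
  then have R': "(\<lambda>n. \<integral>s. ft f s * exp (\<i> * of_real s * of_real t) * of_real (std_normal_density (e n * s)) \<partial>lborel)
     \<longlonglongrightarrow> of_real (sqrt (2 * pi)) * f t"
    by (simp only: fourier_gaussian_smoothing[OF schwartz_integrable[OF f] e])
  have "(\<integral>s. ft f s * exp (\<i> * of_real s * of_real t) * of_real (1 / sqrt (2 * pi)) \<partial>lborel) = of_real (sqrt (2 * pi)) * f t"
    by (rule LIMSEQ_unique[OF L R'])
  then have "(\<integral>s. ft f s * exp (\<i> * of_real s * of_real t) \<partial>lborel) * of_real (1 / sqrt (2 * pi)) = of_real (sqrt (2 * pi)) * f t"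
    by (simp only: integral_mult_left_zero)
  then have "of_real (sqrt (2 * pi)) * ((\<integral>s. ft f s * exp (\<i> * of_real s * of_real t) \<partial>lborel) * of_real (1 / sqrt (2 * pi)))
      = complex_of_real (sqrt (2 * pi)) * (of_real (sqrt (2 * pi)) * f t)" by simp
  moreover have "complex_of_real (sqrt (2 * pi)) * of_real (sqrt (2 * pi)) = of_real (2 * pi)"
    unfolding of_real_mult[symmetric] by simp
  ultimately show ?thesis using sq by (simp add: mult.assoc[symmetric])
qed

text \<open>Inserting inversion for \<open>f\<close> and exchanging the integrals shows that
  \<open>2 * pi\<close> times the transform of the product is a convolution. For an upper bound,
  \<open>1 / (2 * pi)\<close> is estimated by \<open>1\<close> and absolute values are
  taken.\<close>

lemma ft_product_bound:
  assumes f: "schwartz f" and g: "schwartz g"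
  shows "ennreal (norm (ft (\<lambda>t. f t * g t) \<tau>)) \<le> (\<integral>\<^sup>+s. ennreal (norm (ft f s)) * ennreal (norm (ft g (\<tau> - s))) \<partial>lborel)"
proof -
  have [measurable]: "f \<in> borel_measurable borel" "g \<in> borel_measurable borel"
    using f g schwartz_measurable by auto
  let ?h = "\<lambda>t s. exp (- (\<i> * of_real t * of_real (\<tau> - s))) * (ft f s * g t)"
  have int: "integrable (lborel \<Otimes>\<^sub>M lborel) (\<lambda>(t, s). ?h t s)"
  proof (rule Bochner_Integration.integrable_bound)
    show "integrable (lborel \<Otimes>\<^sub>M lborel) (\<lambda>(t, s). norm (g t) * norm (ft f s))"
      by (intro lborel_pair.Fubini_integrable)
         (use schwartz_integrable[OF g] ft_schwartz_integrable[OF f] in \<open>auto simp: abs_mult\<close>)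
    have "norm (exp (- (\<i> * of_real t * (of_real \<tau> - of_real s)))) = 1" for t s
      using norm_exp_imaginary(1)[of t "\<tau> - s"] by simp
    then show "AE x in lborel \<Otimes>\<^sub>M lborel. norm (case x of (t, s) \<Rightarrow> ?h t s) \<le> norm (case x of (t, s) \<Rightarrow> norm (g t) * norm (ft f s))"
      by (intro AE_I2) (auto simp: norm_mult)
  qed measurable
  have "of_real (2 * pi) * ft (\<lambda>t. f t * g t) \<tau> = (\<integral>t. exp (- (\<i> * of_real t * of_real \<tau>)) * ((of_real (2 * pi) * f t) * g t) \<partial>lborel)"
    unfolding ft_def by (subst integral_mult_right_zero[symmetric]) (simp add: mult_ac)
  also have "\<dots> = (\<integral>t. \<integral>s. ?h t s \<partial>lborel \<partial>lborel)"
  proof (intro Bochner_Integration.integral_cong refl)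
    fix t
    have "exp (- (\<i> * of_real t * of_real \<tau>)) * ((of_real (2 * pi) * f t) * g t)
      = (\<integral>s. exp (- (\<i> * of_real t * of_real \<tau>)) * g t * (ft f s * exp (\<i> * of_real s * of_real t)) \<partial>lborel)"
      unfolding fourier_inversion[OF f, symmetric] by (subst integral_mult_right_zero) (simp add: mult_ac)
    also have "\<dots> = (\<integral>s. ?h t s \<partial>lborel)"
    proof (intro Bochner_Integration.integral_cong refl)
      fix s
      have "exp (- (\<i> * of_real t * complex_of_real (\<tau> - s))) = exp (- (\<i> * of_real t * of_real \<tau>)) * exp (\<i> * of_real s * of_real t)"
        by (simp add: exp_add[symmetric] algebra_simps)
      then show "exp (- (\<i> * of_real t * of_real \<tau>)) * g t * (ft f s * exp (\<i> * of_real s * of_real t)) = ?h t s"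
        by (simp add: mult_ac)
    qed
    finally show "exp (- (\<i> * of_real t * of_real \<tau>)) * ((of_real (2 * pi) * f t) * g t) = (\<integral>s. ?h t s \<partial>lborel)" .
  qed
  also have "\<dots> = (\<integral>s. \<integral>t. ?h t s \<partial>lborel \<partial>lborel)"
    by (rule lborel_pair.Fubini_integral[symmetric]) (rule int)
  also have "\<dots> = (\<integral>s. ft f s * ft g (\<tau> - s) \<partial>lborel)"
  proof (intro Bochner_Integration.integral_cong refl)
    fix s
    have "(\<integral>t. ?h t s \<partial>lborel) = (\<integral>t. ft f s * (exp (- (\<i> * of_real t * of_real (\<tau> - s))) * g t) \<partial>lborel)"
      by (intro Bochner_Integration.integral_cong refl) (simp add: mult_ac)
    also have "\<dots> = ft f s * ft g (\<tau> - s)" unfolding ft_def[of g] by (rule integral_mult_right_zero)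
    finally show "(\<integral>t. ?h t s \<partial>lborel) = ft f s * ft g (\<tau> - s)" .
  qed
  finally have eq: "of_real (2 * pi) * ft (\<lambda>t. f t * g t) \<tau> = (\<integral>s. ft f s * ft g (\<tau> - s) \<partial>lborel)" .
  have "norm (ft (\<lambda>t. f t * g t) \<tau>) \<le> 2 * pi * norm (ft (\<lambda>t. f t * g t) \<tau>)"
    using pi_gt3 mult_right_mono[of 1 "2 * pi" "norm (ft (\<lambda>t. f t * g t) \<tau>)"] by simp
  also have "\<dots> = norm (of_real (2 * pi) * ft (\<lambda>t. f t * g t) \<tau>)" by (simp add: norm_mult)
  also have "\<dots> = norm (\<integral>s. ft f s * ft g (\<tau> - s) \<partial>lborel)" unfolding eq ..
  finally have "ennreal (norm (ft (\<lambda>t. f t * g t) \<tau>)) \<le> ennreal (norm (\<integral>s. ft f s * ft g (\<tau> - s) \<partial>lborel))"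
    by (rule ennreal_leI)
  also have "\<dots> \<le> (\<integral>\<^sup>+s. ennreal (norm (ft f s * ft g (\<tau> - s))) \<partial>lborel)"
  proof (rule integral_norm_bound_ennreal)
    obtain C where C: "C > 0" "\<And>s. norm (ft g s) \<le> C * jbr s powr (-2)" using ft_schwartz_decay[OF g] by auto
    have gb: "norm (ft g s) \<le> C" for s
    proof -
      have "C * jbr s powr (-2) \<le> C * 1" using C(1) powr_mono2'[of "-2" 1 "jbr s"] jbr_ge_1[of s] by (intro mult_left_mono) auto
      then show ?thesis using C(2)[of s] by simp
    qed
    show "integrable lborel (\<lambda>s. ft f s * ft g (\<tau> - s))"
    proof (rule Bochner_Integration.integrable_bound)
      show "integrable lborel (\<lambda>s. norm (ft f s) * C)" using ft_schwartz_integrable[OF f] by auto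
      show "AE s in lborel. norm (ft f s * ft g (\<tau> - s)) \<le> norm (norm (ft f s) * C)"
        using gb C(1) by (intro AE_I2) (auto simp: norm_mult abs_mult intro!: mult_left_mono)
    qed measurable
  qed
  also have "\<dots> = (\<integral>\<^sup>+s. ennreal (norm (ft f s)) * ennreal (norm (ft g (\<tau> - s))) \<partial>lborel)"
    by (simp add: norm_mult ennreal_mult)
  finally show ?thesis .
qed

section \<open>The norm of the completion\<close>

lemma ennsqrt_square[simp]: "(ennsqrt a)\<^sup>2 = a"
proof (cases a)
  case (real r)
  then show ?thesis by (simp add: ennsqrt_def ennreal_power)
next
  case top
  then show ?thesis by (simp add: ennsqrt_def power2_eq_square)
qed

lemma ennsqrt_power2[simp]: "ennsqrt (a\<^sup>2) = a"
proof (cases a)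
  case (real r)
  then show ?thesis by (simp add: ennsqrt_def ennreal_power)
next
  case top
  then show ?thesis by (simp add: ennsqrt_def power2_eq_square)
qed

lemma ennsqrt_mono: "a \<le> b \<Longrightarrow> ennsqrt a \<le> ennsqrt b"
  by (cases a; cases b) (auto simp: ennsqrt_def top_unique intro!: ennreal_leI)

lemma ennsqrt_le: "a \<le> b\<^sup>2 \<Longrightarrow> ennsqrt a \<le> b"
  using ennsqrt_mono[of a "b\<^sup>2"] by simp

lemma ennsqrt_top_iff: "ennsqrt a = top \<longleftrightarrow> a = top"
  by (auto simp: ennsqrt_def)

text \<open>Expanding the square leaves a cross term, which Cauchy--Schwarz, applied jointly over
  frequency and time, bounds by the product of the two roots.\<close>

lemma ennsqrt_mass_triangle:
  assumes fin: "finite K" and F: "\<And>k. k \<in> K \<Longrightarrow> F k \<in> borel_measurable borel" and G: "\<And>k. k \<in> K \<Longrightarrow> G k \<in> borel_measurable borel"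
    and le: "\<And>k x. k \<in> K \<Longrightarrow> H k x \<le> F k x + G k x"
  shows "ennsqrt (mass K H) \<le> ennsqrt (mass K F) + ennsqrt (mass K G)"
proof (rule ennsqrt_le)
  let ?M = "\<Sum>k\<in>K. \<integral>\<^sup>+x. F k x * G k x \<partial>lborel"
  have [measurable]: "k \<in> K \<Longrightarrow> F k \<in> borel_measurable borel" "k \<in> K \<Longrightarrow> G k \<in> borel_measurable borel" for k
    using F G by auto
  have "?M\<^sup>2 \<le> mass K F * mass K G"
    unfolding mass_def using fin F G by (intro Cauchy_Schwarz_sum_nn_integral lborel.sigma_finite_measure_axioms) auto
  also have "\<dots> = (ennsqrt (mass K F) * ennsqrt (mass K G))\<^sup>2" by (simp add: power_mult_distrib)
  finally have M: "?M \<le> ennsqrt (mass K F) * ennsqrt (mass K G)"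
    using ennsqrt_mono[of "?M\<^sup>2"] by fastforce
  have "mass K H \<le> (\<Sum>k\<in>K. \<integral>\<^sup>+x. (F k x + G k x)\<^sup>2 \<partial>lborel)"
    unfolding mass_def by (intro sum_mono nn_integral_mono power_mono le) auto
  also have "\<dots> = (\<Sum>k\<in>K. \<integral>\<^sup>+x. (F k x)\<^sup>2 + 2 * (F k x * G k x) + (G k x)\<^sup>2 \<partial>lborel)"
    by (intro sum.cong nn_integral_cong refl) (simp add: power2_sum ac_simps)
  also have "\<dots> = (\<Sum>k\<in>K. (\<integral>\<^sup>+x. (F k x)\<^sup>2 \<partial>lborel) + 2 * (\<integral>\<^sup>+x. F k x * G k x \<partial>lborel) + (\<integral>\<^sup>+x. (G k x)\<^sup>2 \<partial>lborel))"
    by (intro sum.cong refl) (simp add: nn_integral_add nn_integral_cmult)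
  also have "\<dots> = mass K F + 2 * ?M + mass K G" by (simp add: mass_def sum.distrib sum_distrib_left)
  also have "\<dots> \<le> mass K F + 2 * (ennsqrt (mass K F) * ennsqrt (mass K G)) + mass K G"
    by (intro add_mono mult_left_mono M) auto
  also have "\<dots> = (ennsqrt (mass K F))\<^sup>2 + 2 * (ennsqrt (mass K F) * ennsqrt (mass K G)) + (ennsqrt (mass K G))\<^sup>2"
    by simp
  also have "\<dots> = (ennsqrt (mass K F) + ennsqrt (mass K G))\<^sup>2"
    by (simp add: power2_sum ac_simps del: ennsqrt_square)
  finally show "mass K H \<le> (ennsqrt (mass K F) + ennsqrt (mass K G))\<^sup>2" .
qed

text \<open>The time frequency is shifted so that the argument \<open>x\<close> is the modulation.\<close>

definition xdens :: "nat \<Rightarrow> real \<Rightarrow> real \<Rightarrow> real \<Rightarrow> (real \<Rightarrow> real \<Rightarrow> complex) \<Rightarrow> int \<Rightarrow> real \<Rightarrow> ennreal"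
  where "xdens N \<sigma> s b u k x = ennreal (jbr (of_int k) powr s * jbr x powr b * cmod (st_fourier N u (x + \<sigma> * disp N k) k))"

lemma powr_double_square: "(a powr s :: real)\<^sup>2 = a powr (2 * s)"
  by (simp add: power2_eq_square flip: powr_add)

lemma nn_integral_shift_minus:
  fixes f :: "real \<Rightarrow> ennreal"
  assumes [measurable]: "f \<in> borel_measurable borel"
  shows "(\<integral>\<^sup>+\<tau>. f (\<tau> - c) \<partial>lborel) = (\<integral>\<^sup>+x. f x \<partial>lborel)"
  using nn_integral_shift[OF assms, of "-c"] by simp

lemma X_pre_eq_mass:
  assumes "\<And>k. k \<in> freqs N \<Longrightarrow> (\<lambda>\<tau>. st_fourier N u \<tau> k) \<in> borel_measurable borel"
  shows "X_pre N \<sigma> s b u = ennsqrt (mass (freqs N) (xdens N \<sigma> s b u))"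
proof -
  have "(\<integral>\<^sup>+\<tau>. ennreal (jbr (of_int k) powr (2 * s) * jbr (\<tau> - \<sigma> * disp N k) powr (2 * b) * (cmod (st_fourier N u \<tau> k))\<^sup>2) \<partial>lborel)
    = (\<integral>\<^sup>+x. (xdens N \<sigma> s b u k x)\<^sup>2 \<partial>lborel)" if k: "k \<in> freqs N" for k
  proof -
    note [measurable] = assms[OF k]
    have [measurable]: "(\<lambda>x. (xdens N \<sigma> s b u k x)\<^sup>2) \<in> borel_measurable borel" unfolding xdens_def by measurable
    have "(\<integral>\<^sup>+x. (xdens N \<sigma> s b u k x)\<^sup>2 \<partial>lborel) = (\<integral>\<^sup>+\<tau>. (xdens N \<sigma> s b u k (\<tau> - \<sigma> * disp N k))\<^sup>2 \<partial>lborel)"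
      by (rule nn_integral_shift_minus[symmetric]) measurable
    also have "\<dots> = (\<integral>\<^sup>+\<tau>. ennreal (jbr (of_int k) powr (2 * s) * jbr (\<tau> - \<sigma> * disp N k) powr (2 * b) * (cmod (st_fourier N u \<tau> k))\<^sup>2) \<partial>lborel)"
      by (intro nn_integral_cong) (simp add: xdens_def ennreal_power power_mult_distrib powr_double_square)
    finally show ?thesis by simp
  qed
  then show ?thesis unfolding X_pre_def mass_def by (simp cong: sum.cong)
qed

lemma st_fourier_eq_ft:
  assumes "\<forall>x\<in>grid N. integrable lborel (\<lambda>t. u t x)"
  shows "st_fourier N u \<tau> k = ft (\<lambda>t. dft N (u t) k) \<tau>"
proof -
  let ?e = "\<lambda>t. exp (- (\<i> * complex_of_real t * complex_of_real \<tau>))"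
  let ?d = "\<lambda>x. exp (- (\<i> * complex_of_real x * complex_of_int k))"
  have i: "integrable lborel (\<lambda>t. ?e t * ?d x * u t x)" if "x \<in> grid N" for x
    using integrable_mult_right[OF integrable_modulated[OF bspec[OF assms that], of \<tau>], of "?d x"] by (simp add: mult_ac)
  have "ft (\<lambda>t. dft N (u t) k) \<tau> = (\<integral>t. of_real (mesh N / (2 * pi)) * (\<Sum>x\<in>grid N. ?e t * ?d x * u t x) \<partial>lborel)"
    unfolding ft_def dft_def
    by (intro Bochner_Integration.integral_cong refl) (simp add: sum_distrib_left mult_ac)
  also have "\<dots> = of_real (mesh N / (2 * pi)) * (\<integral>t. (\<Sum>x\<in>grid N. ?e t * ?d x * u t x) \<partial>lborel)"
    by (rule integral_mult_right_zero)
  also have "(\<integral>t. (\<Sum>x\<in>grid N. ?e t * ?d x * u t x) \<partial>lborel) = (\<Sum>x\<in>grid N. \<integral>t. ?e t * ?d x * u t x \<partial>lborel)"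
    by (rule Bochner_Integration.integral_sum) (rule i)
  finally show ?thesis unfolding st_fourier_def ..
qed

lemma dft_schwartz:
  assumes "\<forall>x\<in>grid N. schwartz (\<lambda>t. u t x)"
  shows "schwartz (\<lambda>t. dft N (u t) k)"
  unfolding dft_def using assms by (intro schwartz_cmult schwartz_sum) auto

lemma st_fourier_schwartz:
  assumes "\<forall>x\<in>grid N. schwartz (\<lambda>t. u t x)"
  shows "st_fourier N u \<tau> k = ft (\<lambda>t. dft N (u t) k) \<tau>"
  using assms schwartz_integrable by (intro st_fourier_eq_ft) auto

lemma st_fourier_measurable:
  assumes "\<forall>x\<in>grid N. schwartz (\<lambda>t. u t x)"
  shows "(\<lambda>\<tau>. st_fourier N u \<tau> k) \<in> borel_measurable borel"
  unfolding st_fourier_schwartz[where u = u and N = N, OF assms]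
  using ft_measurable[OF schwartz_measurable[OF dft_schwartz[where u = u and N = N, OF assms]]] by simp

lemma xdens_measurable:
  assumes "\<forall>x\<in>grid N. schwartz (\<lambda>t. u t x)"
  shows "xdens N \<sigma> s b u k \<in> borel_measurable borel"
proof -
  note [measurable] = st_fourier_measurable[where u = u and N = N, OF assms]
  show ?thesis unfolding xdens_def[abs_def] by measurable
qed

lemma st_fourier_diff_schwartz:
  assumes u: "\<forall>x\<in>grid N. schwartz (\<lambda>t. u t x)" and v: "\<forall>x\<in>grid N. schwartz (\<lambda>t. v t x)"
  shows "st_fourier N (\<lambda>t x. u t x - v t x) \<tau> k = st_fourier N u \<tau> k - st_fourier N v \<tau> k"
proof -
  have i: "integrable lborel (\<lambda>t. exp (- (\<i> * complex_of_real t * complex_of_real \<tau>)) * dft N (u t) k)"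
    "integrable lborel (\<lambda>t. exp (- (\<i> * complex_of_real t * complex_of_real \<tau>)) * dft N (v t) k)"
    using u v by (intro integrable_modulated schwartz_integrable dft_schwartz; simp)+
  have "dft N (\<lambda>x. u t x - v t x) k = dft N (u t) k - dft N (v t) k" for t
    by (simp add: dft_def right_diff_distrib sum_subtractf)
  moreover have "st_fourier N (\<lambda>t x. u t x - v t x) \<tau> k = ft (\<lambda>t. dft N (\<lambda>x. u t x - v t x) k) \<tau>"
    using u v schwartz_diff by (intro st_fourier_schwartz) auto
  ultimately show ?thesis
    using i by (simp add: st_fourier_schwartz[where u = u and N = N, OF u] st_fourier_schwartz[where u = v and N = N, OF v] ft_def right_diff_distrib)
qed

lemma X_pre_triangle:
  assumes u: "\<forall>x\<in>grid N. schwartz (\<lambda>t. u t x)" and v: "\<forall>x\<in>grid N. schwartz (\<lambda>t. v t x)"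
  shows "X_pre N \<sigma> s b u \<le> X_pre N \<sigma> s b v + X_pre N \<sigma> s b (\<lambda>t x. u t x - v t x)"
proof -
  have d: "\<forall>x\<in>grid N. schwartz (\<lambda>t. u t x - v t x)" using u v schwartz_diff by auto
  have eq: "X_pre N \<sigma> s b u = ennsqrt (mass (freqs N) (xdens N \<sigma> s b u))"
    "X_pre N \<sigma> s b v = ennsqrt (mass (freqs N) (xdens N \<sigma> s b v))"
    "X_pre N \<sigma> s b (\<lambda>t x. u t x - v t x) = ennsqrt (mass (freqs N) (xdens N \<sigma> s b (\<lambda>t x. u t x - v t x)))"
    by (intro X_pre_eq_mass st_fourier_measurable u v d)+
  show ?thesis
    unfolding eq
  proof (rule ennsqrt_mass_triangle)
    fix k x
    have "cmod (st_fourier N u (x + \<sigma> * disp N k) k) \<le> cmod (st_fourier N v (x + \<sigma> * disp N k) k) +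
        cmod (st_fourier N (\<lambda>t x. u t x - v t x) (x + \<sigma> * disp N k) k)"
      unfolding st_fourier_diff_schwartz[where u = u and v = v and N = N, OF u v] by (simp add: norm_triangle_sub)
    from mult_left_mono[OF this, of "jbr (of_int k) powr s * jbr x powr b"]
    show "xdens N \<sigma> s b u k x \<le> xdens N \<sigma> s b v k x + xdens N \<sigma> s b (\<lambda>t x. u t x - v t x) k x"
      unfolding xdens_def by (simp add: distrib_left ennreal_plus[symmetric] ennreal_leI del: ennreal_plus)
  qed (use v d in \<open>auto intro: xdens_measurable simp: freqs_def\<close>)
qed

text \<open>The squared transform decays with exponent \<open>-4\<close> and the weight costs
  \<open>1\<close>, leaving the integrable \<open>-3\<close>. The shift by the dispersion goes into
  the constant through \<open>jbr x \<le> 4 * jbr d * jbr (x + d)\<close>.\<close>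

lemma X_pre_finite:
  assumes u: "\<forall>x\<in>grid N. schwartz (\<lambda>t. u t x)"
  shows "X_pre N \<sigma> s (1/2) u \<noteq> top"
proof -
  have "(\<integral>\<^sup>+x. (xdens N \<sigma> s (1/2) u k x)\<^sup>2 \<partial>lborel) < top" for k
  proof -
    obtain C where C: "C > 0" "\<And>\<tau>. norm (ft (\<lambda>t. dft N (u t) k) \<tau>) \<le> C * jbr \<tau> powr (-2)"
      using ft_schwartz_decay[OF dft_schwartz[where u = u and N = N, OF u]] by metis
    define d where "d = \<sigma> * disp N k"
    define A where "A = (jbr (of_int k) powr s)\<^sup>2 * C\<^sup>2 * (4 * jbr d)"
    have b: "(xdens N \<sigma> s (1/2) u k x)\<^sup>2 \<le> ennreal (A * jbr (x + d) powr (-3))" for x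
    proof -
      have j: "jbr x \<le> 4 * jbr d * jbr (x + d)"
      proof -
        have "jbr x \<le> 1 + \<bar>x + d\<bar> + \<bar>d\<bar>" using jbr_le[of x] by linarith
        also have "\<dots> \<le> (1 + \<bar>d\<bar>) * (1 + \<bar>x + d\<bar>)" by (simp add: algebra_simps)
        also have "\<dots> \<le> (2 * jbr d) * (2 * jbr (x + d))" using jbr_pos[of d] by (intro mult_mono one_plus_abs_le_jbr) auto
        finally show ?thesis by simp
      qed
      have n: "cmod (st_fourier N u (x + d) k) \<le> C * jbr (x + d) powr (-2)"
        unfolding st_fourier_schwartz[where u = u and N = N, OF u] by (rule C(2))
      have "(jbr (of_int k) powr s * jbr x powr (1/2) * cmod (st_fourier N u (x + d) k))\<^sup>2
        = (jbr (of_int k) powr s)\<^sup>2 * jbr x * (cmod (st_fourier N u (x + d) k))\<^sup>2"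
        using jbr_pos[of x] by (simp add: power_mult_distrib powr_double_square)
      also have "\<dots> \<le> (jbr (of_int k) powr s)\<^sup>2 * (4 * jbr d * jbr (x + d)) * (C * jbr (x + d) powr (-2))\<^sup>2"
        using jbr_pos[of d] jbr_pos[of "x + d"] jbr_pos[of x] by (intro mult_mono power_mono n j) auto
      also have "\<dots> = A * (jbr (x + d) powr 1 * jbr (x + d) powr (-2) * jbr (x + d) powr (-2))"
        using jbr_pos[of "x + d"] by (simp add: A_def power2_eq_square)
      also have "\<dots> = A * jbr (x + d) powr (1 + -2 + -2)" by (simp only: powr_add)
      finally have "(jbr (of_int k) powr s * jbr x powr (1/2) * cmod (st_fourier N u (x + d) k))\<^sup>2 \<le> A * jbr (x + d) powr (-3)" by simp
      then show ?thesis unfolding xdens_def d_def[symmetric] by (simp add: ennreal_power ennreal_leI)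
    qed
    have "(\<integral>\<^sup>+x. (xdens N \<sigma> s (1/2) u k x)\<^sup>2 \<partial>lborel) \<le> (\<integral>\<^sup>+x. ennreal (A * jbr (x + d) powr (-3)) \<partial>lborel)"
      by (intro nn_integral_mono b)
    also have "\<dots> = (\<integral>\<^sup>+x. ennreal (A * jbr x powr (-3)) \<partial>lborel)"
      by (rule nn_integral_shift[of "\<lambda>x. ennreal (A * jbr x powr (-3))"]) measurable
    also have "\<dots> = ennreal A * (\<integral>\<^sup>+x. ennreal (jbr x powr (-3)) \<partial>lborel)"
      using jbr_pos[of d] by (subst nn_integral_cmult[symmetric]) (auto simp: A_def ennreal_mult)
    also have "\<dots> < top"
      using jbr_powr_integral[of 3] by (auto simp: ennreal_mult_less_top intro: le_less_trans)
    finally show ?thesis .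
  qed
  then have "mass (freqs N) (xdens N \<sigma> s (1/2) u) < top"
    unfolding mass_def by (simp add: freqs_def)
  then show ?thesis using X_pre_eq_mass[of N u, OF st_fourier_measurable[where u = u and N = N, OF u]] by (simp add: ennsqrt_top_iff)
qed

text \<open>The Cauchy condition is phrased with addition, as subtraction in \<open>ennreal\<close>
  is truncated; exchanging \<open>m\<close> and \<open>n\<close> recovers the two-sided bound for
  the real values.\<close>

lemma ennreal_Cauchy_tendsto:
  fixes a :: "nat \<Rightarrow> ennreal"
  assumes fin: "\<And>n. a n \<noteq> top"
    and cau: "\<And>e. e > 0 \<Longrightarrow> \<exists>M. \<forall>m\<ge>M. \<forall>n\<ge>M. a m \<le> a n + ennreal e"
  shows "\<exists>L. L \<noteq> top \<and> a \<longlonglongrightarrow> L"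
proof -
  define r where "r n = enn2real (a n)" for n
  have a: "a n = ennreal (r n)" for n using fin[of n] by (simp add: r_def less_top)
  have r0: "0 \<le> r n" for n by (simp add: r_def)
  have "Cauchy r"
  proof (rule metric_CauchyI)
    fix e :: real assume e: "e > 0"
    obtain M where M: "\<forall>m\<ge>M. \<forall>n\<ge>M. a m \<le> a n + ennreal (e/2)" using cau[of "e/2"] e by auto
    have "r m \<le> r n + e/2" if "m \<ge> M" "n \<ge> M" for m n
    proof -
      have "ennreal (r m) \<le> ennreal (r n + e/2)" using M that e r0 by (simp add: a ennreal_plus)
      then show ?thesis using r0[of n] e by (subst (asm) ennreal_le_iff) auto
    qed
    then have "dist (r m) (r n) < e" if "m \<ge> M" "n \<ge> M" for m n
      using that e by (smt (verit) dist_real_def field_sum_of_halves)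
    then show "\<exists>M. \<forall>m\<ge>M. \<forall>n\<ge>M. dist (r m) (r n) < e" by blast
  qed
  then obtain l where l: "r \<longlonglongrightarrow> l" using Cauchy_convergent convergent_def by blast
  then have "(\<lambda>n. ennreal (r n)) \<longlonglongrightarrow> ennreal l" by (rule tendsto_ennrealI)
  then show ?thesis by (intro exI[of _ "ennreal l"]) (simp add: a[abs_def])
qed

text \<open>\<open>X_norm\<close> is a \<open>lim\<close> along the sequence picked by
  \<open>SOME\<close>, and says something only once the norms along it are known to converge. The
  triangle inequality makes these norms Cauchy, and each of them is finite. The
  \<open>\<phi>\<close> obtained is the very sequence that \<open>SOME\<close> picks.\<close>

lemma X_norm_witness:
  assumes "u \<in> X_space N \<sigma> s (1/2)"
  obtains \<phi> where "X_approx N \<sigma> s (1/2) \<phi> u" "(\<lambda>n. X_pre N \<sigma> s (1/2) (\<phi> n)) \<longlonglongrightarrow> X_norm N \<sigma> s (1/2) u"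
    "X_norm N \<sigma> s (1/2) u \<noteq> top"
proof -
  define \<phi> where "\<phi> = (SOME \<phi>. X_approx N \<sigma> s (1/2) \<phi> u)"
  have ap: "X_approx N \<sigma> s (1/2) \<phi> u"
  proof -
    have "\<exists>\<phi>. X_approx N \<sigma> s (1/2) \<phi> u" using assms unfolding X_space_def by (rule CollectD)
    then show ?thesis unfolding \<phi>_def by (rule someI_ex)
  qed
  then have sch: "\<And>n. \<forall>x\<in>grid N. schwartz (\<lambda>t. \<phi> n t x)"
    and cau: "\<And>e. e > 0 \<Longrightarrow> \<exists>M. \<forall>m\<ge>M. \<forall>n\<ge>M. X_pre N \<sigma> s (1/2) (\<lambda>t x. \<phi> m t x - \<phi> n t x) < ennreal e"
    unfolding X_approx_def by blast+
  have "\<exists>L. L \<noteq> top \<and> (\<lambda>n. X_pre N \<sigma> s (1/2) (\<phi> n)) \<longlonglongrightarrow> L"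
  proof (rule ennreal_Cauchy_tendsto)
    show "X_pre N \<sigma> s (1/2) (\<phi> n) \<noteq> top" for n by (rule X_pre_finite) (rule sch)
    fix e :: real assume "e > 0"
    then obtain M where M: "\<forall>m\<ge>M. \<forall>n\<ge>M. X_pre N \<sigma> s (1/2) (\<lambda>t x. \<phi> m t x - \<phi> n t x) < ennreal e" using cau by blast
    have "X_pre N \<sigma> s (1/2) (\<phi> m) \<le> X_pre N \<sigma> s (1/2) (\<phi> n) + ennreal e" if "m \<ge> M" "n \<ge> M" for m n
      using X_pre_triangle[OF sch[of m] sch[of n], of \<sigma> s "1/2"] M that
      by (meson add_left_mono less_imp_le order_trans)
    then show "\<exists>M. \<forall>m\<ge>M. \<forall>n\<ge>M. X_pre N \<sigma> s (1/2) (\<phi> m) \<le> X_pre N \<sigma> s (1/2) (\<phi> n) + ennreal e" by blast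
  qed
  then obtain L where L: "L \<noteq> top" "(\<lambda>n. X_pre N \<sigma> s (1/2) (\<phi> n)) \<longlonglongrightarrow> L" by blast
  then have "X_norm N \<sigma> s (1/2) u = L" unfolding X_norm_def \<phi>_def[symmetric] by (intro limI)
  with L ap show ?thesis by (intro that) auto
qed

section \<open>The discrete Fourier transform\<close>

lemma nabla_symbol_bounds:
  assumes N: "N > 0"
  shows "cmod (nabla_symbol N k) \<le> \<bar>of_int k\<bar>" "cmod (nabla_symbol N k) \<le> 2 / mesh N"
proof -
  have h: "mesh N > 0" by (rule mesh_pos[OF N])
  have e: "cmod (nabla_symbol N k) = 2 / mesh N * \<bar>sin (mesh N * of_int k / 2)\<bar>"
    using h by (simp add: nabla_symbol_def norm_mult norm_divide)
  have "2 / mesh N * \<bar>sin (mesh N * of_int k / 2)\<bar> \<le> 2 / mesh N * \<bar>mesh N * of_int k / 2\<bar>"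
    using h by (intro mult_left_mono abs_sin_x_le_abs_x) auto
  also have "\<dots> = \<bar>of_int k\<bar>" using h by (simp add: abs_mult)
  finally show "cmod (nabla_symbol N k) \<le> \<bar>of_int k\<bar>" unfolding e .
  have "2 / mesh N * \<bar>sin (mesh N * of_int k / 2)\<bar> \<le> 2 / mesh N * 1"
    using h by (intro mult_left_mono) auto
  then show "cmod (nabla_symbol N k) \<le> 2 / mesh N" unfolding e by simp
qed

text \<open>An aliased output satisfies
  \<open>\<bar>k\<bar> \<le> N \<le> \<bar>k1 + k2\<bar>\<close>, so wrapping around does not
  enlarge the frequency.\<close>

lemma triads_abs_le:
  assumes "(k1, k2, k) \<in> triads N"
  shows "\<bar>real_of_int k\<bar> \<le> \<bar>of_int k1\<bar> + \<bar>of_int k2\<bar>"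
proof -
  have "\<bar>k\<bar> \<le> \<bar>k1\<bar> + \<bar>k2\<bar>"
  proof (cases "k1 + k2 = k")
    case False
    have "\<bar>k\<bar> \<le> int N" using assms by (auto simp: triads_def freqs_def)
    then show ?thesis using triads_alias_cases[OF assms False] by auto
  qed auto
  then show ?thesis by linarith
qed

text \<open>The two bounds for the symbol are interpolated with exponent
  \<open>\<delta> = s' - s\<close>, which lies between \<open>0\<close> and \<open>1\<close>:
  \<open>jbr k powr \<delta>\<close> raises the weight from \<open>s\<close> to \<open>s'\<close>,
  and \<open>(1 / h) powr (1 - \<delta>)\<close> leaves the gain \<open>h powr \<delta>\<close> next
  to \<open>1 / h\<close>. The weight of \<open>k\<close> is then distributed over the inputs at the
  cost \<open>2 powr s'\<close>; the other \<open>2\<close> is that of \<open>2 / h\<close>.\<close>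

lemma symbol_weight_bound:
  fixes s s' :: real
  assumes s: "0 \<le> s" "s \<le> s'" "s' \<le> s + 1" and N: "N > 0" and t: "(k1, k2, k) \<in> triads N"
  shows "jbr (of_int k) powr s * cmod (nabla_symbol N k) \<le>
    2 powr (s' + 1) * mesh N powr (s' - s) * (1 / mesh N * (jbr (of_int k1) powr s' * jbr (of_int k2) powr s'))"
proof (cases "nabla_symbol N k = 0")
  case True
  then show ?thesis using mesh_pos[OF N] by simp
next
  case False
  define h \<delta> A where "h = mesh N" and "\<delta> = s' - s" and "A = cmod (nabla_symbol N k)"
  have h: "h > 0" using mesh_pos[OF N] by (simp add: h_def)
  have d: "0 \<le> \<delta>" "\<delta> \<le> 1" using s by (auto simp: \<delta>_def)
  have A: "A > 0" using False by (simp add: A_def)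
  have A1: "A \<le> jbr (of_int k)" using nabla_symbol_bounds(1)[OF N, of k] jbr_ge_abs[of "of_int k"] by (simp add: A_def)
  have A2: "A \<le> 2 / h" using nabla_symbol_bounds(2)[OF N, of k] by (simp add: A_def h_def)
  have "A = A powr \<delta> * A powr (1 - \<delta>)" using A by (simp flip: powr_add)
  also have "\<dots> \<le> jbr (of_int k) powr \<delta> * (2 / h) powr (1 - \<delta>)"
    using A A1 A2 d h by (intro mult_mono powr_mono2) auto
  also have "(2 / h) powr (1 - \<delta>) = 2 powr (1 - \<delta>) * (h powr \<delta> / h)"
    using h by (simp add: powr_divide powr_diff)
  also have "\<dots> \<le> 2 powr 1 * (h powr \<delta> / h)"
    using d h by (intro mult_right_mono powr_mono) auto
  finally have A3: "A \<le> jbr (of_int k) powr \<delta> * (2 powr 1 * (h powr \<delta> / h))" by (simp add: mult_left_mono)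
  have kk: "jbr (of_int k) \<le> 2 * jbr (of_int k1) * jbr (of_int k2)"
  proof -
    let ?a = "\<bar>real_of_int k1\<bar>" and ?b = "\<bar>real_of_int k2\<bar>"
    have sq: "(1 + ?a\<^sup>2) * (1 + ?b\<^sup>2) * 4 \<ge> 1 + (?a + ?b)\<^sup>2"
    proof -
      have "(?a + ?b)\<^sup>2 \<le> 2 * (?a\<^sup>2 + ?b\<^sup>2)" using sum_squares_bound[of ?a ?b] by (simp add: power2_sum)
      moreover have "0 \<le> ?a\<^sup>2 * ?b\<^sup>2" by simp
      ultimately show ?thesis using zero_le_power2[of ?a] zero_le_power2[of ?b] by (simp only: distrib_left distrib_right)
    qed
    have "jbr (of_int k) = sqrt (1 + \<bar>real_of_int k\<bar>\<^sup>2)" by (simp add: jbr_sqrt)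
    also have "\<dots> \<le> sqrt (1 + (?a + ?b)\<^sup>2)"
      using triads_abs_le[OF t] by (intro real_sqrt_le_mono add_left_mono power_mono) auto
    also have "\<dots> \<le> sqrt ((1 + ?a\<^sup>2) * (1 + ?b\<^sup>2) * 4)" using sq by (rule real_sqrt_le_mono)
    also have "\<dots> = 2 * jbr (of_int k1) * jbr (of_int k2)" by (simp add: jbr_sqrt real_sqrt_mult)
    finally show ?thesis .
  qed
  have "jbr (of_int k) powr s * A \<le> jbr (of_int k) powr s * (jbr (of_int k) powr \<delta> * (2 powr 1 * (h powr \<delta> / h)))"
    using A3 by (intro mult_left_mono) auto
  also have "\<dots> = jbr (of_int k) powr s' * (2 * (h powr \<delta> / h))"
    by (simp add: \<delta>_def mult.assoc[symmetric] flip: powr_add)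
  also have "\<dots> \<le> (2 * jbr (of_int k1) * jbr (of_int k2)) powr s' * (2 * (h powr \<delta> / h))"
    using kk s h jbr_pos[of "of_int k"] by (intro mult_right_mono powr_mono2) auto
  also have "(2 * jbr (of_int k1) * jbr (of_int k2)) powr s' = 2 powr s' * jbr (of_int k1) powr s' * jbr (of_int k2) powr s'"
    using jbr_pos[of "of_int k1"] jbr_pos[of "of_int k2"] by (simp add: powr_mult)
  finally show ?thesis by (simp add: A_def h_def \<delta>_def powr_add mult_ac)
qed

section \<open>Characters on the grid and the transform of products\<close>

lemma grid_inj: "N > 0 \<Longrightarrow> inj_on (\<lambda>n. mesh N * of_int n) A"
  using mesh_pos[of N] by (auto simp: inj_on_def)

lemma exp_grid_period:
  assumes N: "N > 0" and x: "x \<in> grid N" and d: "2 * int N dvd j"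
  shows "exp (\<i> * of_real x * of_int j) = 1"
proof -
  obtain n where n: "x = mesh N * of_int n" using x by (auto simp: grid_def)
  obtain m where m: "j = 2 * int N * m" using d by auto
  have "x * of_int j = 2 * pi * of_int (n * m)" using N by (simp add: n m mesh_def)
  then have "exp (\<i> * of_real x * of_int j) = exp (\<i> * of_real (2 * pi * of_int (n * m)))"
    by (metis (no_types, opaque_lifting) mult.assoc of_real_mult of_real_of_int_eq)
  also have "\<dots> = 1" by (subst exp_eq_1) (auto intro!: exI[of _ "n * m"])
  finally show ?thesis .
qed

text \<open>Multiplication by \<open>z\<close> shifts the summation index by one, and the terms at
  \<open>N\<close> and \<open>- N\<close> agree, so \<open>z * S = S\<close>. The sum vanishes
  unless \<open>z = 1\<close>, which is the divisible case.\<close>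

lemma grid_exp_sum:
  assumes N: "N > 0"
  shows "(\<Sum>x\<in>grid N. exp (\<i> * of_real x * of_int j)) = (if 2 * int N dvd j then of_nat (2 * N) else 0)"
proof (cases "2 * int N dvd j")
  case True
  have "card (grid N) = 2 * N" unfolding grid_def using grid_inj[OF N] by (simp add: card_image)
  then show ?thesis using exp_grid_period[OF N _ True] True by simp
next
  case False
  define z where "z = exp (\<i> * of_real (mesh N * of_int j))"
  define f where "f n = exp (\<i> * of_real (mesh N * of_int n) * of_int j)" for n :: int
  define S where "S = (\<Sum>n\<in>{- int N..<int N}. f n)"
  have S: "(\<Sum>x\<in>grid N. exp (\<i> * of_real x * of_int j)) = S"
    unfolding grid_def S_def f_def using grid_inj[OF N] by (subst sum.reindex) (auto simp: o_def)
  have z1: "z \<noteq> 1"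
  proof
    assume "z = 1"
    then obtain n :: int where "mesh N * of_int j = of_int (2 * n) * pi"
      unfolding z_def exp_eq_1 by auto
    then have "of_int j = real_of_int (2 * int N * n)" using N by (simp add: mesh_def field_simps)
    then have "j = 2 * int N * n" by linarith
    then show False using False by simp
  qed
  have step: "f (n + 1) = z * f n" for n
    by (simp add: f_def z_def exp_add[symmetric] algebra_simps)
  have per: "f (int N) = f (- int N)"
  proof -
    have "\<i> * of_real (mesh N * of_int (int N)) * of_int j = \<i> * of_real (mesh N * of_int (- int N)) * of_int j + \<i> * of_real (2 * pi * of_int j)"
      using N by (simp add: mesh_def algebra_simps)
    then have "f (int N) = f (- int N) * exp (\<i> * of_real (2 * pi * of_int j))" unfolding f_def by (simp only: exp_add)
    also have "exp (\<i> * of_real (2 * pi * of_int j)) = 1" by (subst exp_eq_1) (auto intro!: exI[of _ j])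
    finally show ?thesis by simp
  qed
  have "z * S = (\<Sum>n\<in>{- int N..<int N}. f (n + 1))" by (simp add: S_def step sum_distrib_left)
  also have "\<dots> = (\<Sum>n\<in>(\<lambda>n. n + 1) ` {- int N..<int N}. f n)" by (subst sum.reindex) (auto simp: inj_on_def)
  also have "(\<lambda>n. n + 1) ` {- int N..<int N} = {- int N + 1..<int N + 1}"
    by (simp only: image_add_atLeastLessThan' add.commute)
  also have "\<dots> = insert (int N) ({- int N..<int N} - {- int N})" using N by auto
  also have "(\<Sum>n\<in>\<dots>. f n) = f (int N) + (\<Sum>n\<in>{- int N..<int N} - {- int N}. f n)" by (subst sum.insert) auto
  also have "\<dots> = S" using N by (simp add: S_def sum_diff1 per)
  finally have "(z - 1) * S = 0" by (simp add: algebra_simps)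
  then show ?thesis using z1 S False by simp
qed

lemma dft_periodic:
  assumes N: "N > 0" and d: "2 * int N dvd j - j'"
  shows "dft N a j = dft N a j'"
proof -
  have "exp (- (\<i> * of_real x * of_int j)) = exp (- (\<i> * of_real x * of_int j'))" if "x \<in> grid N" for x
  proof -
    have "exp (- (\<i> * of_real x * of_int j')) = exp (- (\<i> * of_real x * of_int j)) * exp (\<i> * of_real x * of_int (j - j'))"
      by (simp add: exp_add[symmetric] algebra_simps)
    then show ?thesis using exp_grid_period[OF N that d] by simp
  qed
  then show ?thesis unfolding dft_def by simp
qed

lemma dft_mean_zero:
  assumes N: "N > 0" and d: "2 * int N dvd j" and z: "(\<Sum>x\<in>grid N. a x) = 0"
  shows "dft N a j = 0"
  using dft_periodic[OF N, of j 0 a] d z by (simp add: dft_def)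

text \<open>Orthogonality of the characters leaves only those \<open>j\<close> that are congruent to
  \<open>k\<close>, and within \<open>freqs N\<close> this is \<open>k\<close> alone.\<close>

lemma dft_multiplier:
  assumes N: "N > 0" and k: "k \<in> freqs N"
  shows "dft N (fourier_multiplier N m f) k = m k * dft N f k"
proof -
  have "dft N (fourier_multiplier N m f) k = of_real (mesh N / (2 * pi)) *
     (\<Sum>x\<in>grid N. \<Sum>j\<in>freqs N. m j * dft N f j * exp (\<i> * of_real x * of_int (j - k)))"
    unfolding dft_def[of N "fourier_multiplier N m f"] unfolding fourier_multiplier_def
    by (simp add: sum_distrib_left exp_add[symmetric] exp_diff exp_minus field_simps)
  also have "\<dots> = of_real (mesh N / (2 * pi)) * (\<Sum>j\<in>freqs N. m j * dft N f j * (\<Sum>x\<in>grid N. exp (\<i> * of_real x * of_int (j - k))))"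
    by (subst sum.swap) (simp only: sum_distrib_left)
  also have "\<dots> = of_real (mesh N / (2 * pi)) * (\<Sum>j\<in>freqs N. if j = k then m k * dft N f k * of_nat (2 * N) else 0)"
    unfolding grid_exp_sum[OF N]
    using freqs_cong_unique[OF _ k] by (intro arg_cong2[where f = "(*)"] sum.cong refl) auto
  also have "\<dots> = of_real (mesh N / (2 * pi)) * (m k * dft N f k * of_nat (2 * N))"
    using k by (simp add: freqs_def)
  also have "\<dots> = m k * dft N f k" using N by (simp add: mesh_def)
  finally show ?thesis .
qed

text \<open>The difference \<open>k - j\<close> may leave \<open>freqs N\<close>; its reduction is
  postponed to \<open>dft_product_triads\<close>, where periodicity of \<open>dft\<close> takes care
  of it.\<close>

lemma dft_product:
  "dft N (\<lambda>x. a x * fourier_multiplier N m b x) k = (\<Sum>j\<in>freqs N. m j * dft N b j * dft N a (k - j))"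
proof -
  have "dft N (\<lambda>x. a x * fourier_multiplier N m b x) k = of_real (mesh N / (2 * pi)) *
     (\<Sum>x\<in>grid N. \<Sum>j\<in>freqs N. m j * dft N b j * (exp (- (\<i> * of_real x * of_int (k - j))) * a x))"
    unfolding dft_def[of N "\<lambda>x. a x * fourier_multiplier N m b x"] unfolding fourier_multiplier_def
    by (simp add: sum_distrib_left exp_diff exp_minus right_diff_distrib field_simps)
  also have "\<dots> = (\<Sum>j\<in>freqs N. m j * dft N b j * (of_real (mesh N / (2 * pi)) * (\<Sum>x\<in>grid N. exp (- (\<i> * of_real x * of_int (k - j))) * a x)))"
    by (subst sum.swap) (simp only: sum_distrib_left mult.left_commute)
  finally show ?thesis unfolding dft_def[of N a] .
qed

text \<open>The terms not indexed by a triad have \<open>j\<close> or \<open>k - j\<close> divisible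
  by \<open>2 * N\<close>. There one of the transforms is a mean value and vanishes.\<close>

lemma dft_product_triads:
  assumes N: "N > 0" and k: "k \<in> freqs N" and za: "(\<Sum>x\<in>grid N. a x) = 0" and zb: "(\<Sum>x\<in>grid N. b x) = 0"
  shows "dft N (\<lambda>x. a x * fourier_multiplier N m b x) k =
    (\<Sum>i\<in>{i\<in>triads N. snd (snd i) = k}. m (fst (snd i)) * (dft N a (fst i) * dft N b (fst (snd i))))"
proof -
  let ?I = "{i\<in>triads N. snd (snd i) = k}"
  let ?h = "\<lambda>j. m j * dft N b j * dft N a (k - j)"
  have "(\<Sum>i\<in>?I. m (fst (snd i)) * (dft N a (fst i) * dft N b (fst (snd i)))) = (\<Sum>i\<in>?I. ?h (fst (snd i)))"
  proof (intro sum.cong refl)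
    fix i assume "i \<in> ?I"
    then have "2 * int N dvd fst i - (k - fst (snd i))" by (auto simp: triads_def algebra_simps)
    from dft_periodic[OF N this, of a]
    show "m (fst (snd i)) * (dft N a (fst i) * dft N b (fst (snd i))) = ?h (fst (snd i))" by simp
  qed
  also have "\<dots> = (\<Sum>j\<in>(\<lambda>i. fst (snd i)) ` ?I. ?h j)"
    using fiber_inj(1) by (simp add: sum.reindex)
  also have "\<dots> = (\<Sum>j\<in>freqs N. ?h j)"
  proof (rule sum.mono_neutral_left)
    show "finite (freqs N)" by (simp add: freqs_def)
    show "(\<lambda>i. fst (snd i)) ` ?I \<subseteq> freqs N" by (auto simp: triads_def)
    show "\<forall>j\<in>freqs N - (\<lambda>i. fst (snd i)) ` ?I. ?h j = 0"
    proof
      fix j assume j: "j \<in> freqs N - (\<lambda>i. fst (snd i)) ` ?I"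
      \<comment> \<open>The representative of \<open>k - j\<close> in \<open>freqs N\<close>; adding
        \<open>N\<close> before \<open>mod\<close> and subtracting it afterwards centres the
        range.\<close>
      define l where "l = (k - j + int N) mod (2 * int N) - int N"
      have lf: "l \<in> freqs N" using N by (simp add: l_def freqs_def)
      have ld: "2 * int N dvd l - (k - j)"
      proof -
        have "l - (k - j) = (k - j + int N) mod (2 * int N) - (k - j + int N)" by (simp add: l_def)
        also have "2 * int N dvd \<dots>" by (simp add: mod_eq_dvd_iff[symmetric])
        finally show ?thesis .
      qed
      have "j = 0 \<or> l = 0"
      proof (rule ccontr)
        assume "\<not> ?thesis"
        moreover have "2 * int N dvd l + j - k" using ld by (simp add: algebra_simps)
        ultimately have "(l, j, k) \<in> ?I" using lf j k by (simp add: triads_def)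
        then have "fst (snd (l, j, k)) \<in> (\<lambda>i. fst (snd i)) ` ?I" by (rule imageI)
        then show False using j by simp
      qed
      then show "?h j = 0"
      proof
        assume "j = 0" then show ?thesis using dft_mean_zero[OF N _ zb, of j] by simp
      next
        assume "l = 0"
        then have "2 * int N dvd k - j" using ld by (simp add: dvd_diff_commute)
        then show ?thesis using dft_mean_zero[OF N _ za, of "k - j"] by simp
      qed
    qed
  qed
  finally show ?thesis by (simp add: dft_product)
qed

section \<open>Passage to the limit\<close>

lemma ennreal_square_tendsto_0:
  fixes r :: "nat \<Rightarrow> ennreal"
  assumes "(\<lambda>n. (r n)\<^sup>2) \<longlonglongrightarrow> 0"
  shows "r \<longlonglongrightarrow> 0"
proof (rule order_tendstoI)
  fix e :: ennreal assume e: "0 < e"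
  then have "0 < e\<^sup>2" by (simp add: power2_eq_square ennreal_zero_less_mult_iff)
  then have "eventually (\<lambda>n. (r n)\<^sup>2 < e\<^sup>2) sequentially" using order_tendstoD(2)[OF assms] by blast
  then show "eventually (\<lambda>n. r n < e) sequentially"
    by eventually_elim (meson not_less power_mono zero_le)
qed auto

text \<open>Any \<open>y\<close> below a finite \<open>X\<close> leaves a positive gap
  \<open>X - y\<close>, which \<open>r n\<close> eventually cannot fill, so \<open>E n\<close> has
  to exceed \<open>y\<close>.\<close>

lemma le_liminf_perturbed:
  fixes E r :: "nat \<Rightarrow> ennreal"
  assumes le: "\<And>n. X \<le> E n + r n" and r: "r \<longlonglongrightarrow> 0" and X: "X \<noteq> top"
  shows "X \<le> liminf E"
  unfolding le_Liminf_iff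
proof (intro allI impI)
  fix y assume y: "y < X"
  then have "0 < X - y" using X by (simp add: diff_gr0_ennreal less_top)
  then have "eventually (\<lambda>n. r n < X - y) sequentially" using order_tendstoD(2)[OF r] by blast
  then show "eventually (\<lambda>n. y < E n) sequentially"
  proof eventually_elim
    case (elim n)
    show ?case
    proof (rule ccontr)
      assume "\<not> y < E n"
      then have "X \<le> y + r n" using le[of n] by (meson add_right_mono not_less order_trans)
      moreover have "y + r n < y + (X - y)" using elim y X by (simp add: ennreal_add_left_cancel_less less_top)
      moreover have "y + (X - y) = X" using y by (simp add: add_diff_inverse_ennreal less_imp_le)
      ultimately show False by simp
    qed
  qed
qed

lemma le_liminf_square:
  fixes E :: "nat \<Rightarrow> ennreal"
  assumes "X \<le> liminf E"
  shows "X\<^sup>2 \<le> liminf (\<lambda>n. (E n)\<^sup>2)"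
  unfolding le_Liminf_iff
proof (intro allI impI)
  fix y assume "y < X\<^sup>2"
  then have "ennsqrt y < X" using power_mono[of X "ennsqrt y" 2] by (metis ennsqrt_square not_less zero_le)
  then have "eventually (\<lambda>n. ennsqrt y < E n) sequentially" using assms unfolding le_Liminf_iff by blast
  then show "eventually (\<lambda>n. y < (E n)\<^sup>2) sequentially"
    by eventually_elim (metis ennsqrt_mono ennsqrt_power2 not_less)
qed

text \<open>Fatou's lemma for counting measure.\<close>

lemma sum_liminf_le:
  fixes a :: "nat \<Rightarrow> 'a \<Rightarrow> ennreal"
  assumes "finite K"
  shows "(\<Sum>k\<in>K. liminf (\<lambda>n. a n k)) \<le> liminf (\<lambda>n. \<Sum>k\<in>K. a n k)"
  using nn_integral_liminf[of a "count_space K"] assms by (simp add: nn_integral_count_space_finite)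

section \<open>Products of square integrable limits\<close>

lemma schwartz_square_finite:
  assumes f: "schwartz f"
  shows "(\<integral>\<^sup>+t. ennreal ((cmod (f t))\<^sup>2) \<partial>lborel) < top"
proof -
  obtain C where C: "C > 0" "\<And>t. norm (f t) \<le> C * jbr t powr (-2)" using schwartz_decay[OF f] by auto
  have b: "(cmod (f t))\<^sup>2 \<le> C\<^sup>2 * jbr t powr (-4)" for t
  proof -
    have "(cmod (f t))\<^sup>2 \<le> (C * jbr t powr (-2))\<^sup>2" using C(2) by (intro power_mono) auto
    then show ?thesis by (simp add: power_mult_distrib powr_double_square)
  qed
  have "(\<integral>\<^sup>+t. ennreal ((cmod (f t))\<^sup>2) \<partial>lborel) \<le> (\<integral>\<^sup>+t. ennreal (C\<^sup>2) * ennreal (jbr t powr (-4)) \<partial>lborel)"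
    using b by (intro nn_integral_mono) (simp add: ennreal_mult[symmetric] ennreal_leI)
  also have "\<dots> = ennreal (C\<^sup>2) * (\<integral>\<^sup>+t. ennreal (jbr t powr (-4)) \<partial>lborel)"
    by (rule nn_integral_cmult) measurable
  also have "\<dots> < top" using jbr_powr_integral[of 4] by (auto simp: ennreal_mult_less_top intro: le_less_trans)
  finally show ?thesis .
qed

lemma L2_limit_finite:
  assumes F: "\<And>n. schwartz (F n)" and [measurable]: "f \<in> borel_measurable borel"
    and lim: "(\<lambda>n. \<integral>\<^sup>+t. ennreal ((cmod (F n t - f t))\<^sup>2) \<partial>lborel) \<longlonglongrightarrow> 0"
  shows "(\<integral>\<^sup>+t. ennreal ((cmod (f t))\<^sup>2) \<partial>lborel) < top"
proof -
  have [measurable]: "F n \<in> borel_measurable borel" for n by (rule schwartz_measurable[OF F])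
  have "eventually (\<lambda>n. (\<integral>\<^sup>+t. ennreal ((cmod (F n t - f t))\<^sup>2) \<partial>lborel) < 1) sequentially"
    using order_tendstoD(2)[OF lim, of 1] by simp
  then obtain n where n: "(\<integral>\<^sup>+t. ennreal ((cmod (F n t - f t))\<^sup>2) \<partial>lborel) < 1"
    unfolding eventually_sequentially by blast
  have pw: "(cmod (f t))\<^sup>2 \<le> 2 * ((cmod (F n t))\<^sup>2 + (cmod (F n t - f t))\<^sup>2)" for t
  proof -
    have "(cmod (f t))\<^sup>2 \<le> (cmod (F n t) + cmod (F n t - f t))\<^sup>2"
      using norm_triangle_ineq4[of "F n t" "F n t - f t"] by (intro power_mono) auto
    also have "\<dots> \<le> 2 * ((cmod (F n t))\<^sup>2 + (cmod (F n t - f t))\<^sup>2)"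
      using sum_squares_bound[of "cmod (F n t)" "cmod (F n t - f t)"] by (simp add: power2_sum)
    finally show ?thesis .
  qed
  have "(\<integral>\<^sup>+t. ennreal ((cmod (f t))\<^sup>2) \<partial>lborel) \<le>
     (\<integral>\<^sup>+t. 2 * (ennreal ((cmod (F n t))\<^sup>2) + ennreal ((cmod (F n t - f t))\<^sup>2)) \<partial>lborel)"
  proof (rule nn_integral_mono)
    fix t
    have "ennreal ((cmod (f t))\<^sup>2) \<le> ennreal (2 * ((cmod (F n t))\<^sup>2 + (cmod (F n t - f t))\<^sup>2))" by (rule ennreal_leI[OF pw])
    then show "ennreal ((cmod (f t))\<^sup>2) \<le> 2 * (ennreal ((cmod (F n t))\<^sup>2) + ennreal ((cmod (F n t - f t))\<^sup>2))"
      by (simp only: ennreal_mult ennreal_plus ennreal_numeral zero_le_power2 add_nonneg_nonneg zero_le_numeral)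
  qed
  also have "\<dots> = 2 * ((\<integral>\<^sup>+t. ennreal ((cmod (F n t))\<^sup>2) \<partial>lborel) + (\<integral>\<^sup>+t. ennreal ((cmod (F n t - f t))\<^sup>2) \<partial>lborel))"
    by (subst nn_integral_cmult, measurable, subst nn_integral_add) auto
  also have "\<dots> < top" using schwartz_square_finite[OF F, of n] order_less_trans[OF n ennreal_one_less_top]
    by (simp add: ennreal_mult_less_top)
  finally show ?thesis .
qed

lemma Cauchy_Schwarz_norm:
  fixes f g :: "real \<Rightarrow> complex"
  assumes [measurable]: "f \<in> borel_measurable borel" "g \<in> borel_measurable borel"
  shows "(\<integral>\<^sup>+t. ennreal (cmod (f t)) * ennreal (cmod (g t)) \<partial>lborel)\<^sup>2 \<le>
    (\<integral>\<^sup>+t. ennreal ((cmod (f t))\<^sup>2) \<partial>lborel) * (\<integral>\<^sup>+t. ennreal ((cmod (g t))\<^sup>2) \<partial>lborel)"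
  using Cauchy_Schwarz_nn_integral[of "\<lambda>t. ennreal (cmod (f t))" lborel "\<lambda>t. ennreal (cmod (g t))"]
  by (simp add: ennreal_power)

lemma L2_product_integrable:
  fixes f g :: "real \<Rightarrow> complex"
  assumes [measurable]: "f \<in> borel_measurable borel" "g \<in> borel_measurable borel"
    and fin: "(\<integral>\<^sup>+t. ennreal ((cmod (f t))\<^sup>2) \<partial>lborel) < top" "(\<integral>\<^sup>+t. ennreal ((cmod (g t))\<^sup>2) \<partial>lborel) < top"
  shows "integrable lborel (\<lambda>t. f t * g t)"
proof (rule integrableI_bounded)
  have "(\<integral>\<^sup>+t. ennreal (cmod (f t)) * ennreal (cmod (g t)) \<partial>lborel)\<^sup>2 < top"
    using le_less_trans[OF Cauchy_Schwarz_norm[of f g]] fin by (simp add: ennreal_mult_less_top)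
  then have "(\<integral>\<^sup>+t. ennreal (cmod (f t)) * ennreal (cmod (g t)) \<partial>lborel) < top"
    by (metis ennsqrt_power2 ennsqrt_top_iff less_top)
  then show "(\<integral>\<^sup>+t. ennreal (cmod (f t * g t)) \<partial>lborel) < \<infinity>"
    by (simp add: norm_mult ennreal_mult)
qed measurable

text \<open>The limits are only known to be square integrable, so \<open>ft f\<close> need not
  converge absolutely, but the product of \<open>f\<close> and \<open>g\<close> is integrable. The
  products of the approximants converge to it in L1, hence their transforms converge uniformly;
  \<open>r n\<close> is the L1 error and thus independent of \<open>\<theta>\<close>.\<close>

lemma ft_product_limit:
  assumes F: "\<And>n. schwartz (F n)" and G: "\<And>n. schwartz (G n)"
    and [measurable]: "f \<in> borel_measurable borel" "g \<in> borel_measurable borel"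
    and limF: "(\<lambda>n. \<integral>\<^sup>+t. ennreal ((cmod (F n t - f t))\<^sup>2) \<partial>lborel) \<longlonglongrightarrow> 0"
    and limG: "(\<lambda>n. \<integral>\<^sup>+t. ennreal ((cmod (G n t - g t))\<^sup>2) \<partial>lborel) \<longlonglongrightarrow> 0"
  shows "\<exists>r. r \<longlonglongrightarrow> 0 \<and> (\<forall>n \<theta>. ennreal (cmod (ft (\<lambda>t. f t * g t) \<theta>)) \<le>
    (\<integral>\<^sup>+s. ennreal (cmod (ft (F n) s)) * ennreal (cmod (ft (G n) (\<theta> - s))) \<partial>lborel) + r n)"
proof -
  have [measurable]: "F n \<in> borel_measurable borel" "G n \<in> borel_measurable borel" for n
    using schwartz_measurable F G by auto
  define a b where "a n = (\<integral>\<^sup>+t. ennreal ((cmod (F n t - f t))\<^sup>2) \<partial>lborel)"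
    and "b n = (\<integral>\<^sup>+t. ennreal ((cmod (G n t - g t))\<^sup>2) \<partial>lborel)" for n
  define A B where "A = (\<integral>\<^sup>+t. ennreal ((cmod (f t))\<^sup>2) \<partial>lborel)" and "B = (\<integral>\<^sup>+t. ennreal ((cmod (g t))\<^sup>2) \<partial>lborel)"
  have lim: "a \<longlonglongrightarrow> 0" "b \<longlonglongrightarrow> 0" using limF limG by (simp_all add: a_def[abs_def] b_def[abs_def])
  have fin: "A < top" "B < top" unfolding A_def B_def using L2_limit_finite[OF F _ limF] L2_limit_finite[OF G _ limG] by simp_all
  define r where "r n = (\<integral>\<^sup>+t. ennreal (cmod (f t * g t - F n t * G n t)) \<partial>lborel)" for n
  have r: "(r n)\<^sup>2 \<le> 3 * (a n * B + a n * b n + A * b n)" for n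
  proof -
    \<comment> \<open>Expanded in the limits and the differences alone, so that every term contains
      a factor tending to \<open>0\<close> in L2.\<close>
    have pw: "cmod (f t * g t - F n t * G n t) \<le> cmod (F n t - f t) * cmod (g t) + cmod (F n t - f t) * cmod (G n t - g t) + cmod (f t) * cmod (G n t - g t)" for t
    proof -
      have "f t * g t - F n t * G n t = - ((F n t - f t) * g t + (F n t - f t) * (G n t - g t) + f t * (G n t - g t))"
        by (simp add: algebra_simps)
      then have "cmod (f t * g t - F n t * G n t) = cmod ((F n t - f t) * g t + (F n t - f t) * (G n t - g t) + f t * (G n t - g t))"
        by (simp only: norm_minus_cancel)
      also have "\<dots> \<le> cmod ((F n t - f t) * g t) + cmod ((F n t - f t) * (G n t - g t)) + cmod (f t * (G n t - g t))"
        by (intro order_trans[OF norm_triangle_ineq] add_right_mono norm_triangle_ineq)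
      finally show ?thesis by (simp only: norm_mult)
    qed
    have "r n \<le> (\<integral>\<^sup>+t. ennreal (cmod (F n t - f t)) * ennreal (cmod (g t)) + ennreal (cmod (F n t - f t)) * ennreal (cmod (G n t - g t))
        + ennreal (cmod (f t)) * ennreal (cmod (G n t - g t)) \<partial>lborel)"
      unfolding r_def using pw
      by (intro nn_integral_mono) (simp add: ennreal_mult[symmetric] ennreal_plus[symmetric] ennreal_leI del: ennreal_plus)
    also have "\<dots> = (\<integral>\<^sup>+t. ennreal (cmod (F n t - f t)) * ennreal (cmod (g t)) \<partial>lborel)
       + (\<integral>\<^sup>+t. ennreal (cmod (F n t - f t)) * ennreal (cmod (G n t - g t)) \<partial>lborel)
       + (\<integral>\<^sup>+t. ennreal (cmod (f t)) * ennreal (cmod (G n t - g t)) \<partial>lborel)"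
      by (simp add: nn_integral_add)
    finally have "(r n)\<^sup>2 \<le> 3 * ((\<integral>\<^sup>+t. ennreal (cmod (F n t - f t)) * ennreal (cmod (g t)) \<partial>lborel)\<^sup>2
       + (\<integral>\<^sup>+t. ennreal (cmod (F n t - f t)) * ennreal (cmod (G n t - g t)) \<partial>lborel)\<^sup>2
       + (\<integral>\<^sup>+t. ennreal (cmod (f t)) * ennreal (cmod (G n t - g t)) \<partial>lborel)\<^sup>2)"
      by (rule order_trans[OF power_mono ennreal_sum3_square_le]) simp
    also have "\<dots> \<le> 3 * (a n * B + a n * b n + A * b n)"
      unfolding a_def b_def A_def B_def by (intro mult_left_mono add_mono Cauchy_Schwarz_norm) auto
    finally show ?thesis .
  qed
  have "(\<lambda>n. 3 * (a n * B + a n * b n + A * b n)) \<longlonglongrightarrow> 3 * (0 + 0 + 0)"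
  proof (intro ennreal_tendsto_cmult tendsto_add)
    show "(\<lambda>n. a n * B) \<longlonglongrightarrow> 0"
      using ennreal_tendsto_cmult[OF fin(2) lim(1)] by (simp add: mult.commute)
    show "(\<lambda>n. A * b n) \<longlonglongrightarrow> 0"
      using ennreal_tendsto_cmult[OF fin(1) lim(2)] by simp
    have "eventually (\<lambda>n. b n < 1) sequentially" using order_tendstoD(2)[OF lim(2), of 1] by simp
    then have "eventually (\<lambda>n. a n * b n \<le> a n) sequentially"
      by eventually_elim (metis less_imp_le mult.right_neutral mult_left_mono zero_le)
    then show "(\<lambda>n. a n * b n) \<longlonglongrightarrow> 0"
      by (intro tendsto_sandwich[OF _ _ tendsto_const lim(1)]) auto
  qed simp
  then have "(\<lambda>n. (r n)\<^sup>2) \<longlonglongrightarrow> 0"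
    by (intro tendsto_sandwich[OF _ always_eventually[OF allI[OF r]] tendsto_const]) auto
  then have r0: "r \<longlonglongrightarrow> 0" by (rule ennreal_square_tendsto_0)
  have ifg: "integrable lborel (\<lambda>t. f t * g t)"
    using fin by (intro L2_product_integrable) (simp_all add: A_def B_def)
  have iFG: "integrable lborel (\<lambda>t. F n t * G n t)" for n
    by (intro L2_product_integrable schwartz_square_finite F G) measurable
  have "ennreal (cmod (ft (\<lambda>t. f t * g t) \<theta>)) \<le>
    (\<integral>\<^sup>+s. ennreal (cmod (ft (F n) s)) * ennreal (cmod (ft (G n) (\<theta> - s))) \<partial>lborel) + r n" for n \<theta>
  proof -
    let ?d = "\<lambda>t. f t * g t - F n t * G n t"
    have "ft (\<lambda>t. f t * g t) \<theta> = ft (\<lambda>t. F n t * G n t) \<theta> + ft ?d \<theta>"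
      using integrable_modulated[OF ifg, of \<theta>] integrable_modulated[OF iFG[of n], of \<theta>]
      unfolding ft_def by (simp add: right_diff_distrib)
    then have "cmod (ft (\<lambda>t. f t * g t) \<theta>) \<le> cmod (ft (\<lambda>t. F n t * G n t) \<theta>) + cmod (ft ?d \<theta>)"
      by (simp add: norm_triangle_ineq)
    then have "ennreal (cmod (ft (\<lambda>t. f t * g t) \<theta>)) \<le> ennreal (cmod (ft (\<lambda>t. F n t * G n t) \<theta>)) + ennreal (cmod (ft ?d \<theta>))"
      by (simp add: ennreal_plus[symmetric] ennreal_leI del: ennreal_plus)
    also have "\<dots> \<le> (\<integral>\<^sup>+s. ennreal (cmod (ft (F n) s)) * ennreal (cmod (ft (G n) (\<theta> - s))) \<partial>lborel) + r n"
    proof (rule add_mono)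
      have "integrable lborel ?d" using ifg iFG by (intro Bochner_Integration.integrable_diff)
      from integral_norm_bound_ennreal[OF integrable_modulated[OF this, of \<theta>]]
      show "ennreal (cmod (ft ?d \<theta>)) \<le> r n" unfolding ft_def r_def by (simp add: norm_mult)
    qed (rule ft_product_bound[OF F G])
    finally show ?thesis .
  qed
  with r0 show ?thesis by blast
qed

lemma dft_L2_limit:
  assumes N: "N > 0" and mes: "\<forall>x\<in>grid N. (\<lambda>t. u t x) \<in> borel_measurable borel" and sch: "\<And>n. \<forall>x\<in>grid N. schwartz (\<lambda>t. \<phi> n t x)"
    and lim: "\<forall>x\<in>grid N. (\<lambda>n. \<integral>\<^sup>+t. ennreal ((cmod (\<phi> n t x - u t x))\<^sup>2) \<partial>lborel) \<longlonglongrightarrow> 0"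
  shows "(\<lambda>n. \<integral>\<^sup>+t. ennreal ((cmod (dft N (\<phi> n t) k - dft N (u t) k))\<^sup>2) \<partial>lborel) \<longlonglongrightarrow> 0"
proof -
  define c where "c = (mesh N / (2 * pi))\<^sup>2 * card (grid N)"
  have c: "0 \<le> c" by (simp add: c_def)
  have [measurable]: "x \<in> grid N \<Longrightarrow> (\<lambda>t. u t x) \<in> borel_measurable borel" for x using mes by auto
  have [measurable]: "x \<in> grid N \<Longrightarrow> (\<lambda>t. \<phi> n t x) \<in> borel_measurable borel" for x n
    using sch schwartz_measurable by blast
  have pw: "(cmod (dft N (\<phi> n t) k - dft N (u t) k))\<^sup>2 \<le> c * (\<Sum>x\<in>grid N. (cmod (\<phi> n t x - u t x))\<^sup>2)" for n t
  proof -
    have n1: "norm (exp (- (\<i> * complex_of_real x * of_int k))) = 1" for x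
      using norm_exp_imaginary(1)[of x "of_int k"] by simp
    have "dft N (\<phi> n t) k - dft N (u t) k = of_real (mesh N / (2 * pi)) *
        (\<Sum>x\<in>grid N. exp (- (\<i> * of_real x * of_int k)) * (\<phi> n t x - u t x))"
      unfolding dft_def by (simp only: right_diff_distrib sum_subtractf)
    also have "cmod \<dots> \<le> mesh N / (2 * pi) * (\<Sum>x\<in>grid N. cmod (\<phi> n t x - u t x))"
      using mesh_pos[OF N] unfolding norm_mult
      by (intro mult_mono sum_norm_le) (auto simp: norm_mult norm_divide n1)
    finally have "(cmod (dft N (\<phi> n t) k - dft N (u t) k))\<^sup>2 \<le> (mesh N / (2 * pi) * (\<Sum>x\<in>grid N. cmod (\<phi> n t x - u t x)))\<^sup>2"
      by (intro power_mono) auto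
    also have "\<dots> \<le> (mesh N / (2 * pi))\<^sup>2 * ((\<Sum>x\<in>grid N. (cmod (\<phi> n t x - u t x))\<^sup>2) * card (grid N))"
      unfolding power_mult_distrib by (intro mult_left_mono sum_squared_le_sum_of_squares) auto
    finally show ?thesis by (simp add: c_def mult_ac)
  qed
  have le: "(\<integral>\<^sup>+t. ennreal ((cmod (dft N (\<phi> n t) k - dft N (u t) k))\<^sup>2) \<partial>lborel)
     \<le> ennreal c * (\<Sum>x\<in>grid N. \<integral>\<^sup>+t. ennreal ((cmod (\<phi> n t x - u t x))\<^sup>2) \<partial>lborel)" for n
  proof -
    have "(\<integral>\<^sup>+t. ennreal ((cmod (dft N (\<phi> n t) k - dft N (u t) k))\<^sup>2) \<partial>lborel)
      \<le> (\<integral>\<^sup>+t. ennreal c * (\<Sum>x\<in>grid N. ennreal ((cmod (\<phi> n t x - u t x))\<^sup>2)) \<partial>lborel)"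
      using pw c by (intro nn_integral_mono) (simp add: ennreal_mult[symmetric] sum_nonneg ennreal_leI)
    also have "\<dots> = ennreal c * (\<Sum>x\<in>grid N. \<integral>\<^sup>+t. ennreal ((cmod (\<phi> n t x - u t x))\<^sup>2) \<partial>lborel)"
      by (subst nn_integral_cmult, measurable, subst nn_integral_sum) auto
    finally show ?thesis .
  qed
  have "(\<lambda>n. ennreal c * (\<Sum>x\<in>grid N. \<integral>\<^sup>+t. ennreal ((cmod (\<phi> n t x - u t x))\<^sup>2) \<partial>lborel)) \<longlonglongrightarrow> ennreal c * (\<Sum>x\<in>grid N. 0)"
    using lim by (intro ennreal_tendsto_cmult tendsto_sum) auto
  then show ?thesis
    by (intro tendsto_sandwich[OF _ always_eventually[OF allI[OF le]] tendsto_const]) auto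
qed

section \<open>The nonlinear estimate\<close>

lemma integrable_unimodular:
  fixes f e :: "real \<Rightarrow> complex"
  assumes "integrable lborel f" and [measurable]: "e \<in> borel_measurable borel" and "\<And>t. norm (e t) = 1"
  shows "integrable lborel (\<lambda>t. e t * f t)"
  by (rule Bochner_Integration.integrable_bound[OF assms(1)]) (use assms in \<open>auto simp: norm_mult\<close>)

lemma X_approxD:
  assumes "X_approx N \<sigma> s b \<phi> u"
  shows "\<forall>x\<in>grid N. schwartz (\<lambda>t. \<phi> n t x)" and "\<forall>x\<in>grid N. (\<lambda>t. u t x) \<in> borel_measurable borel"
    and "\<forall>x\<in>grid N. (\<lambda>n. \<integral>\<^sup>+t. ennreal ((cmod (\<phi> n t x - u t x))\<^sup>2) \<partial>lborel) \<longlonglongrightarrow> 0"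
  using assms unfolding X_approx_def by auto

lemma X_approx_dft:
  assumes N: "N > 0" and ap: "X_approx N \<sigma> s b \<phi> u"
  shows "schwartz (\<lambda>t. dft N (\<phi> n t) k)" and "(\<lambda>t. dft N (u t) k) \<in> borel_measurable borel"
    and "(\<lambda>n. \<integral>\<^sup>+t. ennreal ((cmod (dft N (\<phi> n t) k - dft N (u t) k))\<^sup>2) \<partial>lborel) \<longlonglongrightarrow> 0"
proof -
  show "schwartz (\<lambda>t. dft N (\<phi> n t) k)" by (rule dft_schwartz) (rule X_approxD(1)[OF ap])
  show "(\<lambda>t. dft N (u t) k) \<in> borel_measurable borel"
    unfolding dft_def using X_approxD(2)[OF ap] by (intro borel_measurable_times borel_measurable_sum) auto
  show "(\<lambda>n. \<integral>\<^sup>+t. ennreal ((cmod (dft N (\<phi> n t) k - dft N (u t) k))\<^sup>2) \<partial>lborel) \<longlonglongrightarrow> 0"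
    by (rule dft_L2_limit[OF N X_approxD(2)[OF ap] X_approxD(1)[OF ap] X_approxD(3)[OF ap]])
qed

definition nonlin :: "nat \<Rightarrow> real \<Rightarrow> (real \<Rightarrow> real \<Rightarrow> complex) \<Rightarrow> (real \<Rightarrow> real \<Rightarrow> complex) \<Rightarrow> real \<Rightarrow> real \<Rightarrow> complex"
  where "nonlin N \<sigma> u v = (\<lambda>t. nabla_h N (\<lambda>x. u t x * exp_partial_h N (\<sigma> * (2 * t / (mesh N)\<^sup>2)) (v t) x))"

text \<open>At frequency \<open>j\<close> the propagator multiplies by
  \<open>exp (\<i> * t * 2 * \<sigma> * j / h\<^sup>2)\<close>, which shifts the time frequency. The
  sum over triads represents the integrand only for almost every \<open>t\<close>, as mean zero
  holds only there; integrability is therefore read off the full sum \<open>P_eq\<close>.\<close>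

lemma st_fourier_nonlin:
  assumes N: "N > 0" and apu: "X_approx N \<sigma>1 s1 b1 \<phi> u" and apv: "X_approx N \<sigma>2 s2 b2 \<psi> v"
    and mz: "mean_zero N u" "mean_zero N v" and k: "k \<in> freqs N"
  shows "st_fourier N (nonlin N \<sigma> u v) \<tau> k = nabla_symbol N k * (\<Sum>i\<in>{i\<in>triads N. snd (snd i) = k}.
      ft (\<lambda>t. dft N (u t) (fst i) * dft N (v t) (fst (snd i))) (\<tau> - 2 * \<sigma> * of_int (fst (snd i)) / (mesh N)\<^sup>2))" (is ?eq)
    and "(\<lambda>\<tau>. st_fourier N (nonlin N \<sigma> u v) \<tau> k) \<in> borel_measurable borel" (is ?meas)
proof -
  let ?U = "\<lambda>j t. dft N (u t) j" and ?V = "\<lambda>j t. dft N (v t) j"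
  let ?I = "{i\<in>triads N. snd (snd i) = k}"
  define m where "m t j = exp (of_real (\<sigma> * (2 * t / (mesh N)\<^sup>2)) * partial_symbol j)" for t j
  have m_eq: "m t j = exp (\<i> * of_real t * of_real (2 * \<sigma> * of_int j / (mesh N)\<^sup>2))" for t j
    by (simp add: m_def partial_symbol_def algebra_simps)
  have mn: "norm (m t j) = 1" for t j unfolding m_eq by (rule norm_exp_imaginary(2))
  have [measurable]: "(\<lambda>t. m t j) \<in> borel_measurable borel" for j unfolding m_eq by measurable
  have [measurable]: "?U j \<in> borel_measurable borel" "?V j \<in> borel_measurable borel" for j
    using X_approx_dft(2)[OF N apu] X_approx_dft(2)[OF N apv] by auto
  have UV: "integrable lborel (\<lambda>t. ?U i t * ?V j t)" for i j
    by (intro L2_product_integrable L2_limit_finite[OF X_approx_dft(1)[OF N apu] _ X_approx_dft(3)[OF N apu]]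
        L2_limit_finite[OF X_approx_dft(1)[OF N apv] _ X_approx_dft(3)[OF N apv]]) measurable
  define P where "P t l = dft N (\<lambda>x. u t x * fourier_multiplier N (m t) (v t) x) l" for t l
  have P_eq: "P t l = (\<Sum>j\<in>freqs N. m t j * (?U (l - j) t * ?V j t))" for t l
    unfolding P_def dft_product by (simp add: mult_ac)
  have iP: "integrable lborel (\<lambda>t. P t l)" for l
    unfolding P_eq by (intro Bochner_Integration.integrable_sum integrable_unimodular UV mn) measurable
  have w_eq: "nonlin N \<sigma> u v t = fourier_multiplier N (nabla_symbol N) (\<lambda>x. u t x * fourier_multiplier N (m t) (v t) x)" for t
    unfolding nonlin_def nabla_h_def exp_partial_h_def m_def ..
  have w_sum: "nonlin N \<sigma> u v t x = (\<Sum>l\<in>freqs N. nabla_symbol N l * exp (\<i> * of_real x * of_int l) * P t l)" for t x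
    unfolding w_eq fourier_multiplier_def[of N "nabla_symbol N"] P_def by (simp add: mult_ac)
  have iw: "\<forall>x\<in>grid N. integrable lborel (\<lambda>t. nonlin N \<sigma> u v t x)"
    unfolding w_sum by (intro ballI Bochner_Integration.integrable_sum integrable_mult_right iP)
  have dw: "dft N (nonlin N \<sigma> u v t) k = nabla_symbol N k * P t k" for t
    unfolding w_eq P_def by (rule dft_multiplier[OF N k])
  have st: "st_fourier N (nonlin N \<sigma> u v) \<tau> k = ft (\<lambda>t. nabla_symbol N k * P t k) \<tau>" for \<tau>
    unfolding st_fourier_eq_ft[OF iw] dw ..
  have [measurable]: "(\<lambda>t. P t k) \<in> borel_measurable borel" using iP[of k] by auto
  have "ft (\<lambda>t. nabla_symbol N k * P t k) \<in> borel_measurable borel" by measurable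
  then show ?meas unfolding st .
  have ae: "AE t in lborel. P t k = (\<Sum>i\<in>?I. m t (fst (snd i)) * (?U (fst i) t * ?V (fst (snd i)) t))"
    using mz unfolding mean_zero_def
  proof eventually_elim
    case (elim t)
    then show ?case unfolding P_def by (intro dft_product_triads[OF N k])
  qed
  let ?e = "\<lambda>t. exp (- (\<i> * complex_of_real t * complex_of_real \<tau>))"
  have "ft (\<lambda>t. nabla_symbol N k * P t k) \<tau> = nabla_symbol N k * (\<integral>t. ?e t * P t k \<partial>lborel)"
    unfolding ft_def by (subst integral_mult_right_zero[symmetric]) (simp add: mult.left_commute)
  also have "(\<integral>t. ?e t * P t k \<partial>lborel) = (\<integral>t. (\<Sum>i\<in>?I. ?e t * (m t (fst (snd i)) * (?U (fst i) t * ?V (fst (snd i)) t))) \<partial>lborel)"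
    using ae by (intro integral_cong_AE) (auto simp: sum_distrib_left)
  also have "\<dots> = (\<Sum>i\<in>?I. \<integral>t. ?e t * (m t (fst (snd i)) * (?U (fst i) t * ?V (fst (snd i)) t)) \<partial>lborel)"
    by (intro Bochner_Integration.integral_sum integrable_modulated integrable_unimodular UV mn) measurable
  also have "\<dots> = (\<Sum>i\<in>?I. ft (\<lambda>t. ?U (fst i) t * ?V (fst (snd i)) t) (\<tau> - 2 * \<sigma> * of_int (fst (snd i)) / (mesh N)\<^sup>2))"
  proof (intro sum.cong refl)
    fix i :: "int \<times> int \<times> int"
    have "?e t * m t (fst (snd i)) = exp (- (\<i> * of_real t * of_real (\<tau> - 2 * \<sigma> * of_int (fst (snd i)) / (mesh N)\<^sup>2)))" for t
      unfolding m_eq exp_add[symmetric] by (rule arg_cong[where f = exp]) (simp add: algebra_simps)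
    then show "(\<integral>t. ?e t * (m t (fst (snd i)) * (?U (fst i) t * ?V (fst (snd i)) t)) \<partial>lborel) =
      ft (\<lambda>t. ?U (fst i) t * ?V (fst (snd i)) t) (\<tau> - 2 * \<sigma> * of_int (fst (snd i)) / (mesh N)\<^sup>2)"
      unfolding ft_def by (simp only: mult.assoc[symmetric])
  qed
  finally show ?eq unfolding st .
qed

text \<open>The substitution \<open>\<xi> = y + \<sigma> * disp N k1\<close> makes the integration
  variable the modulation of the first input. What remains of the dispersions and of the propagator
  shift is exactly \<open>\<sigma> * resonance N i\<close>, with the second modulation taken for the
  opposite sign.\<close>

lemma triad_convolution_bound:
  assumes s: "0 \<le> s" "s \<le> s'" "s' \<le> s + 1" and N: "N > 0"
    and sch: "\<forall>x\<in>grid N. schwartz (\<lambda>t. \<phi> t x)" "\<forall>x\<in>grid N. schwartz (\<lambda>t. \<psi> t x)" and i: "i \<in> triads N" "snd (snd i) = k"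
  shows "ennreal (jbr (of_int k) powr s * cmod (nabla_symbol N k)) *
     (\<integral>\<^sup>+\<xi>. ennreal (cmod (ft (\<lambda>t. dft N (\<phi> t) (fst i)) \<xi>)) *
       ennreal (cmod (ft (\<lambda>t. dft N (\<psi> t) (fst (snd i))) (x + \<sigma> * disp N k - 2 * \<sigma> * of_int (fst (snd i)) / (mesh N)\<^sup>2 - \<xi>))) \<partial>lborel)
   \<le> ennreal (2 powr (s' + 1) * mesh N powr (s' - s)) * (\<integral>\<^sup>+y.
    ennreal (1 / mesh N * jbr y powr (-(1/2)) * jbr (x - y - \<sigma> * resonance N i) powr (-(1/2))) *
      (xdens N \<sigma> s' (1/2) \<phi> (fst i) y * xdens N (-\<sigma>) s' (1/2) \<psi> (fst (snd i)) (x - y - \<sigma> * resonance N i)) \<partial>lborel)"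
proof -
  obtain k1 k2 where ik: "i = (k1, k2, k)" using i(2) by (cases i) auto
  define A B where "A \<xi> = cmod (ft (\<lambda>t. dft N (\<phi> t) k1) \<xi>)" and "B \<xi> = cmod (ft (\<lambda>t. dft N (\<psi> t) k2) \<xi>)" for \<xi>
  define \<theta> where "\<theta> = x + \<sigma> * disp N k - 2 * \<sigma> * of_int k2 / (mesh N)\<^sup>2"
  have [measurable]: "ft (\<lambda>t. dft N (\<phi> t) k1) \<in> borel_measurable borel" "ft (\<lambda>t. dft N (\<psi> t) k2) \<in> borel_measurable borel"
    by (intro ft_measurable schwartz_measurable dft_schwartz sch)+
  have [measurable]: "A \<in> borel_measurable borel" "B \<in> borel_measurable borel"
    unfolding A_def[abs_def] B_def[abs_def] by measurable
  have h: "mesh N > 0" by (rule mesh_pos[OF N])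
  let ?z = "\<lambda>y. x - y - \<sigma> * resonance N i"
  let ?W = "jbr (of_int k) powr s * cmod (nabla_symbol N k)"
  let ?c = "2 powr (s' + 1) * mesh N powr (s' - s)"
  have arg: "\<theta> - (y + \<sigma> * disp N k1) = ?z y + (- \<sigma>) * disp N k2" for y
    by (simp add: \<theta>_def resonance_def ik algebra_simps)
  have "ennreal ?W * (\<integral>\<^sup>+\<xi>. ennreal (A \<xi>) * ennreal (B (\<theta> - \<xi>)) \<partial>lborel)
     = ennreal ?W * (\<integral>\<^sup>+y. ennreal (A (y + \<sigma> * disp N k1)) * ennreal (B (\<theta> - (y + \<sigma> * disp N k1))) \<partial>lborel)"
    by (subst nn_integral_shift[of "\<lambda>\<xi>. ennreal (A \<xi>) * ennreal (B (\<theta> - \<xi>))"]) auto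
  also have "\<dots> = (\<integral>\<^sup>+y. ennreal ?W * (ennreal (A (y + \<sigma> * disp N k1)) * ennreal (B (?z y + (- \<sigma>) * disp N k2))) \<partial>lborel)"
    unfolding arg by (rule nn_integral_cmult[symmetric]) measurable
  also have "\<dots> \<le> (\<integral>\<^sup>+y. ennreal ?c * (ennreal (1 / mesh N * jbr y powr (-(1/2)) * jbr (?z y) powr (-(1/2))) *
      (xdens N \<sigma> s' (1/2) \<phi> k1 y * xdens N (-\<sigma>) s' (1/2) \<psi> k2 (?z y))) \<partial>lborel)"
  proof (rule nn_integral_mono)
    fix y
    let ?A = "A (y + \<sigma> * disp N k1)" and ?B = "B (?z y + (- \<sigma>) * disp N k2)"
    have AB: "0 \<le> ?A" "0 \<le> ?B" by (simp_all add: A_def B_def)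
    have one: "jbr a powr (-(1/2)) * jbr a powr (1/2) = 1" for a
    proof -
      have "jbr a powr (-(1/2)) * jbr a powr (1/2) = jbr a powr (-(1/2) + 1/2)" by (rule powr_add[symmetric])
      then show ?thesis using jbr_pos[of a] by simp
    qed
    have "?W * (?A * ?B) \<le> ?c * (1 / mesh N * (jbr (of_int k1) powr s' * jbr (of_int k2) powr s')) * (?A * ?B)"
      using symbol_weight_bound[OF s N, of k1 k2 k] i ik AB by (intro mult_right_mono) auto
    \<comment> \<open>A factor \<open>1\<close>, written with opposite bracket powers, completes the
      densities \<open>xdens\<close> and leaves the kernel of \<open>bilin\<close>.\<close>
    also have "\<dots> = ?c * (1 / mesh N * (jbr (of_int k1) powr s' * jbr (of_int k2) powr s')) * (?A * ?B) *
        ((jbr y powr (-(1/2)) * jbr y powr (1/2)) * (jbr (?z y) powr (-(1/2)) * jbr (?z y) powr (1/2)))"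
      by (simp only: one mult_1_right)
    also have "\<dots> = ?c * ((1 / mesh N * jbr y powr (-(1/2)) * jbr (?z y) powr (-(1/2))) *
       ((jbr (of_int k1) powr s' * jbr y powr (1/2) * ?A) * (jbr (of_int k2) powr s' * jbr (?z y) powr (1/2) * ?B)))"
      by (simp only: mult_ac)
    finally have le: "ennreal (?W * (?A * ?B)) \<le> ennreal \<dots>" by (rule ennreal_leI)
    have "xdens N \<sigma> s' (1/2) \<phi> k1 y = ennreal (jbr (of_int k1) powr s' * jbr y powr (1/2) * ?A)"
      "xdens N (-\<sigma>) s' (1/2) \<psi> k2 (?z y) = ennreal (jbr (of_int k2) powr s' * jbr (?z y) powr (1/2) * ?B)"
      unfolding xdens_def A_def B_def st_fourier_schwartz[where u = \<phi> and N = N, OF sch(1)] st_fourier_schwartz[where u = \<psi> and N = N, OF sch(2)]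
      by simp_all
    then show "ennreal ?W * (ennreal ?A * ennreal ?B) \<le> ennreal ?c * (ennreal (1 / mesh N * jbr y powr (-(1/2)) * jbr (?z y) powr (-(1/2))) *
      (xdens N \<sigma> s' (1/2) \<phi> k1 y * xdens N (-\<sigma>) s' (1/2) \<psi> k2 (?z y)))"
      using le AB h by (simp only: ennreal_mult[symmetric] mult_nonneg_nonneg powr_ge_zero norm_ge_zero zero_le_divide_iff zero_le_one less_imp_le zero_le_numeral simp_thms)
  qed
  also have "\<dots> = ennreal ?c * (\<integral>\<^sup>+y. ennreal (1 / mesh N * jbr y powr (-(1/2)) * jbr (?z y) powr (-(1/2))) *
      (xdens N \<sigma> s' (1/2) \<phi> k1 y * xdens N (-\<sigma>) s' (1/2) \<psi> k2 (?z y)) \<partial>lborel)"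
  proof (rule nn_integral_cmult)
    have [measurable]: "xdens N \<sigma> s' (1/2) \<phi> k1 \<in> borel_measurable borel" "xdens N (-\<sigma>) s' (1/2) \<psi> k2 \<in> borel_measurable borel"
      using sch by (auto intro: xdens_measurable)
    show "(\<lambda>y. ennreal (1 / mesh N * jbr y powr (-(1/2)) * jbr (?z y) powr (-(1/2))) *
      (xdens N \<sigma> s' (1/2) \<phi> k1 y * xdens N (-\<sigma>) s' (1/2) \<psi> k2 (?z y))) \<in> borel_measurable lborel" by measurable
  qed
  finally show ?thesis by (simp add: ik A_def B_def \<theta>_def)
qed

text \<open>The errors from \<open>ft_product_limit\<close>, one sequence for each triad, add up to
  \<open>\<rho>\<close>, which tends to \<open>0\<close> because the fibre is finite. The factor
  \<open>c\<close> is free, to be \<open>jbr x powr (-(1/2))\<close> for the \<open>X\<close> part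
  of the norm and \<open>jbr x powr (-1)\<close> for the L1 part.\<close>

lemma nonlin_le_liminf:
  assumes s: "0 \<le> s" "s \<le> s'" "s' \<le> s + 1" and N: "N > 0"
    and apu: "X_approx N \<sigma> s' (1/2) \<phi> u" and apv: "X_approx N (-\<sigma>) s' (1/2) \<psi> v"
    and mz: "mean_zero N u" "mean_zero N v" and k: "k \<in> freqs N" and c: "0 \<le> c"
  shows "ennreal (c * (jbr (of_int k) powr s * cmod (st_fourier N (nonlin N \<sigma> u v) (x + \<sigma> * disp N k) k)))
    \<le> liminf (\<lambda>n. ennreal (2 powr (s' + 1) * mesh N powr (s' - s)) *
        (ennreal c * bilin N \<sigma> (xdens N \<sigma> s' (1/2) (\<phi> n)) (xdens N (-\<sigma>) s' (1/2) (\<psi> n)) k x))"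
proof -
  let ?I = "{i\<in>triads N. snd (snd i) = k}"
  let ?h = "\<lambda>i t. dft N (u t) (fst i) * dft N (v t) (fst (snd i))"
  let ?\<theta> = "\<lambda>i. x + \<sigma> * disp N k - 2 * \<sigma> * of_int (fst (snd i)) / (mesh N)\<^sup>2"
  let ?c = "\<lambda>n i. \<integral>\<^sup>+\<xi>. ennreal (cmod (ft (\<lambda>t. dft N (\<phi> n t) (fst i)) \<xi>)) *
       ennreal (cmod (ft (\<lambda>t. dft N (\<psi> n t) (fst (snd i))) (?\<theta> i - \<xi>))) \<partial>lborel"
  let ?W = "jbr (of_int k) powr s * cmod (nabla_symbol N k)"
  let ?\<kappa> = "2 powr (s' + 1) * mesh N powr (s' - s)"
  let ?F = "\<lambda>n. xdens N \<sigma> s' (1/2) (\<phi> n)" and ?G = "\<lambda>n. xdens N (-\<sigma>) s' (1/2) (\<psi> n)"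
  have "\<exists>r. r \<longlonglongrightarrow> 0 \<and> (\<forall>n. ennreal (cmod (ft (?h i) (?\<theta> i))) \<le> ?c n i + r n)" for i :: "int \<times> int \<times> int"
    using ft_product_limit[OF X_approx_dft(1)[OF N apu, of _ "fst i"] X_approx_dft(1)[OF N apv, of _ "fst (snd i)"]
      X_approx_dft(2)[OF N apu] X_approx_dft(2)[OF N apv] X_approx_dft(3)[OF N apu] X_approx_dft(3)[OF N apv]] by blast
  then have "\<forall>i :: int \<times> int \<times> int. \<exists>r. r \<longlonglongrightarrow> 0 \<and> (\<forall>n. ennreal (cmod (ft (?h i) (?\<theta> i))) \<le> ?c n i + r n)" by (rule allI)
  from choice[OF this] obtain r where
    rr: "\<forall>i :: int \<times> int \<times> int. r i \<longlonglongrightarrow> 0 \<and> (\<forall>n. ennreal (cmod (ft (?h i) (?\<theta> i))) \<le> ?c n i + r i n)" by blast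
  have r: "r i \<longlonglongrightarrow> 0" "ennreal (cmod (ft (?h i) (?\<theta> i))) \<le> ?c n i + r i n" for i n
    using spec[OF rr, of i] by (simp_all only: simp_thms)
  have fin: "finite ?I" using finite_triads by simp
  define \<rho> where "\<rho> n = ennreal c * (ennreal ?W * (\<Sum>i\<in>?I. r i n))" for n
  have "(\<lambda>n. ennreal c * (ennreal ?W * (\<Sum>i\<in>?I. r i n))) \<longlonglongrightarrow> ennreal c * (ennreal ?W * (\<Sum>i\<in>?I. 0))"
    by (intro ennreal_tendsto_cmult tendsto_sum r) auto
  then have \<rho>: "\<rho> \<longlonglongrightarrow> 0" by (simp add: \<rho>_def[abs_def])
  show ?thesis
  proof (rule le_liminf_perturbed[OF _ \<rho>])
    fix n
    note sch = X_approxD(1)[OF apu, of n] X_approxD(1)[OF apv, of n]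
    have "jbr (of_int k) powr s * cmod (st_fourier N (nonlin N \<sigma> u v) (x + \<sigma> * disp N k) k) = ?W * cmod (\<Sum>i\<in>?I. ft (?h i) (?\<theta> i))"
      unfolding st_fourier_nonlin(1)[OF N apu apv mz k] by (simp add: norm_mult mult.assoc)
    also have "\<dots> \<le> ?W * (\<Sum>i\<in>?I. cmod (ft (?h i) (?\<theta> i)))"
      by (intro mult_left_mono norm_sum) auto
    finally have "ennreal (c * (jbr (of_int k) powr s * cmod (st_fourier N (nonlin N \<sigma> u v) (x + \<sigma> * disp N k) k)))
      \<le> ennreal (c * (?W * (\<Sum>i\<in>?I. cmod (ft (?h i) (?\<theta> i)))))"
      using c by (intro ennreal_leI mult_left_mono) auto
    also have "\<dots> = ennreal c * (ennreal ?W * (\<Sum>i\<in>?I. ennreal (cmod (ft (?h i) (?\<theta> i)))))"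
      using c by (simp only: ennreal_mult' sum_ennreal norm_ge_zero mult_nonneg_nonneg powr_ge_zero)
    also have "\<dots> \<le> ennreal c * (ennreal ?W * (\<Sum>i\<in>?I. ?c n i + r i n))"
      by (intro mult_left_mono sum_mono r) auto
    also have "\<dots> = ennreal c * (\<Sum>i\<in>?I. ennreal ?W * ?c n i) + \<rho> n"
      by (simp only: sum.distrib distrib_left sum_distrib_left \<rho>_def)
    also have "\<dots> \<le> ennreal c * (\<Sum>i\<in>?I. ennreal ?\<kappa> * (\<integral>\<^sup>+y.
        ennreal (1 / mesh N * jbr y powr (-(1/2)) * jbr (x - y - \<sigma> * resonance N i) powr (-(1/2))) *
        (?F n (fst i) y * ?G n (fst (snd i)) (x - y - \<sigma> * resonance N i)) \<partial>lborel)) + \<rho> n"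
      by (intro add_right_mono mult_left_mono sum_mono triad_convolution_bound[OF s N sch]) auto
    also have "\<dots> = ennreal ?\<kappa> * (ennreal c * bilin N \<sigma> (?F n) (?G n) k x) + \<rho> n"
      unfolding bilin_def by (simp only: sum_distrib_left[symmetric] mult.left_commute)
    finally show "ennreal (c * (jbr (of_int k) powr s * cmod (st_fourier N (nonlin N \<sigma> u v) (x + \<sigma> * disp N k) k))) \<le> \<dots>" .
  qed simp
qed

lemma X_pre_square:
  assumes "\<forall>x\<in>grid N. schwartz (\<lambda>t. u t x)"
  shows "mass (freqs N) (xdens N \<sigma> s b u) = (X_pre N \<sigma> s b u)\<^sup>2"
  using X_pre_eq_mass[of N u, OF st_fourier_measurable[where u = u and N = N, OF assms]] by simp

lemma bilin_measurable:
  assumes [measurable]: "\<And>k. f k \<in> borel_measurable borel" "\<And>k. g k \<in> borel_measurable borel"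
  shows "bilin N \<sigma> f g k \<in> borel_measurable borel"
  unfolding bilin_def[abs_def] by measurable

theorem lemma4p8:
  fixes s s' :: real
  assumes "0 \<le> s" and "s \<le> s'" and "s' \<le> s + 1"
  shows "\<exists>C::real. C > 0 \<and> (\<forall>N::nat. N > 0 \<longrightarrow> mesh N \<le> 1 \<longrightarrow>
    (\<forall>\<sigma>\<in>{1, -1 :: real}.
      \<forall>u\<in>X_space N \<sigma> s' (1/2). \<forall>v\<in>X_space N (-\<sigma>) s' (1/2).
        mean_zero N u \<longrightarrow> mean_zero N v \<longrightarrow>
        Z_norm N \<sigma> s
          (\<lambda>t. nabla_h N (\<lambda>x. u t x * exp_partial_h N (\<sigma> * (2 * t / (mesh N)\<^sup>2)) (v t) x))
        \<le> ennreal (C * mesh N powr (s' - s)) *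
            X_norm N \<sigma> s' (1/2) u * X_norm N (-\<sigma>) s' (1/2) v))"
proof -
  obtain D where D: "D > 0" and est: "\<forall>N>0. mesh N \<le> 1 \<longrightarrow> (\<forall>\<sigma>\<in>{1, -1::real}. \<forall>f g.
     (\<forall>k. f k \<in> borel_measurable borel) \<longrightarrow> (\<forall>k. g k \<in> borel_measurable borel) \<longrightarrow>
     (\<Sum>k\<in>freqs N. \<integral>\<^sup>+x. (ennreal (jbr x powr (-(1/2))) * bilin N \<sigma> f g k x)\<^sup>2 \<partial>lborel)
        \<le> ennreal D * (mass (freqs N) f * mass (freqs N) g) \<and>
     (\<Sum>k\<in>freqs N. (\<integral>\<^sup>+x. ennreal (jbr x powr (-1)) * bilin N \<sigma> f g k x \<partial>lborel)\<^sup>2)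
        \<le> ennreal D * (mass (freqs N) f * mass (freqs N) g))"
    using bilinear_estimate by blast
  \<comment> \<open>The first \<open>2\<close> counts the two parts of the \<open>Z\<close> norm,
    \<open>2 powr (s' + 1)\<close> comes from \<open>symbol_weight_bound\<close>, and
    \<open>sqrt D\<close> from the squared bilinear estimate.\<close>
  define C where "C = 2 * (2 powr (s' + 1) * sqrt D)"
  show ?thesis
  proof (intro exI[of _ C] conjI allI impI ballI)
    show "C > 0" using D by (simp add: C_def)
    fix N :: nat and \<sigma> :: real and u v
    assume N: "N > 0" and h1: "mesh N \<le> 1" and \<sigma>: "\<sigma> \<in> {1, -1}"
      and u: "u \<in> X_space N \<sigma> s' (1/2)" and v: "v \<in> X_space N (-\<sigma>) s' (1/2)"
      and mz: "mean_zero N u" "mean_zero N v"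
    obtain \<phi> where apu: "X_approx N \<sigma> s' (1/2) \<phi> u" and limu: "(\<lambda>n. X_pre N \<sigma> s' (1/2) (\<phi> n)) \<longlonglongrightarrow> X_norm N \<sigma> s' (1/2) u"
      and finu: "X_norm N \<sigma> s' (1/2) u \<noteq> top" using X_norm_witness[OF u] by blast
    obtain \<psi> where apv: "X_approx N (-\<sigma>) s' (1/2) \<psi> v" and limv: "(\<lambda>n. X_pre N (-\<sigma>) s' (1/2) (\<psi> n)) \<longlonglongrightarrow> X_norm N (-\<sigma>) s' (1/2) v"
      and finv: "X_norm N (-\<sigma>) s' (1/2) v \<noteq> top" using X_norm_witness[OF v] by blast
    let ?F = "\<lambda>n. xdens N \<sigma> s' (1/2) (\<phi> n)" and ?G = "\<lambda>n. xdens N (-\<sigma>) s' (1/2) (\<psi> n)"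
    define \<kappa> where "\<kappa> = 2 powr (s' + 1) * mesh N powr (s' - s)"
    define a b where "a n = X_pre N \<sigma> s' (1/2) (\<phi> n)" and "b n = X_pre N (-\<sigma>) s' (1/2) (\<psi> n)" for n
    define xu xv where "xu = X_norm N \<sigma> s' (1/2) u" and "xv = X_norm N (-\<sigma>) s' (1/2) v"
    define w where "w = nonlin N \<sigma> u v"
    define M where "M = ennreal (\<kappa> * sqrt D) * xu * xv"
    have k0: "0 \<le> \<kappa>" by (simp add: \<kappa>_def)
    have finK: "finite (freqs N)" by (simp add: freqs_def)
    have mF[measurable]: "?F n k \<in> borel_measurable borel" and mG[measurable]: "?G n k \<in> borel_measurable borel" for n k
      using xdens_measurable X_approxD(1)[OF apu] X_approxD(1)[OF apv] by blast+
    have mB[measurable]: "bilin N \<sigma> (?F n) (?G n) k \<in> borel_measurable borel" for n k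
      by (intro bilin_measurable mF mG)
    have est1: "(\<Sum>k\<in>freqs N. \<integral>\<^sup>+x. (ennreal (jbr x powr (-(1/2))) * bilin N \<sigma> (?F n) (?G n) k x)\<^sup>2 \<partial>lborel) \<le> ennreal D * ((a n)\<^sup>2 * (b n)\<^sup>2)"
      and est2: "(\<Sum>k\<in>freqs N. (\<integral>\<^sup>+x. ennreal (jbr x powr (-1)) * bilin N \<sigma> (?F n) (?G n) k x \<partial>lborel)\<^sup>2) \<le> ennreal D * ((a n)\<^sup>2 * (b n)\<^sup>2)" for n
      using est[THEN spec, THEN mp, OF N, THEN mp, OF h1, THEN bspec, OF \<sigma>, THEN spec[of _ "?F n"],
          THEN spec[of _ "?G n"], THEN mp, OF allI[OF mF], THEN mp, OF allI[OF mG]]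
      unfolding X_pre_square[OF X_approxD(1)[OF apu]] X_pre_square[OF X_approxD(1)[OF apv]] a_def b_def by blast+
    \<comment> \<open>Multiplication in \<open>ennreal\<close> is not continuous at \<open>0\<close>
      times \<open>top\<close>. All norms involved are finite, so the limit is taken among real
      numbers.\<close>
    have lim: "liminf (\<lambda>n. (ennreal \<kappa>)\<^sup>2 * (ennreal D * ((a n)\<^sup>2 * (b n)\<^sup>2))) = M\<^sup>2"
    proof -
      have fin: "a n \<noteq> top" "b n \<noteq> top" for n
        unfolding a_def b_def using X_pre_finite X_approxD(1)[OF apu] X_approxD(1)[OF apv] by blast+
      define ar br where "ar n = enn2real (a n)" and "br n = enn2real (b n)" for n
      have ab: "a n = ennreal (ar n)" "b n = ennreal (br n)" for n
        using fin[of n] by (simp_all add: ar_def br_def less_top)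
      obtain xr where xr: "xu = ennreal xr" "0 \<le> xr" using finu unfolding xu_def[symmetric] by (cases xu) auto
      obtain yr where yr: "xv = ennreal yr" "0 \<le> yr" using finv unfolding xv_def[symmetric] by (cases xv) auto
      have "a \<longlonglongrightarrow> ennreal xr" "b \<longlonglongrightarrow> ennreal yr"
        using limu limv unfolding xu_def[symmetric] xv_def[symmetric] xr(1) yr(1) a_def[abs_def, symmetric] b_def[abs_def, symmetric]
        by simp_all
      then have "ar \<longlonglongrightarrow> xr" "br \<longlonglongrightarrow> yr" unfolding ar_def[abs_def] br_def[abs_def] using xr yr by (auto intro: tendsto_enn2real)
      then have "(\<lambda>n. \<kappa>\<^sup>2 * (D * ((ar n)\<^sup>2 * (br n)\<^sup>2))) \<longlonglongrightarrow> \<kappa>\<^sup>2 * (D * (xr\<^sup>2 * yr\<^sup>2))"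
        by (intro tendsto_intros)
      then have "(\<lambda>n. ennreal (\<kappa>\<^sup>2 * (D * ((ar n)\<^sup>2 * (br n)\<^sup>2)))) \<longlonglongrightarrow> ennreal (\<kappa>\<^sup>2 * (D * (xr\<^sup>2 * yr\<^sup>2)))"
        by (rule tendsto_ennrealI)
      moreover have "ennreal (\<kappa>\<^sup>2 * (D * ((ar n)\<^sup>2 * (br n)\<^sup>2))) = (ennreal \<kappa>)\<^sup>2 * (ennreal D * ((a n)\<^sup>2 * (b n)\<^sup>2))" for n
        using k0 D unfolding ab by (simp add: ennreal_power ennreal_mult ar_def br_def)
      moreover have "ennreal (\<kappa>\<^sup>2 * (D * (xr\<^sup>2 * yr\<^sup>2))) = M\<^sup>2"
      proof -
        have "M = ennreal (\<kappa> * sqrt D * xr * yr)" using k0 D xr yr by (simp add: M_def ennreal_mult)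
        then have "M\<^sup>2 = ennreal ((\<kappa> * sqrt D * xr * yr)\<^sup>2)" using k0 D xr yr by (simp add: ennreal_power)
        then show ?thesis using D by (simp add: power_mult_distrib mult_ac)
      qed
      ultimately have "(\<lambda>n. (ennreal \<kappa>)\<^sup>2 * (ennreal D * ((a n)\<^sup>2 * (b n)\<^sup>2))) \<longlonglongrightarrow> M\<^sup>2" by simp
      then show ?thesis by (intro lim_imp_Liminf) auto
    qed
    have pt: "ennreal (c * (jbr (of_int k) powr s * cmod (st_fourier N w (x + \<sigma> * disp N k) k)))
       \<le> liminf (\<lambda>n. ennreal \<kappa> * (ennreal c * bilin N \<sigma> (?F n) (?G n) k x))" if "k \<in> freqs N" "0 \<le> c" for k x c
      unfolding w_def \<kappa>_def by (rule nonlin_le_liminf[OF assms N apu apv mz that])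
    have wm: "(\<lambda>\<tau>. st_fourier N w \<tau> k) \<in> borel_measurable borel" if "k \<in> freqs N" for k
      unfolding w_def by (rule st_fourier_nonlin(2)[OF N apu apv mz that])
    have Xeq: "X_pre N \<sigma> s (-1/2) w = ennsqrt (mass (freqs N) (xdens N \<sigma> s (-1/2) w))"
      by (rule X_pre_eq_mass) (rule wm)
    have X: "X_pre N \<sigma> s (-1/2) w \<le> M"
      unfolding Xeq
    proof (rule ennsqrt_le)
      have "mass (freqs N) (xdens N \<sigma> s (-1/2) w) \<le> (\<Sum>k\<in>freqs N. \<integral>\<^sup>+x. liminf (\<lambda>n. (ennreal \<kappa> * (ennreal (jbr x powr (-(1/2))) * bilin N \<sigma> (?F n) (?G n) k x))\<^sup>2) \<partial>lborel)"
        unfolding mass_def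
      proof (intro sum_mono nn_integral_mono le_liminf_square)
        fix k x assume "k \<in> freqs N"
        from pt[OF this, of "jbr x powr (-(1/2))" x]
        show "xdens N \<sigma> s (-1/2) w k x \<le> liminf (\<lambda>n. ennreal \<kappa> * (ennreal (jbr x powr (-(1/2))) * bilin N \<sigma> (?F n) (?G n) k x))"
          unfolding xdens_def by (simp add: mult_ac)
      qed
      \<comment> \<open>Fatou's lemma, here for the integral and in the next step for the finite sum
        over frequencies.\<close>
      also have "\<dots> \<le> (\<Sum>k\<in>freqs N. liminf (\<lambda>n. \<integral>\<^sup>+x. (ennreal \<kappa> * (ennreal (jbr x powr (-(1/2))) * bilin N \<sigma> (?F n) (?G n) k x))\<^sup>2 \<partial>lborel))"
        by (intro sum_mono nn_integral_liminf) measurable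
      also have "\<dots> \<le> liminf (\<lambda>n. \<Sum>k\<in>freqs N. \<integral>\<^sup>+x. (ennreal \<kappa> * (ennreal (jbr x powr (-(1/2))) * bilin N \<sigma> (?F n) (?G n) k x))\<^sup>2 \<partial>lborel)"
        by (rule sum_liminf_le[OF finK])
      also have "\<dots> \<le> liminf (\<lambda>n. (ennreal \<kappa>)\<^sup>2 * (ennreal D * ((a n)\<^sup>2 * (b n)\<^sup>2)))"
      proof (intro Liminf_mono always_eventually allI)
        fix n
        have "(\<Sum>k\<in>freqs N. \<integral>\<^sup>+x. (ennreal \<kappa> * (ennreal (jbr x powr (-(1/2))) * bilin N \<sigma> (?F n) (?G n) k x))\<^sup>2 \<partial>lborel)
          = (\<Sum>k\<in>freqs N. (ennreal \<kappa>)\<^sup>2 * (\<integral>\<^sup>+x. (ennreal (jbr x powr (-(1/2))) * bilin N \<sigma> (?F n) (?G n) k x)\<^sup>2 \<partial>lborel))"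
          unfolding power_mult_distrib[of "ennreal \<kappa>"] by (intro sum.cong refl nn_integral_cmult) measurable
        also have "\<dots> \<le> (ennreal \<kappa>)\<^sup>2 * (ennreal D * ((a n)\<^sup>2 * (b n)\<^sup>2))"
          unfolding sum_distrib_left[symmetric] by (intro mult_left_mono est1) simp
        finally show "(\<Sum>k\<in>freqs N. \<integral>\<^sup>+x. (ennreal \<kappa> * (ennreal (jbr x powr (-(1/2))) * bilin N \<sigma> (?F n) (?G n) k x))\<^sup>2 \<partial>lborel) \<le> \<dots>" .
      qed
      finally show "mass (freqs N) (xdens N \<sigma> s (-1/2) w) \<le> M\<^sup>2" unfolding lim .
    qed
    let ?Y = "\<lambda>k. \<integral>\<^sup>+\<tau>. ennreal (jbr (of_int k) powr s * jbr (\<tau> - \<sigma> * disp N k) powr (-1) * cmod (st_fourier N w \<tau> k)) \<partial>lborel"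
    have Y: "ennsqrt (\<Sum>k\<in>freqs N. (?Y k)\<^sup>2) \<le> M"
    proof (rule ennsqrt_le)
      let ?S = "\<lambda>n k. \<integral>\<^sup>+x. ennreal \<kappa> * (ennreal (jbr x powr (-1)) * bilin N \<sigma> (?F n) (?G n) k x) \<partial>lborel"
      have "?Y k \<le> liminf (\<lambda>n. ?S n k)" if k: "k \<in> freqs N" for k
      proof -
        note [measurable] = wm[OF k]
        have "?Y k = (\<integral>\<^sup>+x. ennreal (jbr x powr (-1) * (jbr (of_int k) powr s * cmod (st_fourier N w (x + \<sigma> * disp N k) k))) \<partial>lborel)"
          by (subst nn_integral_shift[where a = "\<sigma> * disp N k", symmetric]) (simp_all add: mult_ac)
        also have "\<dots> \<le> (\<integral>\<^sup>+x. liminf (\<lambda>n. ennreal \<kappa> * (ennreal (jbr x powr (-1)) * bilin N \<sigma> (?F n) (?G n) k x)) \<partial>lborel)"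
          by (intro nn_integral_mono pt[OF k]) simp
        also have "\<dots> \<le> liminf (\<lambda>n. ?S n k)" by (rule nn_integral_liminf) measurable
        finally show ?thesis .
      qed
      then have "(\<Sum>k\<in>freqs N. (?Y k)\<^sup>2) \<le> (\<Sum>k\<in>freqs N. liminf (\<lambda>n. (?S n k)\<^sup>2))"
        by (intro sum_mono le_liminf_square)
      also have "\<dots> \<le> liminf (\<lambda>n. \<Sum>k\<in>freqs N. (?S n k)\<^sup>2)" by (rule sum_liminf_le[OF finK])
      also have "\<dots> \<le> liminf (\<lambda>n. (ennreal \<kappa>)\<^sup>2 * (ennreal D * ((a n)\<^sup>2 * (b n)\<^sup>2)))"
      proof (intro Liminf_mono always_eventually allI)
        fix n
        have "(?S n k)\<^sup>2 = (ennreal \<kappa>)\<^sup>2 * (\<integral>\<^sup>+x. ennreal (jbr x powr (-1)) * bilin N \<sigma> (?F n) (?G n) k x \<partial>lborel)\<^sup>2" for k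
          by (subst nn_integral_cmult, measurable) (simp add: power_mult_distrib)
        then have "(\<Sum>k\<in>freqs N. (?S n k)\<^sup>2) = (ennreal \<kappa>)\<^sup>2 * (\<Sum>k\<in>freqs N. (\<integral>\<^sup>+x. ennreal (jbr x powr (-1)) * bilin N \<sigma> (?F n) (?G n) k x \<partial>lborel)\<^sup>2)"
          by (simp only: sum_distrib_left)
        also have "\<dots> \<le> (ennreal \<kappa>)\<^sup>2 * (ennreal D * ((a n)\<^sup>2 * (b n)\<^sup>2))"
          by (intro mult_left_mono est2) simp
        finally show "(\<Sum>k\<in>freqs N. (?S n k)\<^sup>2) \<le> \<dots>" .
      qed
      finally show "(\<Sum>k\<in>freqs N. (?Y k)\<^sup>2) \<le> M\<^sup>2" unfolding lim .
    qed
    have "Z_norm N \<sigma> s w \<le> M + M" unfolding Z_norm_def by (intro add_mono X Y)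
    also have "\<dots> = ennreal (C * mesh N powr (s' - s)) * xu * xv"
    proof -
      have "C * mesh N powr (s' - s) = \<kappa> * sqrt D + \<kappa> * sqrt D" by (simp add: C_def \<kappa>_def)
      moreover have "0 \<le> \<kappa> * sqrt D" using k0 D by simp
      ultimately have "ennreal (C * mesh N powr (s' - s)) = ennreal (\<kappa> * sqrt D) + ennreal (\<kappa> * sqrt D)"
        by (simp only: ennreal_plus)
      then show ?thesis by (simp only: M_def distrib_right)
    qed
    finally show "Z_norm N \<sigma> s (\<lambda>t. nabla_h N (\<lambda>x. u t x * exp_partial_h N (\<sigma> * (2 * t / (mesh N)\<^sup>2)) (v t) x))
        \<le> ennreal (C * mesh N powr (s' - s)) * X_norm N \<sigma> s' (1/2) u * X_norm N (-\<sigma>) s' (1/2) v"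
      unfolding w_def nonlin_def xu_def xv_def .
  qed
qed

end
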